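(* Let $\Omega\subset\mathbb{C}$ be open and connected and let $T=\begin{pmatrix} T_0 & S_{0,1}\\ 0 & T_1\end{pmatrix}\in\mathcal{F}B_2(\Omega)$. Then $\operatorname{trace}\mathcal{K}_T=\mathcal{K}_{T_0}+\mathcal{K}_{T_1}$ on $\Omega$ if and only if there exists a holomorphic function $\phi$ on $\Omega$ with $|\phi(w)|>1$ for all $w\in\Omega$ such that $$\mathcal{K}_{T_0}=\frac{|\phi|^2}{1-|\phi|^2}\,\theta_{0,1}(T)^2\quad\text{on }\Omega.$$
   Context: For a connected open set $\Omega\subset\mathbb{C}$ and a complex separable Hilbert space $\mathcal H$, $B_n(\Omega)$ is the set of bounded operators $T$ on $\mathcal H$ with (1) $\Omega\subset\sigma(T)$; (2) $\dim\ker(T-w)=n$ for $w\in\Omega$; (3) $\bigvee_{w\in\Omega}\ker(T-w)=\mathcal H$ (closed linear span); (4) $\operatorname{ran}(T-w)=\mathcal H$ for $w\in\Omega$. For $T\in B_n(\Omega)$, $\mathcal{E}_T=\{(w,x)\in\Omega\times\mathcal H: x\in\ker(T-w)\}$ is a Hermitian holomorphic vector bundle of rank $n$ over $\Omega$. The curvature of a Hermitian holomorphic bundle with holomorphic frame $\{\gamma_1,\dots,\gamma_n\}$ and Gram matrix $h(w)=(\langle\gamma_j(w),\gamma_i(w)\rangle)_{i,j}$ is $\mathcal K(w)=-\frac{\partial}{\partial\overline w}\big(h^{-1}\frac{\partial h}{\partial w}\big)$; for a line bundle with non-vanishing holomorphic section $\gamma$ it is $-\frac{\partial^2}{\partial\overline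 w\partial w}\log\|\gamma(w)\|^2$. $\mathcal K_T$ denotes the curvature of $\mathcal{E}_T$. The class $\mathcal{F}B_2(\Omega)$ consists of the operators $T=\begin{pmatrix} T_0&S_{0,1}\\0&T_1\end{pmatrix}$ on $\mathcal H_0\oplus\mathcal H_1$ with $T_0\in B_1(\Omega)$ on $\mathcal H_0$, $T_1\in B_1(\Omega)$ on $\mathcal H_1$, and $S_{0,1}:\mathcal H_1\to\mathcal H_0$ a non-zero bounded operator with $T_0S_{0,1}=S_{0,1}T_1$; such $T$ belong to $B_2(\Omega)$. The second fundamental form of $\mathcal{E}_{T_0}$ in $\mathcal{E}_T$ is, identified with its coefficient of $d\bar z$, $$\theta_{0,1}(T)(z)=\frac{\mathcal K_{T_0}(z)}{\Big(\frac{\|t_1(z)\|^2}{\|S_{0,1}t_1(z)\|^2}-\mathcal K_{T_0}(z)\Big)^{1/2}},$$ where $t_1$ is a non-vanishing holomorphic section of $\mathcal{E}_{T_1}$ (the value does not depend on the choice of $t_1$; it is read as $0$ at points where $S_{0,1}t_1(z)=0$). *)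

theory Defs
  imports "HOL-Complex_Analysis.Complex_Analysis"
begin

text \<open>
  The underlying real normed space is complete (class \<open>banach\<close>); the inner product is linear in
  its first argument and induces the norm. Separability is the additional sort constraint
  \<open>second_countable_topology\<close>, which for metric spaces is equivalent to it. The Hilbert space direct
  sum is the product type, whose norm is \<open>sqrt ((norm x)\<^sup>2 + (norm y)\<^sup>2)\<close>.
\<close>

class complex_hilbert_space = banach +
  fixes cscale :: "complex \<Rightarrow> 'a \<Rightarrow> 'a"  (infixr "*\<^sub>C" 75)
    and cinner :: "'a \<Rightarrow> 'a \<Rightarrow> complex"
  assumes cscale_add_right: "a *\<^sub>C (x + y) = a *\<^sub>C x + a *\<^sub>C y"
    and cscale_add_left: "(a + b) *\<^sub>C x = a *\<^sub>C x + b *\<^sub>C x"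
    and cscale_cscale: "a *\<^sub>C (b *\<^sub>C x) = (a * b) *\<^sub>C x"
    and cscale_of_real: "complex_of_real r *\<^sub>C x = r *\<^sub>R x"
    and cinner_commute: "cinner x y = cnj (cinner y x)"
    and cinner_add_left: "cinner (x + y) z = cinner x z + cinner y z"
    and cinner_cscale_left: "cinner (a *\<^sub>C x) y = a * cinner x y"
    and cinner_same: "cinner x x = complex_of_real ((norm x)\<^sup>2)"

instantiation prod :: (complex_hilbert_space, complex_hilbert_space) complex_hilbert_space
begin

definition cscale_prod :: "complex \<Rightarrow> 'a \<times> 'b \<Rightarrow> 'a \<times> 'b" where
  "cscale_prod a p = (a *\<^sub>C fst p, a *\<^sub>C snd p)"

definition cinner_prod :: "'a \<times> 'b \<Rightarrow> 'a \<times> 'b \<Rightarrow> complex" where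
  "cinner_prod p q = cinner (fst p) (fst q) + cinner (snd p) (snd q)"

instance
proof
  fix a b :: complex and r :: real and x y z :: "'a \<times> 'b"
  show "a *\<^sub>C (x + y) = a *\<^sub>C x + a *\<^sub>C y"
    by (simp add: cscale_prod_def cscale_add_right)
  show "(a + b) *\<^sub>C x = a *\<^sub>C x + b *\<^sub>C x"
    by (simp add: cscale_prod_def cscale_add_left)
  show "a *\<^sub>C (b *\<^sub>C x) = (a * b) *\<^sub>C x"
    by (simp add: cscale_prod_def cscale_cscale)
  show "complex_of_real r *\<^sub>C x = r *\<^sub>R x"
    by (simp add: cscale_prod_def cscale_of_real scaleR_prod_def)
  show "cinner x y = cnj (cinner y x)"
    by (simp add: cinner_prod_def cinner_commute[of "fst x"] cinner_commute[of "snd x"])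
  show "cinner (x + y) z = cinner x z + cinner y z"
    by (simp add: cinner_prod_def cinner_add_left)
  show "cinner (a *\<^sub>C x) y = a * cinner x y"
    by (simp add: cinner_prod_def cscale_prod_def cinner_cscale_left distrib_left)
  show "cinner x x = complex_of_real ((norm x)\<^sup>2)"
    by (simp add: cinner_prod_def cinner_same norm_prod_def)
qed

end

global_interpretation cvec: vector_space "cscale :: complex \<Rightarrow> 'a \<Rightarrow> 'a::complex_hilbert_space"
proof
  fix a b :: complex and x y :: 'a
  show "a *\<^sub>C (x + y) = a *\<^sub>C x + a *\<^sub>C y" by (rule cscale_add_right)
  show "(a + b) *\<^sub>C x = a *\<^sub>C x + b *\<^sub>C x" by (rule cscale_add_left)
  show "a *\<^sub>C (b *\<^sub>C x) = (a * b) *\<^sub>C x" by (rule cscale_cscale)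
  show "1 *\<^sub>C x = x" using cscale_of_real[of 1 x] by simp
qed

definition bounded_clinear ::
    "('a::complex_hilbert_space \<Rightarrow> 'b::complex_hilbert_space) \<Rightarrow> bool" where
  "bounded_clinear A \<longleftrightarrow> bounded_linear A \<and> (\<forall>c x. A (c *\<^sub>C x) = c *\<^sub>C A x)"

definition vholomorphic_on :: "(complex \<Rightarrow> 'a::complex_hilbert_space) \<Rightarrow> complex set \<Rightarrow> bool"
    (infix "vholomorphic'_on" 50) where
  "f vholomorphic_on U \<longleftrightarrow> (\<forall>z\<in>U. \<exists>D. (f has_derivative (\<lambda>h. h *\<^sub>C D)) (at z within U))"

definition shift_op :: "('a::complex_hilbert_space \<Rightarrow> 'a) \<Rightarrow> complex \<Rightarrow> 'a \<Rightarrow> 'a" where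
  "shift_op T w = (\<lambda>x. T x - w *\<^sub>C x)"

definition kernel :: "('a \<Rightarrow> 'b::zero) \<Rightarrow> 'a set" where
  "kernel A = {x. A x = 0}"

definition op_spectrum :: "('a::complex_hilbert_space \<Rightarrow> 'a) \<Rightarrow> complex set" where
  "op_spectrum T =
     {w. \<not> (\<exists>R. bounded_clinear R \<and> R \<circ> shift_op T w = id \<and> shift_op T w \<circ> R = id)}"

text \<open>
  The requirement \<open>0 < n\<close> is needed because \<open>cvec.dim\<close> is \<open>0\<close> also on infinite-dimensional
  subspaces; for positive \<open>n\<close>, dimension \<open>n\<close> means that there is a basis with \<open>n\<close> elements.
\<close>

definition cowen_douglas ::
    "nat \<Rightarrow> complex set \<Rightarrow>
     ('a::{complex_hilbert_space, second_countable_topology} \<Rightarrow> 'a) set" where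
  "cowen_douglas n \<Omega> = {T. 0 < n \<and> bounded_clinear T \<and>
     \<Omega> \<subseteq> op_spectrum T \<and>
     (\<forall>w\<in>\<Omega>. cvec.dim (kernel (shift_op T w)) = n) \<and>
     closure (cvec.span (\<Union>w\<in>\<Omega>. kernel (shift_op T w))) = UNIV \<and>
     (\<forall>w\<in>\<Omega>. range (shift_op T w) = UNIV)}"

definition block_op ::
    "('a::complex_hilbert_space \<Rightarrow> 'a) \<Rightarrow> ('b::complex_hilbert_space \<Rightarrow> 'a) \<Rightarrow> ('b \<Rightarrow> 'b) \<Rightarrow>
     'a \<times> 'b \<Rightarrow> 'a \<times> 'b" where
  "block_op T0 S01 T1 = (\<lambda>(x, y). (T0 x + S01 y, T1 y))"

text \<open>
  The class is a predicate on the entries of the block matrix, since the curvatures and the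
  second fundamental form refer to them.
\<close>

definition FB2 ::
    "complex set \<Rightarrow> ('a::{complex_hilbert_space, second_countable_topology} \<Rightarrow> 'a) \<Rightarrow>
     ('b::{complex_hilbert_space, second_countable_topology} \<Rightarrow> 'a) \<Rightarrow> ('b \<Rightarrow> 'b) \<Rightarrow> bool" where
  "FB2 \<Omega> T0 S01 T1 \<longleftrightarrow>
     T0 \<in> cowen_douglas 1 \<Omega> \<and> T1 \<in> cowen_douglas 1 \<Omega> \<and>
     bounded_clinear S01 \<and> S01 \<noteq> (\<lambda>_. 0) \<and> T0 \<circ> S01 = S01 \<circ> T1"

text \<open>
  The Wirtinger operators; \<open>frechet_derivative f (at w)\<close> applied to \<open>1\<close> and \<open>\<i>\<close> gives the partial
  derivatives with respect to the real and imaginary part.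
\<close>

definition dz :: "(complex \<Rightarrow> complex) \<Rightarrow> complex \<Rightarrow> complex" where
  "dz f w = (frechet_derivative f (at w) 1 - \<i> * frechet_derivative f (at w) \<i>) / 2"

definition dzbar :: "(complex \<Rightarrow> complex) \<Rightarrow> complex \<Rightarrow> complex" where
  "dzbar f w = (frechet_derivative f (at w) 1 + \<i> * frechet_derivative f (at w) \<i>) / 2"

definition gram :: "('n::finite \<Rightarrow> complex \<Rightarrow> 'a::complex_hilbert_space) \<Rightarrow> complex \<Rightarrow> complex^'n^'n"
  where "gram \<gamma> w = (\<chi> i j. cinner (\<gamma> j w) (\<gamma> i w))"

definition frame_curvature ::
    "('n::finite \<Rightarrow> complex \<Rightarrow> 'a::complex_hilbert_space) \<Rightarrow> complex \<Rightarrow> complex^'n^'n" where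
  "frame_curvature \<gamma> w =
     (\<chi> i j. - dzbar (\<lambda>z. (matrix_inv (gram \<gamma> z) ** (\<chi> k l. dz (\<lambda>u. gram \<gamma> u $ k $ l) z)) $ i $ j) w)"

definition section_curvature :: "(complex \<Rightarrow> 'a::complex_hilbert_space) \<Rightarrow> complex \<Rightarrow> complex" where
  "section_curvature \<gamma> w = - dzbar (dz (\<lambda>z. complex_of_real (ln ((norm (\<gamma> z))\<^sup>2)))) w"

text \<open>
  Holomorphic frames of the eigenvector bundle of \<open>T\<close> over an open subset \<open>U\<close> of \<open>\<Omega>\<close>. The bundle
  is a subbundle of the trivial bundle, so its holomorphic sections are the holomorphic functions
  with values in the eigenspaces. A frame of a line bundle is a non-vanishing section.
\<close>

definition hol_frame ::
    "complex set \<Rightarrow> ('a::complex_hilbert_space \<Rightarrow> 'a) \<Rightarrow> complex set \<Rightarrow>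
     ('n::finite \<Rightarrow> complex \<Rightarrow> 'a) \<Rightarrow> bool" where
  "hol_frame \<Omega> T U \<gamma> \<longleftrightarrow> open U \<and> U \<subseteq> \<Omega> \<and> (\<forall>i. \<gamma> i vholomorphic_on U) \<and>
     (\<forall>w\<in>U. inj (\<lambda>i. \<gamma> i w) \<and> cvec.independent (range (\<lambda>i. \<gamma> i w)) \<and>
            cvec.span (range (\<lambda>i. \<gamma> i w)) = kernel (shift_op T w))"

definition nonvanishing_section ::
    "complex set \<Rightarrow> ('a::complex_hilbert_space \<Rightarrow> 'a) \<Rightarrow> complex set \<Rightarrow> (complex \<Rightarrow> 'a) \<Rightarrow> bool" where
  "nonvanishing_section \<Omega> T U \<gamma> \<longleftrightarrow> open U \<and> U \<subseteq> \<Omega> \<and> \<gamma> vholomorphic_on U \<and>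
     (\<forall>w\<in>U. \<gamma> w \<in> kernel (shift_op T w) \<and> \<gamma> w \<noteq> 0)"

text \<open>
  The curvature at \<open>w\<close> is computed in some holomorphic frame on a neighbourhood of \<open>w\<close>. Changing
  the frame conjugates the curvature matrix, so its trace does not depend on the choice, and
  neither does the curvature of a line bundle.
\<close>

definition local_frame ::
    "complex set \<Rightarrow> ('a::complex_hilbert_space \<Rightarrow> 'a) \<Rightarrow> complex \<Rightarrow> ('n::finite \<Rightarrow> complex \<Rightarrow> 'a)" where
  "local_frame \<Omega> T w = (SOME \<gamma>. \<exists>U. w \<in> U \<and> hol_frame \<Omega> T U \<gamma>)"

definition local_section ::
    "complex set \<Rightarrow> ('a::complex_hilbert_space \<Rightarrow> 'a) \<Rightarrow> complex \<Rightarrow> (complex \<Rightarrow> 'a)" where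
  "local_section \<Omega> T w = (SOME \<gamma>. \<exists>U. w \<in> U \<and> nonvanishing_section \<Omega> T U \<gamma>)"

definition curvature ::
    "complex set \<Rightarrow> ('a::complex_hilbert_space \<Rightarrow> 'a) \<Rightarrow> complex \<Rightarrow> complex^'n::finite^'n" where
  "curvature \<Omega> T w = frame_curvature (local_frame \<Omega> T w) w"

definition line_curvature ::
    "complex set \<Rightarrow> ('a::complex_hilbert_space \<Rightarrow> 'a) \<Rightarrow> complex \<Rightarrow> complex" where
  "line_curvature \<Omega> T w = section_curvature (local_section \<Omega> T w) w"

text \<open>
  The quotient \<open>(norm (t1 z))\<^sup>2 / (norm (S01 (t1 z)))\<^sup>2\<close> does not
  depend on the section \<open>t1\<close>. The radicand is a positive real number (the curvature of the line
  bundle is real and nonpositive), so \<open>csqrt\<close> is the ordinary square root. The first branch is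
  not subsumed by the second, because division by zero yields zero.
\<close>

definition second_fundamental_form ::
    "complex set \<Rightarrow> ('a::complex_hilbert_space \<Rightarrow> 'a) \<Rightarrow> ('b::complex_hilbert_space \<Rightarrow> 'a) \<Rightarrow>
     ('b \<Rightarrow> 'b) \<Rightarrow> complex \<Rightarrow> complex" where
  "second_fundamental_form \<Omega> T0 S01 T1 z =
     (let t1 = local_section \<Omega> T1 z; K0 = line_curvature \<Omega> T0 z
      in if S01 (t1 z) = 0 then 0
         else K0 / csqrt (complex_of_real ((norm (t1 z))\<^sup>2 / (norm (S01 (t1 z)))\<^sup>2) - K0))"

end

theory Submission
  imports Defs
begin

text \<open>
  Let \<open>(x\<^sub>0, 0)\<close>, \<open>(y, x\<^sub>1)\<close> be a local holomorphic frame of the eigenvector bundle of the block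
  operator and \<open>h\<close> its Gram matrix. Then \<open>det h = \<parallel>x\<^sub>0\<parallel>\<^sup>2 \<parallel>x\<^sub>1\<parallel>\<^sup>2 v\<close> with
  \<open>v = 1 - \<K>\<^sub>0 \<parallel>S x\<^sub>1\<parallel>\<^sup>2 / \<parallel>x\<^sub>1\<parallel>\<^sup>2\<close>, a function on \<open>\<Omega>\<close> that does not depend on the frame.
  Since the trace of the curvature is \<open>- \<partial>\<partial>' log (det h)\<close>, where \<open>\<partial>'\<close> is the conjugate of \<open>\<partial>\<close>,
  the trace formula says that \<open>log v\<close> is harmonic. As \<open>\<K>\<^sub>0 < 0\<close>, the equation for the second
  fundamental form says that \<open>v = \<bar>\<phi>\<bar>\<^sup>2\<close>. So one has to find a global \<open>\<phi>\<close> if \<open>log v\<close> is harmonic,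
  although \<open>\<Omega>\<close> need not be simply connected. Locally \<open>\<phi>\<close> exists, and polarizing \<open>v = \<bar>\<phi>\<bar>\<^sup>2\<close> at a
  point \<open>w\<close> expresses \<open>\<phi>\<close> up to a constant through inner products of the frames at \<open>z\<close> and \<open>w\<close>;
  this quotient is single-valued on \<open>\<Omega>\<close>, so there is no monodromy. Finally \<open>\<bar>\<phi>\<bar> \<ge> 1\<close>, and
  equality somewhere would force \<open>v = 1\<close> by the maximum principle, hence \<open>S = 0\<close>.
\<close>

section \<open>Complex Hilbert spaces\<close>

text \<open>The curvatures are computed in frames picked by \<open>SOME\<close>, for which only one
  complex derivative per section is given, while curvature takes two. So reference frames with two
  explicit derivatives are built from power series, and the chosen frames are expanded in them. The
  coefficients are scalar holomorphic functions and carry all further derivatives; the change of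
  frame multiplies the Gram determinant by the squared modulus of a non-vanishing holomorphic
  function, which the Laplacian of the logarithm does not see. The single-valued quotient has the
  denominator \<open>cinner (x0 z) (x0 w) * cinner (x1 z) (x1 w)\<close>, which may vanish away from
  \<open>w\<close>. The quotient thus lives on a set \<open>G\<close>, and a priori there could be
  regions without points of \<open>G\<close>. The continuation therefore carries the density of
  \<open>G\<close> along with the modulus identity: a local denominator that is holomorphic and not
  identically zero on a ball vanishes on no open subset of it.\<close>

lemma cinner_add_right: "cinner x (y + z) = cinner x y + cinner x z"
  by (metis cinner_add_left cinner_commute complex_cnj_add)

lemma cinner_cscale_right: "cinner x (a *\<^sub>C y) = cnj a * cinner x y"
  by (metis cinner_commute cinner_cscale_left complex_cnj_mult)

lemma cinner_zero_left [simp]: "cinner 0 y = 0"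
  using cinner_add_left[of 0 0 y] by simp

lemma cinner_zero_right [simp]: "cinner x 0 = 0"
  using cinner_add_right[of x 0 0] by simp

lemma cinner_minus_left: "cinner (- x) y = - cinner x y"
  using cinner_add_left[of x "- x" y] by (simp add: add_eq_0_iff2)

lemma cinner_minus_right: "cinner x (- y) = - cinner x y"
  using cinner_add_right[of x y "- y"] by (simp add: add_eq_0_iff2)

lemma cinner_diff_left: "cinner (x - y) z = cinner x z - cinner y z"
  using cinner_add_left[of x "- y" z] by (simp add: cinner_minus_left)

lemma cinner_diff_right: "cinner x (y - z) = cinner x y - cinner x z"
  using cinner_add_right[of x y "- z"] by (simp add: cinner_minus_right)

lemma cinner_scaleR_left: "cinner (r *\<^sub>R x) y = r *\<^sub>R cinner x y"
  by (metis cinner_cscale_left cscale_of_real scaleR_conv_of_real)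

lemma cinner_scaleR_right: "cinner x (r *\<^sub>R y) = r *\<^sub>R cinner x y"
  by (metis cinner_cscale_right complex_cnj_complex_of_real cscale_of_real scaleR_conv_of_real)

lemma cinner_eq_zero_iff [simp]: "cinner x x = 0 \<longleftrightarrow> x = 0"
  by (simp add: cinner_same)

lemma norm_cscale: "norm (c *\<^sub>C x) = cmod c * norm x"
proof -
  have "complex_of_real ((norm (c *\<^sub>C x))\<^sup>2) = c * cnj c * cinner x x"
    by (simp only: cinner_same[symmetric] cinner_cscale_left cinner_cscale_right) simp
  also have "\<dots> = complex_of_real ((cmod c * norm x)\<^sup>2)"
    unfolding cinner_same complex_mult_cnj cmod_power2[symmetric]
    by (simp add: power_mult_distrib)
  finally have "(norm (c *\<^sub>C x))\<^sup>2 = (cmod c * norm x)\<^sup>2"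
    using of_real_eq_iff by blast
  then show ?thesis by (simp add: power2_eq_iff_nonneg)
qed

lemma cinner_mult_commute: "cinner x y * cinner y x = complex_of_real ((cmod (cinner x y))\<^sup>2)"
  unfolding cinner_commute[of y x] complex_norm_square by simp

text \<open>The vector is \<open>(norm x)\<^sup>2\<close> times the component of \<open>y\<close>
  orthogonal to \<open>x\<close>. Scaling by \<open>cinner x x\<close> instead of dividing keeps the
  identity valid for \<open>x = 0\<close>.\<close>

lemma gram_residual:
  "cinner (cinner x x *\<^sub>C y - cinner y x *\<^sub>C x) (cinner x x *\<^sub>C y - cinner y x *\<^sub>C x) =
     cinner x x * (cinner x x * cinner y y - cinner x y * cinner y x)"
  unfolding cinner_diff_left cinner_diff_right cinner_cscale_left cinner_cscale_right
    cinner_commute[of x x, symmetric] cinner_commute[of x y, symmetric]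
  by (simp add: algebra_simps)

lemma cauchy_schwarz_residual:
  "(norm ((complex_of_real ((norm x)\<^sup>2)) *\<^sub>C y - cinner y x *\<^sub>C x))\<^sup>2 =
     (norm x)\<^sup>2 * ((norm x)\<^sup>2 * (norm y)\<^sup>2 - (cmod (cinner x y))\<^sup>2)"
  using gram_residual[of x y, unfolded cinner_mult_commute]
  unfolding cinner_same of_real_mult[symmetric] of_real_diff[symmetric] of_real_eq_iff .

lemma cinner_cauchy_schwarz: "cmod (cinner x y) \<le> norm x * norm y"
proof (cases "x = 0")
  case False
  have "0 \<le> (norm x)\<^sup>2 * ((norm x)\<^sup>2 * (norm y)\<^sup>2 - (cmod (cinner x y))\<^sup>2)"
    by (metis cauchy_schwarz_residual zero_le_power2)
  moreover have "0 < (norm x)\<^sup>2"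
    using False by simp
  ultimately have "(cmod (cinner x y))\<^sup>2 \<le> (norm x * norm y)\<^sup>2"
    by (simp only: zero_le_mult_iff power_mult_distrib) linarith
  then show ?thesis by (rule power2_le_imp_le) simp
qed simp

text \<open>Equality makes the orthogonal residual vanish, so \<open>y\<close> is a multiple of
  \<open>x\<close>. The strict form is what makes the curvature of \<open>T0\<close> strictly
  negative.\<close>

lemma cinner_cauchy_schwarz_strict:
  assumes "x \<noteq> 0" and "\<And>c. y \<noteq> c *\<^sub>C x"
  shows "(cmod (cinner x y))\<^sup>2 < (norm x)\<^sup>2 * (norm y)\<^sup>2"
proof (rule ccontr)
  define n where "n = complex_of_real ((norm x)\<^sup>2)"
  have n: "n \<noteq> 0" using assms(1) by (simp add: n_def)
  assume "\<not> ?thesis"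
  then have "(norm x)\<^sup>2 * ((norm x)\<^sup>2 * (norm y)\<^sup>2 - (cmod (cinner x y))\<^sup>2) \<le> 0"
    by (intro mult_nonneg_nonpos) auto
  then have "(norm (n *\<^sub>C y - cinner y x *\<^sub>C x))\<^sup>2 \<le> 0"
    unfolding n_def cauchy_schwarz_residual .
  then have eq: "n *\<^sub>C y = cinner y x *\<^sub>C x"
    by simp
  have "y = inverse n *\<^sub>C n *\<^sub>C y"
    using n by (simp add: cscale_cscale)
  also have "\<dots> = (inverse n * cinner y x) *\<^sub>C x"
    unfolding eq cscale_cscale ..
  finally show False using assms(2) by blast
qed

lemma bounded_bilinear_cinner: "bounded_bilinear (cinner :: 'a::complex_hilbert_space \<Rightarrow> 'a \<Rightarrow> complex)"
  by standard
    (auto simp: cinner_add_left cinner_add_right cinner_scaleR_left cinner_scaleR_right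
      intro!: exI[of _ 1] cinner_cauchy_schwarz)

lemma cscale_scaleR_left: "(r *\<^sub>R c) *\<^sub>C x = r *\<^sub>R (c *\<^sub>C x)"
  by (metis cscale_cscale cscale_of_real scaleR_conv_of_real)

lemma cscale_scaleR_right: "c *\<^sub>C (r *\<^sub>R x) = r *\<^sub>R (c *\<^sub>C x)"
  by (metis cscale_cscale cscale_of_real mult.commute)

lemma bounded_bilinear_cscale: "bounded_bilinear (cscale :: complex \<Rightarrow> 'a \<Rightarrow> 'a::complex_hilbert_space)"
  by standard
    (auto simp: cscale_add_left cscale_add_right cscale_scaleR_left cscale_scaleR_right norm_cscale
      intro!: exI[of _ 1])

lemma bounded_clinear_fst:
    "bounded_clinear (fst :: 'a::complex_hilbert_space \<times> 'b::complex_hilbert_space \<Rightarrow> 'a)"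
  and bounded_clinear_snd:
    "bounded_clinear (snd :: 'a::complex_hilbert_space \<times> 'b::complex_hilbert_space \<Rightarrow> 'b)"
  by (auto simp: bounded_clinear_def cscale_prod_def bounded_linear_fst bounded_linear_snd)

section \<open>Wirtinger derivatives\<close>

text \<open>Every real-linear self-map of the plane has this form. Carrying differentiability in a
  predicate matters because \<open>dz\<close> and \<open>dzbar\<close> rest on
  \<open>frechet_derivative\<close>, a choice that is arbitrary at points where \<open>f\<close> is
  not differentiable.\<close>

definition has_wirtinger :: "(complex \<Rightarrow> complex) \<Rightarrow> complex \<Rightarrow> complex \<Rightarrow> complex \<Rightarrow> bool" where
  "has_wirtinger f a b z \<longleftrightarrow> (f has_derivative (\<lambda>h. h * a + cnj h * b)) (at z)"

lemma has_wirtinger_dz: "has_wirtinger f a b z \<Longrightarrow> dz f z = a"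
  and has_wirtinger_dzbar: "has_wirtinger f a b z \<Longrightarrow> dzbar f z = b"
proof -
  assume "has_wirtinger f a b z"
  then have "frechet_derivative f (at z) = (\<lambda>h. h * a + cnj h * b)"
    unfolding has_wirtinger_def by (metis frechet_derivative_at)
  then show "dz f z = a" "dzbar f z = b"
    by (simp_all add: dz_def dzbar_def algebra_simps)
qed

lemma has_wirtinger_transform:
  assumes "has_wirtinger f a b z" "open V" "z \<in> V" "\<And>u. u \<in> V \<Longrightarrow> f u = g u"
  shows "has_wirtinger g a b z"
  using assms unfolding has_wirtinger_def by (blast intro: has_derivative_transform_within_open)

lemma dzbar_cong:
  assumes "open V" "z \<in> V" "\<And>u. u \<in> V \<Longrightarrow> f u = g u"
  shows "dzbar f z = dzbar g z"
proof -
  have "(f has_derivative D) (at z) \<longleftrightarrow> (g has_derivative D) (at z)" for D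
    using has_derivative_transform_within_open[OF _ assms(1,2), of f D UNIV g]
      has_derivative_transform_within_open[OF _ assms(1,2), of g D UNIV f] assms(3) by auto
  then show ?thesis by (simp add: dzbar_def frechet_derivative_def)
qed

lemma dz_cong:
  assumes "open V" "z \<in> V" "\<And>u. u \<in> V \<Longrightarrow> f u = g u"
  shows "dz f z = dz g z"
proof -
  have "(f has_derivative D) (at z) \<longleftrightarrow> (g has_derivative D) (at z)" for D
    using has_derivative_transform_within_open[OF _ assms(1,2), of f D UNIV g]
      has_derivative_transform_within_open[OF _ assms(1,2), of g D UNIV f] assms(3) by auto
  then show ?thesis by (simp add: dz_def frechet_derivative_def)
qed

lemma has_wirtinger_holomorphic:
  "(f has_field_derivative f') (at z) \<longleftrightarrow> has_wirtinger f f' 0 z"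
  unfolding has_wirtinger_def has_field_derivative_def
  by (simp add: mult.commute[of _ f'])

lemma has_wirtinger_const: "has_wirtinger (\<lambda>_. c) 0 0 z"
  by (simp add: has_wirtinger_def)

lemma has_wirtinger_add:
  "has_wirtinger f a b z \<Longrightarrow> has_wirtinger g c d z \<Longrightarrow> has_wirtinger (\<lambda>z. f z + g z) (a + c) (b + d) z"
  unfolding has_wirtinger_def
  by (drule (1) has_derivative_add, erule has_derivative_eq_rhs) (simp add: fun_eq_iff algebra_simps)

lemma has_wirtinger_diff:
  "has_wirtinger f a b z \<Longrightarrow> has_wirtinger g c d z \<Longrightarrow> has_wirtinger (\<lambda>z. f z - g z) (a - c) (b - d) z"
  unfolding has_wirtinger_def
  by (drule (1) has_derivative_diff, erule has_derivative_eq_rhs) (simp add: fun_eq_iff algebra_simps)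

lemma has_wirtinger_mult:
  "has_wirtinger f a b z \<Longrightarrow> has_wirtinger g c d z \<Longrightarrow>
   has_wirtinger (\<lambda>z. f z * g z) (a * g z + f z * c) (b * g z + f z * d) z"
  unfolding has_wirtinger_def
  by (drule (1) has_derivative_mult, erule has_derivative_eq_rhs) (simp add: fun_eq_iff algebra_simps)

lemma has_wirtinger_divide:
  "has_wirtinger f a b z \<Longrightarrow> has_wirtinger g c d z \<Longrightarrow> g z \<noteq> 0 \<Longrightarrow>
   has_wirtinger (\<lambda>z. f z / g z) ((a * g z - f z * c) / (g z)\<^sup>2) ((b * g z - f z * d) / (g z)\<^sup>2) z"
  unfolding has_wirtinger_def
  by (drule (2) has_derivative_divide', erule has_derivative_eq_rhs)
     (simp add: fun_eq_iff divide_simps power2_eq_square, simp add: algebra_simps)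

lemma has_wirtinger_cnj:
  "has_wirtinger f a b z \<Longrightarrow> has_wirtinger (\<lambda>z. cnj (f z)) (cnj b) (cnj a) z"
  unfolding has_wirtinger_def
  by (drule has_derivative_cnj, erule has_derivative_eq_rhs) (simp add: fun_eq_iff algebra_simps)

section \<open>Complex derivatives of functions with values in a Hilbert space\<close>

definition has_cderiv :: "(complex \<Rightarrow> 'a::complex_hilbert_space) \<Rightarrow> 'a \<Rightarrow> complex \<Rightarrow> bool" where
  "has_cderiv f D z \<longleftrightarrow> (f has_derivative (\<lambda>h. h *\<^sub>C D)) (at z)"

lemma has_cderiv_transform:
  assumes "has_cderiv f D z" "open V" "z \<in> V" "\<And>u. u \<in> V \<Longrightarrow> f u = g u"
  shows "has_cderiv g D z"
  using assms unfolding has_cderiv_def by (blast intro: has_derivative_transform_within_open)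

lemma has_cderiv_continuous: "has_cderiv f D z \<Longrightarrow> continuous (at z) f"
  unfolding has_cderiv_def by (rule has_derivative_continuous)

lemma has_cderiv_add:
  "has_cderiv f D z \<Longrightarrow> has_cderiv g E z \<Longrightarrow> has_cderiv (\<lambda>z. f z + g z) (D + E) z"
  unfolding has_cderiv_def
  by (drule (1) has_derivative_add, erule has_derivative_eq_rhs) (simp add: cscale_add_right)

lemma has_cderiv_cscale:
  "(a has_field_derivative a') (at z) \<Longrightarrow> has_cderiv f D z \<Longrightarrow>
   has_cderiv (\<lambda>z. a z *\<^sub>C f z) (a z *\<^sub>C D + a' *\<^sub>C f z) z"
  unfolding has_cderiv_def has_field_derivative_def
  by (drule (1) bounded_bilinear.FDERIV[OF bounded_bilinear_cscale], erule has_derivative_eq_rhs)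
     (simp add: fun_eq_iff cscale_add_right cscale_cscale mult.commute)

lemma has_cderiv_bounded_clinear:
  "bounded_clinear A \<Longrightarrow> has_cderiv f D z \<Longrightarrow> has_cderiv (\<lambda>z. A (f z)) (A D) z"
  unfolding has_cderiv_def bounded_clinear_def
  by (auto dest: bounded_linear.has_derivative)

lemma has_cderiv_Pair:
  "has_cderiv f D z \<Longrightarrow> has_cderiv g E z \<Longrightarrow> has_cderiv (\<lambda>z. (f z, g z)) (D, E) z"
  unfolding has_cderiv_def
  by (drule (1) has_derivative_Pair, erule has_derivative_eq_rhs) (simp add: cscale_prod_def)

lemma has_cderiv_const: "has_cderiv (\<lambda>z. x) 0 z"
  by (simp add: has_cderiv_def)

text \<open>\<open>cinner\<close> is antilinear in its second slot, so for holomorphic arguments the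
  z-derivative sees only \<open>f\<close> and the conjugate derivative sees only
  \<open>g\<close>.\<close>

lemma has_wirtinger_cinner:
  "has_cderiv f D z \<Longrightarrow> has_cderiv g E z \<Longrightarrow>
   has_wirtinger (\<lambda>z. cinner (f z) (g z)) (cinner D (g z)) (cinner (f z) E) z"
  unfolding has_cderiv_def has_wirtinger_def
  by (drule (1) bounded_bilinear.FDERIV[OF bounded_bilinear_cinner], erule has_derivative_eq_rhs)
     (simp add: fun_eq_iff cinner_cscale_left cinner_cscale_right)

lemma has_cderiv_cinner:
  "has_cderiv f D z \<Longrightarrow> ((\<lambda>z. cinner (f z) x) has_field_derivative cinner D x) (at z)"
  using has_wirtinger_cinner[OF _ has_cderiv_const, of f D z x]
  by (simp add: has_wirtinger_holomorphic)

lemma vholomorphic_on_has_cderiv: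
  "open U \<Longrightarrow> f vholomorphic_on U \<longleftrightarrow> (\<forall>z\<in>U. \<exists>D. has_cderiv f D z)"
  unfolding vholomorphic_on_def has_cderiv_def
  by (intro ball_cong refl) (simp add: at_within_open[of _ U])

section \<open>Holomorphic eigenvectors\<close>

text \<open>The Baire half of the open mapping theorem: the images of the balls of integer radius
  cover the target, so the closure of one of them contains a ball. The error factor 1/2 is what the
  iteration in \<open>surj_bounded_preimage\<close> consumes.\<close>

lemma surj_approximate_preimage:
  fixes A :: "'a::banach \<Rightarrow> 'b::banach"
  assumes A: "bounded_linear A" and surj: "surj A"
  shows "\<exists>K>0. \<forall>y. \<exists>x. norm x \<le> K * norm y \<and> norm (y - A x) \<le> norm y / 2"
proof -
  interpret A: bounded_linear A by fact
  define F where "F n = closure (A ` cball 0 (real n))" for n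
  have "\<exists>n. y \<in> F n" for y
  proof -
    obtain x where "y = A x" using surj by blast
    moreover obtain n where "norm x \<le> real n" using real_arch_simple by blast
    ultimately have "y \<in> A ` cball 0 (real n)" by auto
    then show ?thesis unfolding F_def using closure_subset by blast
  qed
  then have "\<Union>(range F) = UNIV" by auto
  moreover have "interior (\<Union>(range F)) = {}" if empty: "\<And>n. interior (F n) = {}"
  proof -
    have "closedin Met_TC.mtopology T \<and> Met_TC.mtopology interior_of T = {}" if "T \<in> range F" for T
      using that empty by (auto simp: F_def)
    moreover have "Met_TC.mcomplete TYPE('b)" by (simp add: complete_UNIV)
    ultimately show ?thesis
      using Met_TC.metric_Baire_category_alt[of "range F"] by simp
  qed
  ultimately obtain n where "interior (F n) \<noteq> {}" by auto
  then obtain y0 r where r: "r > 0" "ball y0 r \<subseteq> F n"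
    using mem_interior[of _ "F n"] by blast
  \<comment> \<open>\<open>y\<close> is the difference of \<open>y0 + y\<close> and
    \<open>y0\<close>, both in the closure. Approximating each within \<open>e / 2\<close> moves the
    ball to the origin and doubles the norm bound.\<close>
  have near: "\<exists>x. norm x \<le> 2 * real n \<and> norm (y - A x) < e" if y: "norm y < r" and "e > 0" for y e
  proof -
    have "y0 + y \<in> F n" "y0 \<in> F n" using r y by (auto simp: dist_norm subset_iff)
    then have "\<exists>w\<in>A ` cball 0 (real n). dist w (y0 + y) < e / 2"
        "\<exists>w\<in>A ` cball 0 (real n). dist w y0 < e / 2"
      using half_gt_zero[OF \<open>e > 0\<close>] unfolding F_def closure_approachable by blast+
    then obtain u v where u: "norm u \<le> real n" "dist (A u) (y0 + y) < e / 2"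
      and v: "norm v \<le> real n" "dist (A v) y0 < e / 2"
      by auto
    have "norm (y - A (u - v)) = norm ((A v - y0) - (A u - (y0 + y)))"
      by (simp add: A.diff algebra_simps)
    also have "\<dots> \<le> norm (A v - y0) + norm (A u - (y0 + y))" by (rule norm_triangle_ineq4)
    also have "\<dots> < e" using u v by (simp add: dist_norm)
    finally have "norm (y - A (u - v)) < e" .
    moreover have "norm (u - v) \<le> 2 * real n" using u v norm_triangle_ineq4[of u v] by linarith
    ultimately show ?thesis by blast
  qed
  \<comment> \<open>\<open>y\<close> is rescaled to norm \<open>r / 2\<close>, and undoing the
    scaling turns \<open>2 * real n\<close> into \<open>4 * real n / r\<close> times
    \<open>norm y\<close>. The summand 1 keeps \<open>K\<close> positive for
    \<open>n = 0\<close>.\<close>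
  define K where "K = 4 * real n / r + 1"
  have K: "K > 0" using r by (simp add: K_def add_nonneg_pos)
  have "\<exists>x. norm x \<le> K * norm y \<and> norm (y - A x) \<le> norm y / 2" for y
  proof (cases "y = 0")
    case True
    then show ?thesis by (intro exI[of _ 0]) (simp add: A.zero)
  next
    case False
    define c where "c = r / (2 * norm y)"
    have c: "c > 0" using False r by (simp add: c_def)
    have "norm (c *\<^sub>R y) < r" using False r by (simp add: c_def)
    then obtain x where x: "norm x \<le> 2 * real n" "norm (c *\<^sub>R y - A x) < c * (norm y / 2)"
      using near[of "c *\<^sub>R y" "c * (norm y / 2)"] c False by auto
    have "y - A (x /\<^sub>R c) = (c *\<^sub>R y - A x) /\<^sub>R c"
      using c by (simp add: A.scaleR scaleR_diff_right)
    then have "norm (y - A (x /\<^sub>R c)) = norm (c *\<^sub>R y - A x) / c"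
      using c by (simp add: divide_inverse mult.commute)
    also have "\<dots> \<le> norm y / 2"
      using x c by (simp add: pos_divide_le_eq mult.commute)
    finally have 1: "norm (y - A (x /\<^sub>R c)) \<le> norm y / 2" .
    have "norm (x /\<^sub>R c) = norm x / c" using c by (simp add: divide_inverse mult.commute)
    also have "\<dots> \<le> 2 * real n / c" using x c by (simp add: divide_right_mono)
    also have "\<dots> = (4 * real n / r) * norm y" using False r by (simp add: c_def)
    also have "\<dots> \<le> K * norm y" by (intro mult_right_mono) (auto simp: K_def)
    finally show ?thesis using 1 by blast
  qed
  then show ?thesis using K by blast
qed

text \<open>The residual is corrected repeatedly by an approximate preimage. It halves each time, so
  the corrections are dominated by a geometric series with sum \<open>2 * K * norm y\<close> and add
  up to an exact preimage.\<close>

lemma surj_bounded_preimage: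
  fixes A :: "'a::banach \<Rightarrow> 'b::banach"
  assumes A: "bounded_linear A" and surj: "surj A"
  shows "\<exists>M>0. \<forall>y. \<exists>x. A x = y \<and> norm x \<le> M * norm y"
proof -
  interpret A: bounded_linear A by fact
  obtain K where K: "K > 0" and "\<forall>y. \<exists>x. norm x \<le> K * norm y \<and> norm (y - A x) \<le> norm y / 2"
    using surj_approximate_preimage[OF assms] by blast
  then obtain s where s: "\<And>y. norm (s y) \<le> K * norm y" "\<And>y. norm (y - A (s y)) \<le> norm y / 2"
    by metis
  have "\<exists>x. A x = y \<and> norm x \<le> (2 * K) * norm y" for y
  proof -
    define Y where "Y n = ((\<lambda>y. y - A (s y)) ^^ n) y" for n
    have Y0: "Y 0 = y" and YS: "Y (Suc n) = Y n - A (s (Y n))" for n by (simp_all add: Y_def)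
    have Y: "norm (Y n) \<le> norm y * (1/2) ^ n" for n
    proof (induction n)
      case (Suc n)
      have "norm (Y (Suc n)) \<le> norm (Y n) / 2" unfolding YS by (rule s)
      then show ?case using Suc by simp
    qed (simp add: Y0)
    have sY: "norm (s (Y n)) \<le> K * norm y * (1/2) ^ n" for n
      using order_trans[OF s(1)[of "Y n"] mult_left_mono[OF Y[of n], of K]] K by (simp add: mult.assoc)
    have geo: "(\<lambda>n. K * norm y * (1/2) ^ n) sums (K * norm y * 2)"
      using geometric_sums[of "1/2::real"] by (intro sums_mult) simp
    have sm: "summable (\<lambda>n. norm (s (Y n)))"
      by (rule summable_comparison_test'[OF sums_summable[OF geo], of 0]) (simp only: real_norm_def abs_norm_cancel sY)
    define x where "x = (\<Sum>n. s (Y n))"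
    have "(\<lambda>n. s (Y n)) sums x"
      unfolding x_def by (rule summable_sums[OF summable_norm_cancel[OF sm]])
    then have "(\<lambda>n. A (s (Y n))) sums A x" by (rule A.sums)
    moreover have "Y \<longlonglongrightarrow> 0"
    proof (rule Lim_null_comparison)
      show "\<forall>\<^sub>F n in sequentially. norm (Y n) \<le> norm y * (1/2) ^ n" using Y by simp
      show "(\<lambda>n. norm y * (1 / 2) ^ n) \<longlonglongrightarrow> 0"
        using LIMSEQ_power_zero[of "1/2::real"] by (intro tendsto_mult_right_zero) simp
    qed
    then have "(\<lambda>n. Y n - Y (Suc n)) sums (Y 0 - 0)" by (rule telescope_sums')
    then have "(\<lambda>n. A (s (Y n))) sums y" by (simp add: YS Y0)
    ultimately have "A x = y" by (rule sums_unique2)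
    have "norm x \<le> (\<Sum>n. norm (s (Y n)))" unfolding x_def by (rule summable_norm[OF sm])
    also have "\<dots> \<le> (\<Sum>n. K * norm y * (1/2) ^ n)"
      by (intro suminf_le sm sY sums_summable[OF geo])
    also have "\<dots> = (2 * K) * norm y" using sums_unique[OF geo] by simp
    finally show ?thesis using \<open>A x = y\<close> by blast
  qed
  then show ?thesis using K by (intro exI[of _ "2 * K"]) auto
qed

section \<open>Power series with coefficients in a Hilbert space\<close>

lemma vector_power_series:
  fixes x :: "nat \<Rightarrow> 'a::complex_hilbert_space"
  assumes sm: "\<And>r::real. norm r < \<rho> \<Longrightarrow> summable (\<lambda>n. norm (x n) * r ^ n)"
    and z: "z \<in> ball p \<rho>"
  shows "summable (\<lambda>n. (z - p) ^ n *\<^sub>C x n)"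
proof (rule summable_norm_cancel)
  have "norm (norm (z - p)) < \<rho>" using z by (simp add: dist_norm norm_minus_commute)
  from sm[OF this] show "summable (\<lambda>n. norm ((z - p) ^ n *\<^sub>C x n))"
    by (simp add: norm_cscale norm_power mult.commute)
qed

lemma vector_diffs_summable:
  fixes x :: "nat \<Rightarrow> 'a::complex_hilbert_space"
  assumes sm: "\<And>r::real. norm r < \<rho> \<Longrightarrow> summable (\<lambda>n. norm (x n) * r ^ n)" and "norm (r::real) < \<rho>"
  shows "summable (\<lambda>n. norm (real (Suc n) *\<^sub>R x (Suc n)) * r ^ n)"
  using termdiff_converges[OF assms(2), of "\<lambda>n. norm (x n)"] sm by (simp add: diffs_def)

text \<open>Termwise differentiation on a ball of radius strictly between \<open>dist p z\<close>
  and \<open>\<rho>\<close>, where the Weierstrass test applies to the differentiated series. That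
  series satisfies the same hypothesis by \<open>vector_diffs_summable\<close>, so the lemma can be
  applied to it again.\<close>

lemma has_cderiv_power_series:
  fixes x :: "nat \<Rightarrow> 'a::complex_hilbert_space"
  assumes sm: "\<And>r::real. norm r < \<rho> \<Longrightarrow> summable (\<lambda>n. norm (x n) * r ^ n)"
    and z: "z \<in> ball p \<rho>"
  shows "has_cderiv (\<lambda>z. \<Sum>n. (z - p) ^ n *\<^sub>C x n)
           (\<Sum>n. (z - p) ^ n *\<^sub>C (real (Suc n) *\<^sub>R x (Suc n))) z"
proof -
  obtain r where r: "dist p z < r" "r < \<rho>" using z dense[of "dist p z" \<rho>] by auto
  then have r0: "0 < r" using zero_le_dist[of p z] by linarith
  define S where "S = ball p r"
  \<comment> \<open>At \<open>i = 0\<close> the truncated exponent \<open>i - 1\<close> is harmless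
    because of the factor \<open>of_nat i\<close>: the term vanishes and the sum can be reindexed by
    \<open>Suc\<close>.\<close>
  define d where "d i u = (of_nat i * (u - p) ^ (i - 1)) *\<^sub>C x i" for i u
  define M where "M i = real i * r ^ (i - 1) * norm (x i)" for i
  have "summable (\<lambda>i. M (Suc i))"
    using vector_diffs_summable[OF sm, of \<rho> r] r r0 by (simp add: M_def mult.commute mult.left_commute)
  then have M: "summable M" by (simp only: summable_Suc_iff)
  have dM: "norm (d i u) \<le> M i" if "u \<in> S" for i u
    using that unfolding d_def M_def norm_cscale norm_mult norm_power
    by (intro mult_right_mono mult_mono power_mono)
       (auto simp: S_def dist_norm norm_minus_commute)
  have lim: "uniform_limit S (\<lambda>n u. \<Sum>i<n. d i u) (\<lambda>u. \<Sum>i. d i u) sequentially"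
    by (rule Weierstrass_m_test[OF dM M])
  have "\<exists>g. \<forall>u\<in>S. (\<lambda>n. (u - p) ^ n *\<^sub>C x n) sums (g u) \<and>
      (g has_derivative (\<lambda>h. h *\<^sub>C (\<Sum>i. d i u))) (at u within S)"
  proof (rule has_derivative_series[where f' = "\<lambda>i u h. h *\<^sub>C d i u"])
    show "convex S" by (simp add: S_def)
    fix n u
    assume "u \<in> S"
    have "((\<lambda>u. (u - p) ^ n) has_field_derivative of_nat n * (u - p) ^ (n - 1)) (at u)"
      by (auto intro!: derivative_eq_intros)
    from has_cderiv_cscale[OF this has_cderiv_const[of "x n"]]
    show "((\<lambda>u. (u - p) ^ n *\<^sub>C x n) has_derivative (\<lambda>h. h *\<^sub>C d n u)) (at u within S)"
      by (auto simp: has_cderiv_def d_def intro: has_derivative_at_withinI)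
  next
    fix e :: real assume "e > 0"
    then have "\<forall>\<^sub>F n in sequentially. \<forall>u\<in>S. dist (\<Sum>i<n. d i u) (\<Sum>i. d i u) < e"
      using lim by (simp add: uniform_limit_iff)
    then show "\<forall>\<^sub>F n in sequentially. \<forall>u\<in>S. \<forall>h. norm ((\<Sum>i<n. h *\<^sub>C d i u) - h *\<^sub>C (\<Sum>i. d i u)) \<le> e * norm h"
    proof (rule eventually_mono, intro ballI allI)
      fix n u h assume *: "\<forall>u\<in>S. dist (\<Sum>i<n. d i u) (\<Sum>i. d i u) < e" and "u \<in> S"
      have "(\<Sum>i<n. h *\<^sub>C d i u) - h *\<^sub>C (\<Sum>i. d i u) = h *\<^sub>C ((\<Sum>i<n. d i u) - (\<Sum>i. d i u))"
        by (simp add: cvec.scale_sum_right cvec.scale_right_diff_distrib)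
      then have "norm ((\<Sum>i<n. h *\<^sub>C d i u) - h *\<^sub>C (\<Sum>i. d i u)) = dist (\<Sum>i<n. d i u) (\<Sum>i. d i u) * norm h"
        by (simp add: norm_cscale dist_norm mult.commute)
      also have "\<dots> \<le> e * norm h" using * \<open>u \<in> S\<close> by (intro mult_right_mono) (auto intro: less_imp_le)
      finally show "norm ((\<Sum>i<n. h *\<^sub>C d i u) - h *\<^sub>C (\<Sum>i. d i u)) \<le> e * norm h" .
    qed
  next
    show "z \<in> S" using r by (simp add: S_def)
    show "(\<lambda>n. (z - p) ^ n *\<^sub>C x n) sums (\<Sum>n. (z - p) ^ n *\<^sub>C x n)"
      using vector_power_series[OF sm z] by (rule summable_sums)
  qed
  then obtain g where g: "\<And>u. u \<in> S \<Longrightarrow> (\<lambda>n. (u - p) ^ n *\<^sub>C x n) sums (g u)"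
      "\<And>u. u \<in> S \<Longrightarrow> (g has_derivative (\<lambda>h. h *\<^sub>C (\<Sum>i. d i u))) (at u within S)"
    by blast
  have zS: "z \<in> S" "open S" using r by (auto simp: S_def)
  have "has_cderiv g (\<Sum>i. d i z) z"
    using g(2)[OF zS(1)] zS by (simp add: has_cderiv_def at_within_open[of _ S])
  then have "has_cderiv (\<lambda>u. \<Sum>n. (u - p) ^ n *\<^sub>C x n) (\<Sum>i. d i z) z"
    by (rule has_cderiv_transform[OF _ zS(2,1)]) (use g(1) in \<open>simp add: sums_iff\<close>)
  moreover have "summable (\<lambda>i. d i z)"
    by (rule summable_norm_cancel, rule summable_comparison_test'[OF M, of 0]) (use dM[OF zS(1)] in simp)
  then have "(\<Sum>i. d i z) = (\<Sum>i. d (Suc i) z)"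
    using suminf_split_head[of "\<lambda>i. d i z"] by (simp add: d_def)
  moreover have "d (Suc i) z = (z - p) ^ i *\<^sub>C (real (Suc i) *\<^sub>R x (Suc i))" for i
    using cscale_of_real[of "real (Suc i)" "x (Suc i)", symmetric]
    by (simp only: d_def cscale_cscale) (simp add: mult.commute)
  ultimately show ?thesis by simp
qed

text \<open>The first derivative is named because it enters the curvature formula; of the second
  only existence is used, to differentiate inner products with \<open>f'\<close> once more.\<close>

definition twice_cdiff_on ::
    "(complex \<Rightarrow> 'a::complex_hilbert_space) \<Rightarrow> (complex \<Rightarrow> 'a) \<Rightarrow> complex set \<Rightarrow> bool" where
  "twice_cdiff_on f f' U \<longleftrightarrow> (\<forall>z\<in>U. has_cderiv f (f' z) z \<and> (\<exists>f''. has_cderiv f' f'' z))"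

text \<open>Let \<open>s\<close> be a bounded, possibly nonlinear, right inverse of
  \<open>T - p\<close>, and iterate it from \<open>x\<close>. Then \<open>T - p\<close> shifts the
  coefficients of the series and kills the first one, so it acts on \<open>t z\<close> as
  multiplication by \<open>z - p\<close>. Growth of at most \<open>M ^ n\<close> gives convergence
  at distances below \<open>1 / M\<close>.\<close>

lemma holomorphic_eigenvector:
  fixes T :: "'a::complex_hilbert_space \<Rightarrow> 'a"
  assumes T: "bounded_clinear T" and surj: "range (shift_op T p) = UNIV"
    and x: "x \<in> kernel (shift_op T p)"
  shows "\<exists>r>0. \<exists>t t'. t p = x \<and> twice_cdiff_on t t' (ball p r) \<and>
           (\<forall>z\<in>ball p r. t z \<in> kernel (shift_op T z))"
proof -
  have bl: "bounded_linear (shift_op T p)"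
    unfolding shift_op_def using T bounded_bilinear.bounded_linear_right[OF bounded_bilinear_cscale]
    by (intro bounded_linear_sub) (auto simp: bounded_clinear_def)
  then interpret A: bounded_linear "shift_op T p" .
  obtain M where M: "M > 0" and "\<forall>y. \<exists>x. shift_op T p x = y \<and> norm x \<le> M * norm y"
    using surj_bounded_preimage[OF bl surj] by blast
  then obtain s where s: "\<And>y. shift_op T p (s y) = y" "\<And>y. norm (s y) \<le> M * norm y"
    by metis
  define X where "X n = (s ^^ n) x" for n
  have X0: "X 0 = x" and XS: "X (Suc n) = s (X n)" for n by (simp_all add: X_def)
  have X: "norm (X n) \<le> M ^ n * norm x" for n
  proof (induction n)
    case (Suc n)
    have "norm (X (Suc n)) \<le> M * norm (X n)" unfolding XS by (rule s)
    also have "\<dots> \<le> M * (M ^ n * norm x)" using Suc M by simp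
    finally show ?case by (simp add: mult.assoc)
  qed (simp add: X0)
  define \<rho> where "\<rho> = 1 / M"
  have sm: "summable (\<lambda>n. norm (X n) * r ^ n)" if "norm r < \<rho>" for r :: real
  proof (rule summable_comparison_test')
    have "norm (M * r) < 1" using that M by (simp add: \<rho>_def abs_mult field_simps)
    then show "summable (\<lambda>n. norm x * norm (M * r) ^ n)"
      by (intro summable_mult summable_geometric) simp
    fix n :: nat
    have "norm (norm (X n) * r ^ n) \<le> M ^ n * norm x * norm r ^ n"
      using X[of n] by (auto simp: abs_mult power_abs intro!: mult_right_mono)
    then show "norm (norm (X n) * r ^ n) \<le> norm x * norm (M * r) ^ n"
      using M by (simp add: abs_mult power_mult_distrib mult_ac)
  qed
  define t where "t z = (\<Sum>n. (z - p) ^ n *\<^sub>C X n)" for z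
  define t' where "t' z = (\<Sum>n. (z - p) ^ n *\<^sub>C (real (Suc n) *\<^sub>R X (Suc n)))" for z
  have "twice_cdiff_on t t' (ball p \<rho>)"
    unfolding twice_cdiff_on_def t_def t'_def
    using has_cderiv_power_series[of \<rho>, OF sm]
      has_cderiv_power_series[of \<rho>, OF vector_diffs_summable[of \<rho>, OF sm]]
    by blast
  moreover have "t p = x"
    using suminf_finite[of "{0}" "\<lambda>n. (p - p) ^ n *\<^sub>C X n"] by (simp add: t_def X0)
  moreover have "t z \<in> kernel (shift_op T z)" if z: "z \<in> ball p \<rho>" for z
  proof -
    have smz: "summable (\<lambda>n. (z - p) ^ n *\<^sub>C X n)" by (rule vector_power_series[OF sm z])
    have Ac: "shift_op T p (c *\<^sub>C y) = c *\<^sub>C shift_op T p y" for c y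
      using T by (simp add: bounded_clinear_def shift_op_def cvec.scale_right_diff_distrib
          cscale_cscale mult.commute)
    have "shift_op T p (t z) = (\<Sum>n. shift_op T p ((z - p) ^ n *\<^sub>C X n))"
      unfolding t_def by (rule A.suminf[OF smz])
    also have "\<dots> = (\<Sum>n. shift_op T p ((z - p) ^ Suc n *\<^sub>C X (Suc n)))"
      using suminf_split_head[OF A.summable[OF smz]] x by (simp add: X0 kernel_def)
    also have "\<dots> = (\<Sum>n. (z - p) *\<^sub>C ((z - p) ^ n *\<^sub>C X n))"
      by (simp only: Ac XS s) (simp add: cscale_cscale)
    also have "\<dots> = (z - p) *\<^sub>C t z"
      unfolding t_def
      by (rule bounded_linear.suminf[OF bounded_bilinear.bounded_linear_right[OF bounded_bilinear_cscale] smz, symmetric])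
    finally show ?thesis
      by (simp add: kernel_def shift_op_def cvec.scale_left_diff_distrib)
  qed
  moreover have "\<rho> > 0" using M by (simp add: \<rho>_def)
  ultimately show ?thesis by blast
qed

section \<open>The Laplacian of a logarithm\<close>

text \<open>Records just the regularity that \<open>log_laplacian\<close> uses at \<open>w\<close>:
  real differentiability nearby, and differentiability of the z-derivative \<open>a\<close> at the
  point itself.\<close>

definition wirtinger_C2 :: "(complex \<Rightarrow> complex) \<Rightarrow> complex \<Rightarrow> bool" where
  "wirtinger_C2 f w \<longleftrightarrow> (\<exists>V a. open V \<and> w \<in> V \<and> (\<forall>z\<in>V. \<exists>b. has_wirtinger f (a z) b z) \<and>
     (\<exists>c d. has_wirtinger a c d w))"

text \<open>The mixed second derivative of \<open>log f\<close>, written through the logarithmic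
  derivative so that it makes sense for complex non-vanishing \<open>f\<close> without a branch of
  the logarithm.\<close>

definition log_laplacian :: "(complex \<Rightarrow> complex) \<Rightarrow> complex \<Rightarrow> complex" where
  "log_laplacian f w = dzbar (\<lambda>z. dz f z / f z) w"

lemma has_wirtinger_continuous: "has_wirtinger f a b z \<Longrightarrow> continuous (at z) f"
  unfolding has_wirtinger_def by (rule has_derivative_continuous)

lemma wirtinger_C2E:
  assumes "wirtinger_C2 f w"
  obtains V a b c d where "open V" "w \<in> V" "\<And>z. z \<in> V \<Longrightarrow> has_wirtinger f (a z) (b z) z"
    "has_wirtinger a c d w" "continuous_on V f"
proof -
  obtain V a c d where V: "open V" "w \<in> V" "\<forall>z\<in>V. \<exists>b. has_wirtinger f (a z) b z" "has_wirtinger a c d w"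
    using assms unfolding wirtinger_C2_def by blast
  from V(3) obtain b where b: "\<And>z. z \<in> V \<Longrightarrow> has_wirtinger f (a z) (b z) z" by metis
  moreover have "continuous_on V f"
    by (rule continuous_at_imp_continuous_on) (use b has_wirtinger_continuous in blast)
  ultimately show ?thesis using V that by blast
qed

lemma wirtinger_C2I:
  assumes "open V" "w \<in> V" "\<And>z. z \<in> V \<Longrightarrow> has_wirtinger f (a z) (b z) z" "has_wirtinger a c d w"
  shows "wirtinger_C2 f w"
  using assms unfolding wirtinger_C2_def by blast

lemma wirtinger_C2_transform:
  assumes "wirtinger_C2 f w" "open V" "w \<in> V" "\<And>z. z \<in> V \<Longrightarrow> f z = g z"
  shows "wirtinger_C2 g w"
proof -
  obtain U a b c d where U: "open U" "w \<in> U" "\<And>z. z \<in> U \<Longrightarrow> has_wirtinger f (a z) (b z) z"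
    "has_wirtinger a c d w" using assms(1) by (rule wirtinger_C2E) (rule that)
  show ?thesis
  proof (rule wirtinger_C2I[of "U \<inter> V"])
    fix z assume "z \<in> U \<inter> V"
    then show "has_wirtinger g (a z) (b z) z"
      using U(3)[of z] assms(2,4) by (intro has_wirtinger_transform[of f "a z" "b z" z V g]) auto
  qed (use U assms in auto)
qed

lemma wirtinger_C2_at:
  assumes "wirtinger_C2 f w"
  shows "\<exists>a b. has_wirtinger f a b w"
  using assms by (rule wirtinger_C2E) blast

lemma wirtinger_C2_dz:
  assumes "wirtinger_C2 f w"
  shows "\<exists>c d. has_wirtinger (dz f) c d w"
proof -
  obtain V a b c d where V: "open V" "w \<in> V" "\<And>z. z \<in> V \<Longrightarrow> has_wirtinger f (a z) (b z) z"
    "has_wirtinger a c d w" using assms by (rule wirtinger_C2E) (rule that)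
  have "has_wirtinger (dz f) c d w"
    using V(4,1,2) by (rule has_wirtinger_transform) (simp add: has_wirtinger_dz[OF V(3)])
  then show ?thesis by blast
qed

lemma wirtinger_C2_add:
  assumes "wirtinger_C2 f w" "wirtinger_C2 g w"
  shows "wirtinger_C2 (\<lambda>z. f z + g z) w"
proof -
  obtain V a b c d where V: "open V" "w \<in> V" "\<And>z. z \<in> V \<Longrightarrow> has_wirtinger f (a z) (b z) z"
    "has_wirtinger a c d w" using assms(1) by (rule wirtinger_C2E) (rule that)
  obtain V' a' b' c' d' where V': "open V'" "w \<in> V'" "\<And>z. z \<in> V' \<Longrightarrow> has_wirtinger g (a' z) (b' z) z"
    "has_wirtinger a' c' d' w" using assms(2) by (rule wirtinger_C2E) (rule that)
  show ?thesis
  proof (rule wirtinger_C2I[of "V \<inter> V'"])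
    show "has_wirtinger (\<lambda>z. f z + g z) (a z + a' z) (b z + b' z) z" if "z \<in> V \<inter> V'" for z
      using that V V' by (intro has_wirtinger_add) auto
    show "has_wirtinger (\<lambda>z. a z + a' z) (c + c') (d + d') w"
      using V V' by (intro has_wirtinger_add)
  qed (use V V' in auto)
qed

lemma wirtinger_C2_mult:
  assumes "wirtinger_C2 f w" "wirtinger_C2 g w"
  shows "wirtinger_C2 (\<lambda>z. f z * g z) w"
proof -
  obtain V a b c d where V: "open V" "w \<in> V" "\<And>z. z \<in> V \<Longrightarrow> has_wirtinger f (a z) (b z) z"
    "has_wirtinger a c d w" using assms(1) by (rule wirtinger_C2E) (rule that)
  obtain V' a' b' c' d' where V': "open V'" "w \<in> V'" "\<And>z. z \<in> V' \<Longrightarrow> has_wirtinger g (a' z) (b' z) z"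
    "has_wirtinger a' c' d' w" using assms(2) by (rule wirtinger_C2E) (rule that)
  show ?thesis
  proof (rule wirtinger_C2I[of "V \<inter> V'"])
    show "has_wirtinger (\<lambda>z. f z * g z) (a z * g z + f z * a' z) (b z * g z + f z * b' z) z"
      if "z \<in> V \<inter> V'" for z
      using that V V' by (intro has_wirtinger_mult) auto
    show "has_wirtinger (\<lambda>z. a z * g z + f z * a' z) ((c * g w + a w * a' w) + (a w * a' w + f w * c'))
        ((d * g w + a w * b' w) + (b w * a' w + f w * d')) w"
      using V V' by (intro has_wirtinger_add has_wirtinger_mult) auto
  qed (use V V' in auto)
qed

lemma wirtinger_C2_holomorphic:
  assumes "f holomorphic_on V" "open V" "w \<in> V"
  shows "wirtinger_C2 f w"
proof (rule wirtinger_C2I)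
  show "has_wirtinger f (deriv f z) 0 z" if "z \<in> V" for z
    using holomorphic_derivI[OF assms(1,2) that] has_wirtinger_holomorphic by blast
  show "has_wirtinger (deriv f) (deriv (deriv f) w) 0 w"
    using holomorphic_derivI[OF holomorphic_deriv[OF assms(1,2)] assms(2,3)] has_wirtinger_holomorphic by blast
qed (use assms in auto)

lemma wirtinger_C2_const: "wirtinger_C2 (\<lambda>_. c) w"
  by (rule wirtinger_C2_holomorphic[of _ UNIV]) auto

lemma wirtinger_C2_diff:
  assumes "wirtinger_C2 f w" "wirtinger_C2 g w"
  shows "wirtinger_C2 (\<lambda>z. f z - g z) w"
  using wirtinger_C2_add[OF assms(1) wirtinger_C2_mult[OF wirtinger_C2_const[of "-1"] assms(2)]] by simp

lemma wirtinger_C2_cnj: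
  assumes "f holomorphic_on V" "open V" "w \<in> V"
  shows "wirtinger_C2 (\<lambda>z. cnj (f z)) w"
proof (rule wirtinger_C2I)
  show "has_wirtinger (\<lambda>z. cnj (f z)) ((\<lambda>_. 0) z) (cnj (deriv f z)) z" if "z \<in> V" for z
    using has_wirtinger_cnj[of f "deriv f z" 0 z]
      has_wirtinger_holomorphic[THEN iffD1, OF holomorphic_derivI[OF assms(1,2) that]] by simp
  show "has_wirtinger (\<lambda>_. 0) 0 0 w" by (rule has_wirtinger_const)
qed (use assms in auto)

lemma wirtinger_C2_inverse:
  assumes "wirtinger_C2 f w" "f w \<noteq> 0"
  shows "wirtinger_C2 (\<lambda>z. 1 / f z) w"
proof -
  obtain V a b c d where V: "open V" "w \<in> V" "\<And>z. z \<in> V \<Longrightarrow> has_wirtinger f (a z) (b z) z"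
    "has_wirtinger a c d w" "continuous_on V f" using assms(1) by (rule wirtinger_C2E) (rule that)
  define V' where "V' = {z \<in> V. f z \<noteq> 0}"
  have V': "open V'" "w \<in> V'"
    using V assms continuous_open_preimage[OF V(5,1), of "- {0}"] by (auto simp: V'_def vimage_def Int_def)
  show ?thesis
  proof (rule wirtinger_C2I[OF V'])
    show "has_wirtinger (\<lambda>z. 1 / f z) ((0 * f z - 1 * a z) / (f z)\<^sup>2) ((0 * f z - 1 * b z) / (f z)\<^sup>2) z"
      if "z \<in> V'" for z
      using that V by (intro has_wirtinger_divide has_wirtinger_const) (auto simp: V'_def)
    note N = has_wirtinger_diff[OF has_wirtinger_mult[OF has_wirtinger_const[of 0 w] V(3)[OF V(2)]]
        has_wirtinger_mult[OF has_wirtinger_const[of 1 w] V(4)]]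
    note D = has_wirtinger_mult[OF V(3)[OF V(2)] V(3)[OF V(2)]]
    have "\<exists>c' d'. has_wirtinger (\<lambda>z. (0 * f z - 1 * a z) / (f z)\<^sup>2) c' d' w"
      unfolding power2_eq_square by (intro exI, rule has_wirtinger_divide[OF N D]) (simp add: assms(2))
    then obtain c' d' where cd: "has_wirtinger (\<lambda>z. (0 * f z - 1 * a z) / (f z)\<^sup>2) c' d' w"
      by blast
    show "has_wirtinger (\<lambda>z. (0 * f z - 1 * a z) / (f z)\<^sup>2)
       (dz (\<lambda>z. (0 * f z - 1 * a z) / (f z)\<^sup>2) w) (dzbar (\<lambda>z. (0 * f z - 1 * a z) / (f z)\<^sup>2) w) w"
      unfolding has_wirtinger_dz[OF cd] has_wirtinger_dzbar[OF cd] by (rule cd)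
  qed
qed

lemma wirtinger_C2_cinner:
  assumes "twice_cdiff_on f f' V" "twice_cdiff_on g g' V" "open V" "w \<in> V"
  shows "wirtinger_C2 (\<lambda>z. cinner (f z) (g z)) w"
proof -
  from assms obtain f'' where f'': "has_cderiv f' f'' w" by (auto simp: twice_cdiff_on_def)
  have f: "has_cderiv f (f' z) z" and g: "has_cderiv g (g' z) z" if "z \<in> V" for z
    using assms that by (auto simp: twice_cdiff_on_def)
  show ?thesis
    by (rule wirtinger_C2I[OF assms(3,4) has_wirtinger_cinner[OF f g] has_wirtinger_cinner[OF f'' g[OF assms(4)]]])
qed

lemma dz_log_C2:
  assumes "wirtinger_C2 f w" "f w \<noteq> 0"
  shows "\<exists>c d. has_wirtinger (\<lambda>z. dz f z / f z) c d w"
proof -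
  obtain a b where "has_wirtinger f a b w" using wirtinger_C2_at[OF assms(1)] by blast
  moreover obtain c d where "has_wirtinger (dz f) c d w" using wirtinger_C2_dz[OF assms(1)] by blast
  ultimately show ?thesis using has_wirtinger_divide assms(2) by blast
qed

lemma log_laplacian_cong:
  assumes "open V" "w \<in> V" "\<And>z. z \<in> V \<Longrightarrow> f z = g z"
  shows "log_laplacian f w = log_laplacian g w"
  unfolding log_laplacian_def
  by (rule dzbar_cong[OF assms(1,2)]) (simp add: assms(3) dz_cong[OF assms(1) _ assms(3)])

lemma log_laplacian_mult:
  assumes f: "wirtinger_C2 f w" "f w \<noteq> 0" and g: "wirtinger_C2 g w" "g w \<noteq> 0"
  shows "log_laplacian (\<lambda>z. f z * g z) w = log_laplacian f w + log_laplacian g w"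
proof -
  obtain V a b where V: "open V" "w \<in> V" "\<And>z. z \<in> V \<Longrightarrow> has_wirtinger f (a z) (b z) z"
    "continuous_on V f" using f(1) by (rule wirtinger_C2E) (rule that)
  obtain V' a' b' where V': "open V'" "w \<in> V'" "\<And>z. z \<in> V' \<Longrightarrow> has_wirtinger g (a' z) (b' z) z"
    "continuous_on V' g" using g(1) by (rule wirtinger_C2E) (rule that)
  define W where "W = (V \<inter> f -` (- {0})) \<inter> (V' \<inter> g -` (- {0}))"
  have W: "open W" "w \<in> W"
    unfolding W_def
    by (intro open_Int continuous_open_preimage[OF V(4,1)] continuous_open_preimage[OF V'(4,1)];
      simp add: open_Compl)
       (use V(2) V'(2) f g in auto)
  have eq: "dz (\<lambda>z. f z * g z) z / (f z * g z) = dz f z / f z + dz g z / g z" if "z \<in> W" for z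
  proof -
    have z: "z \<in> V" "z \<in> V'" "f z \<noteq> 0" "g z \<noteq> 0" using that by (auto simp: W_def)
    have "dz (\<lambda>z. f z * g z) z = a z * g z + f z * a' z"
      using has_wirtinger_dz[OF has_wirtinger_mult[OF V(3)[OF z(1)] V'(3)[OF z(2)]]] .
    moreover have "dz f z = a z" "dz g z = a' z"
      using has_wirtinger_dz V(3)[OF z(1)] V'(3)[OF z(2)] by blast+
    ultimately show ?thesis using z by (simp add: field_simps)
  qed
  obtain c d where cd: "has_wirtinger (\<lambda>z. dz f z / f z) c d w" using dz_log_C2[OF f] by blast
  obtain c' d' where cd': "has_wirtinger (\<lambda>z. dz g z / g z) c' d' w" using dz_log_C2[OF g] by blast
  have "log_laplacian (\<lambda>z. f z * g z) w = dzbar (\<lambda>z. dz f z / f z + dz g z / g z) w"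
    unfolding log_laplacian_def by (rule dzbar_cong[OF W eq])
  then show ?thesis
    using has_wirtinger_dzbar[OF has_wirtinger_add[OF cd cd']] has_wirtinger_dzbar[OF cd]
      has_wirtinger_dzbar[OF cd'] by (simp add: log_laplacian_def)
qed

lemma log_laplacian_holomorphic:
  assumes "f holomorphic_on V" "open V" "w \<in> V" "f w \<noteq> 0"
  shows "log_laplacian f w = 0"
proof -
  have "dz f z = deriv f z" if "z \<in> V" for z
    using has_wirtinger_dz holomorphic_derivI[OF assms(1,2) that] has_wirtinger_holomorphic by blast
  then have "log_laplacian f w = dzbar (\<lambda>z. deriv f z / f z) w"
    unfolding log_laplacian_def by (intro dzbar_cong[OF assms(2,3)]) simp
  moreover have "(\<lambda>z. deriv f z / f z) field_differentiable at w"
    using assms holomorphic_deriv[OF assms(1,2)] holomorphic_on_imp_differentiable_at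
    by (intro field_differentiable_divide) blast+
  ultimately show ?thesis
    using has_wirtinger_dzbar has_wirtinger_holomorphic by (metis field_differentiable_def)
qed

lemma log_laplacian_cnj:
  assumes "f holomorphic_on V" "open V" "w \<in> V"
  shows "log_laplacian (\<lambda>z. cnj (f z)) w = 0"
proof -
  have "dz (\<lambda>z. cnj (f z)) z = 0" if "z \<in> V" for z
    using has_wirtinger_dz[OF has_wirtinger_cnj] holomorphic_derivI[OF assms(1,2) that]
      has_wirtinger_holomorphic by fastforce
  then have "log_laplacian (\<lambda>z. cnj (f z)) w = dzbar (\<lambda>z. 0) w"
    unfolding log_laplacian_def by (intro dzbar_cong[OF assms(2,3)]) simp
  then show ?thesis using has_wirtinger_dzbar[OF has_wirtinger_const] by simp
qed

text \<open>The logarithmic derivative of \<open>f\<close> is holomorphic and the z-derivative of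
  \<open>cnj f\<close> is zero, so neither factor contributes. This is the gauge invariance of
  curvature: a holomorphic change of frame produces exactly the factor
  \<open>f * cnj f\<close>.\<close>

lemma log_laplacian_norm_square_mult:
  assumes f: "f holomorphic_on V" "open V" "w \<in> V" "f w \<noteq> 0" and g: "wirtinger_C2 g w" "g w \<noteq> 0"
  shows "log_laplacian (\<lambda>z. f z * cnj (f z) * g z) w = log_laplacian g w"
  using log_laplacian_mult[OF wirtinger_C2_mult[OF wirtinger_C2_holomorphic[OF f(1-3)] wirtinger_C2_cnj[OF f(1-3)]] _ g]
    log_laplacian_mult[OF wirtinger_C2_holomorphic[OF f(1-3)] f(4) wirtinger_C2_cnj[OF f(1-3)]]
    log_laplacian_holomorphic[OF f] log_laplacian_cnj[OF f(1-3)] f(4)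
  by simp

text \<open>The quotient is the Gram determinant of \<open>f\<close> and \<open>f'\<close> over the
  fourth power of the norm of \<open>f\<close>, hence nonnegative by Cauchy-Schwarz. With the
  opposite sign it is the curvature of the line spanned by \<open>f\<close>.\<close>

lemma log_laplacian_cinner:
  assumes f: "twice_cdiff_on f f' V" "open V" "w \<in> V" "f w \<noteq> 0"
  shows "log_laplacian (\<lambda>z. cinner (f z) (f z)) w =
    (cinner (f w) (f w) * cinner (f' w) (f' w) - cinner (f' w) (f w) * cinner (f w) (f' w)) / (cinner (f w) (f w))\<^sup>2"
proof -
  have d: "has_cderiv f (f' z) z" if "z \<in> V" for z
    using f that by (auto simp: twice_cdiff_on_def)
  obtain f'' where f'': "has_cderiv f' f'' w" using f by (auto simp: twice_cdiff_on_def)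
  have "dz (\<lambda>z. cinner (f z) (f z)) z = cinner (f' z) (f z)" if "z \<in> V" for z
    by (rule has_wirtinger_dz[OF has_wirtinger_cinner[OF d[OF that] d[OF that]]])
  then have "log_laplacian (\<lambda>z. cinner (f z) (f z)) w = dzbar (\<lambda>z. cinner (f' z) (f z) / cinner (f z) (f z)) w"
    unfolding log_laplacian_def by (intro dzbar_cong[OF f(2,3)]) simp
  also have "\<dots> = (cinner (f' w) (f' w) * cinner (f w) (f w) - cinner (f' w) (f w) * cinner (f w) (f' w)) / (cinner (f w) (f w))\<^sup>2"
    using f(4) by (intro has_wirtinger_dzbar[OF has_wirtinger_divide[OF
       has_wirtinger_cinner[OF f'' d[OF f(3)]] has_wirtinger_cinner[OF d[OF f(3)] d[OF f(3)]]]]) simp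
  finally show ?thesis by (simp add: mult.commute)
qed

text \<open>
  If \<open>\<partial> log v\<close> is holomorphic, a primitive \<open>g\<close> of it makes \<open>v * cmod (exp (- g))\<^sup>2\<close> a
  real-valued function with vanishing \<open>\<partial>\<close>-derivative, hence a constant.
\<close>

lemma log_harmonic_is_norm_square:
  fixes v :: "complex \<Rightarrow> real"
  assumes C2: "\<And>z. z \<in> ball p r \<Longrightarrow> wirtinger_C2 (\<lambda>z. complex_of_real (v z)) z"
    and pos: "\<And>z. z \<in> ball p r \<Longrightarrow> v z > 0"
    and zero: "\<And>z. z \<in> ball p r \<Longrightarrow> log_laplacian (\<lambda>z. complex_of_real (v z)) z = 0"
    and r: "r > 0"
  shows "\<exists>e. e holomorphic_on ball p r \<and> (\<forall>z\<in>ball p r. e z \<noteq> 0 \<and> v z = (cmod (e z))\<^sup>2)"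
proof -
  let ?v = "\<lambda>z. complex_of_real (v z)"
  define G where "G z = dz ?v z / ?v z" for z
  have "G field_differentiable at z" if z: "z \<in> ball p r" for z
  proof -
    obtain c d where cd: "has_wirtinger G c d z"
      unfolding G_def using dz_log_C2[OF C2[OF z]] pos[OF z] by auto
    moreover have "d = 0"
      using has_wirtinger_dzbar[OF cd] zero[OF z] unfolding log_laplacian_def G_def by simp
    ultimately show ?thesis
      using has_wirtinger_holomorphic field_differentiable_def by blast
  qed
  then have "G holomorphic_on ball p r"
    by (auto simp: holomorphic_on_def intro: field_differentiable_at_within)
  then obtain g where "\<And>z. z \<in> ball p r \<Longrightarrow> (g has_field_derivative G z) (at z within ball p r)"
    using holomorphic_convex_primitive'[OF convex_ball open_ball] by blast
  then have g: "\<And>z. z \<in> ball p r \<Longrightarrow> (g has_field_derivative G z) (at z)"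
    by (simp add: at_within_open[OF _ open_ball])
  define k where "k z = ?v z * (exp (- g z) * cnj (exp (- g z)))" for z
  have k: "k z = complex_of_real (v z * (cmod (exp (- g z)))\<^sup>2)" for z
    by (simp only: k_def of_real_mult complex_norm_square)
  have "(k has_derivative (\<lambda>h. 0)) (at z within ball p r)" if z: "z \<in> ball p r" for z
  proof -
    have E: "has_wirtinger (\<lambda>z. exp (- g z)) (- exp (- g z) * G z) 0 z"
      using g[OF z] unfolding has_wirtinger_holomorphic[symmetric]
      by (auto intro!: derivative_eq_intros)
    obtain a b where ab: "has_wirtinger ?v a b z" using wirtinger_C2_at[OF C2[OF z]] by blast
    have a: "a = ?v z * G z"
      using has_wirtinger_dz[OF ab] pos[OF z] by (simp add: G_def)
    obtain b' where "has_wirtinger k 0 b' z"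
      using has_wirtinger_mult[OF ab has_wirtinger_mult[OF E has_wirtinger_cnj[OF E]]]
      unfolding k_def a by (auto simp: algebra_simps)
    then have k0: "has_wirtinger k 0 b' z" .
    \<comment> \<open>For a real-valued function the two Wirtinger derivatives are conjugate, so the
      vanishing of one forces that of the other.\<close>
    have "(\<lambda>z. cnj (k z)) = k" by (rule ext) (simp only: k complex_cnj_complex_of_real)
    with has_wirtinger_cnj[OF k0] have "has_wirtinger k (cnj b') 0 z" by simp
    from has_wirtinger_dzbar[OF this] has_wirtinger_dzbar[OF k0] k0
    have "has_wirtinger k 0 0 z" by simp
    then show ?thesis by (auto simp: has_wirtinger_def intro: has_derivative_at_withinI)
  qed
  then obtain C where C: "\<And>z. z \<in> ball p r \<Longrightarrow> k z = C"
    using has_derivative_zero_constant[OF convex_ball] by metis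
  define c where "c = v p * (cmod (exp (- g p)))\<^sup>2"
  have c: "c > 0" using pos[of p] r by (simp add: c_def)
  have vc: "v z * (cmod (exp (- g z)))\<^sup>2 = c" if "z \<in> ball p r" for z
  proof -
    have "k z = k p" using C[of z] C[of p] that r by simp
    then show ?thesis unfolding k c_def of_real_eq_iff .
  qed
  define e where "e z = complex_of_real (sqrt c) * exp (g z)" for z
  have "e holomorphic_on ball p r"
    unfolding e_def using g holomorphic_on_open[OF open_ball, of g p r]
    by (intro holomorphic_intros) blast
  moreover have "v z = (cmod (e z))\<^sup>2" if "z \<in> ball p r" for z
    using vc[OF that, symmetric] c
    by (simp add: e_def norm_mult power_mult_distrib exp_minus norm_inverse power_inverse)
  moreover have "e z \<noteq> 0" for z using c by (simp add: e_def)
  ultimately show ?thesis by blast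
qed

section \<open>Polarization and continuation\<close>

text \<open>
  The holomorphy of \<open>F\<close> in its first argument and antiholomorphy in the second are only needed
  along pairs of holomorphic curves.
\<close>

definition sesquiholomorphic_on :: "(complex \<Rightarrow> complex \<Rightarrow> complex) \<Rightarrow> complex set \<Rightarrow> bool" where
  "sesquiholomorphic_on F U \<longleftrightarrow> (\<forall>W \<alpha> \<beta>. open W \<longrightarrow> \<alpha> holomorphic_on W \<longrightarrow> \<beta> holomorphic_on W \<longrightarrow>
     (\<forall>u\<in>W. \<alpha> u \<in> U \<and> cnj (\<beta> u) \<in> U) \<longrightarrow> (\<lambda>u. F (\<alpha> u) (cnj (\<beta> u))) holomorphic_on W)"

lemma sesquiholomorphic_on_mult:
  "sesquiholomorphic_on F U \<Longrightarrow> sesquiholomorphic_on G U \<Longrightarrow> sesquiholomorphic_on (\<lambda>z w. F z w * G z w) U"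
  and sesquiholomorphic_on_add:
  "sesquiholomorphic_on F U \<Longrightarrow> sesquiholomorphic_on G U \<Longrightarrow> sesquiholomorphic_on (\<lambda>z w. F z w + G z w) U"
  and sesquiholomorphic_on_diff:
  "sesquiholomorphic_on F U \<Longrightarrow> sesquiholomorphic_on G U \<Longrightarrow> sesquiholomorphic_on (\<lambda>z w. F z w - G z w) U"
  unfolding sesquiholomorphic_on_def by (auto intro!: holomorphic_intros)

lemma sesquiholomorphic_on_holomorphic:
  assumes "f holomorphic_on U" "open U"
  shows "sesquiholomorphic_on (\<lambda>z w. f z * cnj (f w)) U"
  unfolding sesquiholomorphic_on_def
proof (intro allI impI holomorphic_on_mult)
  fix W \<alpha> \<beta>
  assume W: "open W" and \<alpha>: "\<alpha> holomorphic_on W" and \<beta>: "\<beta> holomorphic_on W"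
    and U: "\<forall>u\<in>W. \<alpha> u \<in> U \<and> cnj (\<beta> u) \<in> U"
  show "(\<lambda>u. f (\<alpha> u)) holomorphic_on W"
    using holomorphic_on_compose_gen[OF \<alpha> assms(1)] U by (auto simp: o_def)
  have "cnj ` U = cnj -` U"
    using image_eqI[of _ cnj "cnj _" U] by fastforce
  then have "open (cnj ` U)"
    using continuous_open_vimage[OF assms(2), of cnj] by (simp add: continuous_intros)
  then have "(cnj \<circ> f \<circ> cnj) holomorphic_on cnj ` U"
    using assms by (intro holomorphic_on_compose_cnj_cnj) (auto simp: image_image)
  moreover have "\<beta> ` W \<subseteq> cnj ` U"
    using U by (metis (no_types, lifting) complex_cnj_cnj image_eqI image_subsetI)
  ultimately show "(\<lambda>u. cnj (f (cnj (\<beta> u)))) holomorphic_on W"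
    using holomorphic_on_compose_gen[OF \<beta>, of "cnj \<circ> f \<circ> cnj" "cnj ` U"] by (simp add: o_def)
qed

text \<open>The differential of \<open>cnj (\<beta> u)\<close> is conjugate-linear, and the
  antilinear second slot of \<open>cinner\<close> conjugates it back, which leaves a complex-linear
  differential in \<open>u\<close>.\<close>

lemma sesquiholomorphic_on_cinner:
  assumes f: "\<And>z. z \<in> U \<Longrightarrow> has_cderiv f (f' z) z" and g: "\<And>z. z \<in> U \<Longrightarrow> has_cderiv g (g' z) z"
  shows "sesquiholomorphic_on (\<lambda>z w. cinner (f z) (g w)) U"
  unfolding sesquiholomorphic_on_def
proof (intro allI impI)
  fix W \<alpha> \<beta>
  assume W: "open W" and \<alpha>: "\<alpha> holomorphic_on W" and \<beta>: "\<beta> holomorphic_on W"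
    and U: "\<forall>u\<in>W. \<alpha> u \<in> U \<and> cnj (\<beta> u) \<in> U"
  have "\<exists>D. ((\<lambda>u. cinner (f (\<alpha> u)) (g (cnj (\<beta> u)))) has_field_derivative D) (at u)" if u: "u \<in> W" for u
  proof -
    obtain a b where a: "(\<alpha> has_derivative (\<lambda>h. a * h)) (at u)" and b: "(\<beta> has_derivative (\<lambda>h. b * h)) (at u)"
      using holomorphic_derivI[OF \<alpha> W u] holomorphic_derivI[OF \<beta> W u]
      by (auto simp: has_field_derivative_def)
    have "((\<lambda>u. f (\<alpha> u)) has_derivative (\<lambda>h. (a * h) *\<^sub>C f' (\<alpha> u))) (at u)"
      using has_derivative_compose[OF a] f[unfolded has_cderiv_def] U u by blast
    moreover have "((\<lambda>u. g (cnj (\<beta> u))) has_derivative (\<lambda>h. cnj (b * h) *\<^sub>C g' (cnj (\<beta> u)))) (at u)"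
      using has_derivative_compose[OF has_derivative_cnj[OF b]] g[unfolded has_cderiv_def] U u by blast
    ultimately have "((\<lambda>u. cinner (f (\<alpha> u)) (g (cnj (\<beta> u)))) has_derivative
        (\<lambda>h. cinner (f (\<alpha> u)) (cnj (b * h) *\<^sub>C g' (cnj (\<beta> u))) +
             cinner ((a * h) *\<^sub>C f' (\<alpha> u)) (g (cnj (\<beta> u))))) (at u)"
      by (rule bounded_bilinear.FDERIV[OF bounded_bilinear_cinner])
    then have "((\<lambda>u. cinner (f (\<alpha> u)) (g (cnj (\<beta> u)))) has_derivative
        (\<lambda>h. (b * cinner (f (\<alpha> u)) (g' (cnj (\<beta> u))) + a * cinner (f' (\<alpha> u)) (g (cnj (\<beta> u)))) * h)) (at u)"
      by (rule has_derivative_eq_rhs) (simp add: fun_eq_iff cinner_cscale_left cinner_cscale_right algebra_simps)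
    then show ?thesis unfolding has_field_derivative_def by blast
  qed
  then show "(\<lambda>u. cinner (f (\<alpha> u)) (g (cnj (\<beta> u)))) holomorphic_on W"
    using W by (auto simp: holomorphic_on_open)
qed

text \<open>Real points accumulate at the centre, so the identity theorem applies.\<close>

lemma holomorphic_zero_on_reals:
  assumes f: "f holomorphic_on ball 0 s" and s: "s > 0"
    and zero: "\<And>x::real. \<bar>x\<bar> < s \<Longrightarrow> f (complex_of_real x) = 0" and z: "z \<in> ball 0 s"
  shows "f z = 0"
proof (rule analytic_continuation[OF f open_ball connected_ball _ _ _ _ z])
  show "complex_of_real ` {-s<..<s} \<subseteq> ball 0 s" by auto
  show "(0::complex) \<in> ball 0 s" using s by simp
  show "0 islimpt complex_of_real ` {-s<..<s}"
    unfolding islimpt_approachable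
  proof (intro allI impI)
    fix e :: real assume e: "e > 0"
    define x where "x = min e s / 2"
    have "0 < x" "x < e" "x < s" using e s by (auto simp: x_def)
    then show "\<exists>x'\<in>complex_of_real ` {-s<..<s}. x' \<noteq> 0 \<and> dist x' 0 < e"
      by (intro bexI[of _ "complex_of_real x"]) auto
  qed
qed (use zero in auto)

text \<open>
  In the coordinates \<open>z = p + x + \<i> y\<close> and \<open>w = p + cnj (x - \<i> y)\<close> the diagonal is given by real
  \<open>x\<close> and \<open>y\<close>, so that the identity theorem applies in each of the two variables.
\<close>

lemma polarization:
  assumes F: "sesquiholomorphic_on F (ball p r)" and diag: "\<And>z. z \<in> ball p r \<Longrightarrow> F z z = 0"
    and z: "z \<in> ball p r"
  shows "F z p = 0"
proof -
  have r: "r > 0" using z by (metis ball_eq_empty empty_iff not_le)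
  define G where "G x y = F (p + x + \<i> * y) (cnj (cnj p + x - \<i> * y))" for x y
  have inb: "p + x + \<i> * y \<in> ball p r" "cnj (cnj p + x - \<i> * y) \<in> ball p r"
    if "x \<in> ball 0 (r/2)" "y \<in> ball 0 (r/2)" for x y
  proof -
    have "cmod (x + \<i> * y) < r"
      using that norm_triangle_ineq[of x "\<i> * y"] by (simp add: norm_mult)
    moreover have "dist p (p + x + \<i> * y) = cmod (- (x + \<i> * y))"
      unfolding dist_norm by (rule arg_cong[of _ _ cmod]) simp
    ultimately show "p + x + \<i> * y \<in> ball p r" by (simp only: norm_minus_cancel mem_ball)
    have "cmod (x - \<i> * y) < r"
      using that norm_triangle_ineq4[of x "\<i> * y"] by (simp add: norm_mult)
    moreover have "dist p (cnj (cnj p + x - \<i> * y)) = cmod (- cnj (x - \<i> * y))"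
      unfolding dist_norm by (rule arg_cong[of _ _ cmod]) (simp add: algebra_simps)
    ultimately show "cnj (cnj p + x - \<i> * y) \<in> ball p r" by (simp only: norm_minus_cancel complex_mod_cnj mem_ball)
  qed
  have G0: "G (complex_of_real x) (complex_of_real y) = 0" if "\<bar>x\<bar> < r/2" "\<bar>y\<bar> < r/2" for x y
    using diag inb(1)[of "complex_of_real x" "complex_of_real y"] that by (simp add: G_def)
  have hol1: "(\<lambda>y. G x y) holomorphic_on ball 0 (r/2)" if "x \<in> ball 0 (r/2)" for x
    unfolding G_def using that inb
    by (intro F[unfolded sesquiholomorphic_on_def, rule_format] holomorphic_intros) auto
  have hol2: "(\<lambda>x. G x y) holomorphic_on ball 0 (r/2)" if "y \<in> ball 0 (r/2)" for y
    unfolding G_def using that inb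
    by (intro F[unfolded sesquiholomorphic_on_def, rule_format] holomorphic_intros) auto
  have G1: "G (complex_of_real x) y = 0" if "\<bar>x\<bar> < r/2" "y \<in> ball 0 (r/2)" for x y
  proof (rule holomorphic_zero_on_reals[OF hol1])
    show "complex_of_real x \<in> ball 0 (r/2)" using that by simp
  qed (use r that G0 in auto)
  have G2: "G x y = 0" if "x \<in> ball 0 (r/2)" "y \<in> ball 0 (r/2)" for x y
    by (rule holomorphic_zero_on_reals[OF hol2[OF that(2)] _ _ that(1)]) (use r that G1 in auto)
  \<comment> \<open>The arguments solve \<open>x + \<i> * y = z - p\<close> and
    \<open>x - \<i> * y = 0\<close>; the second equation freezes the second slot of \<open>F\<close>
    at \<open>p\<close>.\<close>
  have "cmod ((z - p) / 2) < r / 2" "cmod ((z - p) / (2 * \<i>)) < r / 2"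
    using z by (simp_all add: dist_norm norm_minus_commute norm_divide norm_mult)
  then have "G ((z - p) / 2) ((z - p) / (2 * \<i>)) = 0" by (intro G2) auto
  then show ?thesis by (simp add: G_def field_simps)
qed

lemma holomorphic_constant_modulus:
  assumes h: "h holomorphic_on ball p r" and c: "\<And>z. z \<in> ball p r \<Longrightarrow> cmod (h z) = c"
  shows "\<exists>b. \<forall>z\<in>ball p r. h z = b"
proof (cases "r > 0")
  case True
  have "h constant_on ball p r"
    by (rule maximum_modulus_principle[OF h open_ball connected_ball open_ball order_refl, of p])
      (use c True in auto)
  then show ?thesis by (auto simp: constant_on_def)
next
  case False
  then have "ball p r = {}" by simp
  then show ?thesis by blast
qed

text \<open>Near a point of \<open>G\<close> in both balls, the quotient \<open>N / (D * e)\<close>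
  has constant modulus, hence is a constant \<open>c\<close>. Cleared of denominators, the relation
  \<open>N = c * e * D\<close> is an identity of holomorphic functions and spreads over the whole
  ball, across the zeros of \<open>D\<close>. As \<open>D\<close> is not identically zero, it
  vanishes on no open subset, so \<open>G\<close> is dense in the ball.\<close>

lemma continue_meromorphic_quotient:
  fixes N D e \<Phi> :: "complex \<Rightarrow> complex" and v :: "complex \<Rightarrow> real"
  assumes hol: "N holomorphic_on ball p r" "D holomorphic_on ball p r" "e holomorphic_on ball p r"
    and e: "\<And>z. z \<in> ball p r \<Longrightarrow> e z \<noteq> 0 \<and> v z = (cmod (e z))\<^sup>2"
    and D: "\<And>z. z \<in> ball p r \<Longrightarrow> D z \<noteq> 0 \<longleftrightarrow> z \<in> G"
    and \<Phi>: "\<And>z. z \<in> ball p r \<Longrightarrow> z \<in> G \<Longrightarrow> N z = \<Phi> z * D z"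
    and x: "x \<in> ball p r" "x \<in> closure G" "\<rho> > 0"
    and \<kappa>: "\<And>z. z \<in> ball x \<rho> \<Longrightarrow> z \<in> G \<Longrightarrow> (cmod (\<Phi> z))\<^sup>2 = \<kappa> * v z"
  shows "\<exists>c. (cmod c)\<^sup>2 = \<kappa> \<and> (\<forall>z\<in>ball p r \<inter> G. \<Phi> z = c * e z)" and "ball p r \<subseteq> closure G"
proof -
  obtain g where g: "g \<in> G" "g \<in> ball p r \<inter> ball x \<rho>"
    using x closure_iff_nhds_not_empty[of x G] by (metis Int_iff centre_in_ball disjoint_iff open_Int open_ball order_refl)
  have "open (ball p r \<inter> D -` (- {0}))"
    by (rule continuous_open_preimage[OF holomorphic_on_imp_continuous_on[OF hol(2)] open_ball]) (simp add: open_Compl)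
  from open_Int[OF this open_ball]
  have "open (ball p r \<inter> D -` (- {0}) \<inter> ball x \<rho>)" .
  moreover have "g \<in> ball p r \<inter> D -` (- {0}) \<inter> ball x \<rho>" using g D[of g] by auto
  ultimately obtain s where s: "s > 0" "ball g s \<subseteq> ball p r \<inter> D -` (- {0}) \<inter> ball x \<rho>"
    by (meson open_contains_ball)
  define h where "h z = N z / (D z * e z)" for z
  have "cmod (h z) = sqrt \<kappa>" if z: "z \<in> ball g s" for z
  proof -
    have zz: "z \<in> ball p r" "z \<in> ball x \<rho>" "D z \<noteq> 0" using s(2) z by blast+
    then have "z \<in> G" using D by blast
    note zz = zz this
    have "h z = \<Phi> z / e z" using zz \<Phi>[of z] by (simp add: h_def)
    then have "(cmod (h z))\<^sup>2 = \<kappa>"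
      using \<kappa>[OF zz(2,4)] e[OF zz(1)] by (simp add: norm_divide power_divide)
    then show ?thesis by (metis norm_ge_zero real_sqrt_unique)
  qed
  moreover have "h holomorphic_on ball g s"
    unfolding h_def using s e D
    by (intro holomorphic_intros holomorphic_on_subset[OF hol(1)] holomorphic_on_subset[OF hol(2)]
        holomorphic_on_subset[OF hol(3)]) auto
  ultimately obtain c where c: "\<And>z. z \<in> ball g s \<Longrightarrow> h z = c"
    using holomorphic_constant_modulus[of h g s "sqrt \<kappa>"] by blast
  have gG: "g \<in> ball x \<rho>" "g \<in> ball p r" "D g \<noteq> 0" using g D by auto
  have Ng: "N z = c * e z * D z" if "z \<in> ball g s" for z
  proof -
    have "z \<in> ball p r" "D z \<noteq> 0" using s(2) that by blast+
    then show ?thesis using c[OF that] e[of z] by (auto simp: h_def field_simps)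
  qed
  have N: "N z = c * e z * D z" if "z \<in> ball p r" for z
    by (rule analytic_continuation_open[OF open_ball[of g s] open_ball[of p r] _ connected_ball _ hol(1) _ Ng that])
      (use s in \<open>auto intro!: holomorphic_intros hol\<close>)
  have eq: "\<Phi> z = c * e z" if "z \<in> ball p r \<inter> G" for z
    using that N[of z] \<Phi>[of z] D[of z] by auto
  have "(cmod c)\<^sup>2 = \<kappa>"
    using eq[of g] \<kappa>[of g] g e[of g] by (auto simp: norm_mult power_mult_distrib)
  with eq show "\<exists>c. (cmod c)\<^sup>2 = \<kappa> \<and> (\<forall>z\<in>ball p r \<inter> G. \<Phi> z = c * e z)" by blast
  show "ball p r \<subseteq> closure G"
  proof
    fix y assume y: "y \<in> ball p r"
    show "y \<in> closure G"
    proof (rule ccontr)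
      assume "y \<notin> closure G"
      define A where "A = ball p r \<inter> - closure G"
      have A: "open A" "A \<noteq> {}" "A \<subseteq> ball p r"
        using y \<open>y \<notin> closure G\<close> by (auto simp: A_def)
      have "D z = 0" if "z \<in> A" for z
        using that D[of z] closure_subset[of G] by (auto simp: A_def)
      then have "D g = 0"
        using analytic_continuation_open[OF A(1) open_ball A(2) connected_ball A(3) hol(2) holomorphic_on_const _ gG(2)]
        by blast
      then show False using gG by simp
    qed
  qed
qed

text \<open>
  The function \<open>\<Phi>\<close> is single-valued on all of \<open>\<Omega>\<close>, and locally it is a constant multiple of any
  holomorphic square root \<open>e\<close> of \<open>v\<close>. Continuation along \<open>\<Omega>\<close> therefore has no monodromy.
\<close>

lemma global_norm_square_root:
  fixes \<Phi> :: "complex \<Rightarrow> complex" and v :: "complex \<Rightarrow> real"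
  assumes \<Omega>: "open \<Omega>" "connected \<Omega>" "w0 \<in> \<Omega>"
    and loc: "\<And>p. p \<in> \<Omega> \<Longrightarrow> \<exists>r>0. ball p r \<subseteq> \<Omega> \<and> (\<exists>N D e. N holomorphic_on ball p r \<and>
        D holomorphic_on ball p r \<and> e holomorphic_on ball p r \<and>
        (\<forall>z\<in>ball p r. (e z \<noteq> 0 \<and> v z = (cmod (e z))\<^sup>2) \<and> (D z \<noteq> 0 \<longleftrightarrow> z \<in> G) \<and>
           (z \<in> G \<longrightarrow> N z = \<Phi> z * D z)))"
    and w0: "w0 \<in> G" "\<rho> > 0" "\<And>z. z \<in> ball w0 \<rho> \<Longrightarrow> z \<in> G \<Longrightarrow> (cmod (\<Phi> z))\<^sup>2 = \<kappa> * v z"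
    and \<kappa>: "\<kappa> > 0"
  shows "\<exists>\<phi>. \<phi> holomorphic_on \<Omega> \<and> (\<forall>z\<in>\<Omega>. (cmod (\<phi> z))\<^sup>2 = v z)"
proof -
  \<comment> \<open>The modulus identity alone could hold vacuously near \<open>x\<close>;
    membership in \<open>closure G\<close> rules this out and lets the identity pass from ball to
    ball.\<close>
  define P where "P x \<longleftrightarrow> x \<in> closure G \<and> (\<exists>\<rho>>0. \<forall>z\<in>ball x \<rho>. z \<in> G \<longrightarrow> (cmod (\<Phi> z))\<^sup>2 = \<kappa> * v z)" for x
  define S where "S p r e \<longleftrightarrow> r > 0 \<and> ball p r \<subseteq> \<Omega> \<and> e holomorphic_on ball p r \<and>
      (\<forall>z\<in>ball p r. v z = (cmod (e z))\<^sup>2) \<and>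
      (\<forall>x\<in>ball p r. P x \<longrightarrow> ball p r \<subseteq> closure G \<and>
         (\<exists>c. (cmod c)\<^sup>2 = \<kappa> \<and> (\<forall>z\<in>ball p r \<inter> G. \<Phi> z = c * e z)))" for p r e
  have step: "\<exists>r e. S p r e" if p: "p \<in> \<Omega>" for p
  proof -
    obtain r N D e where r: "r > 0" "ball p r \<subseteq> \<Omega>" and hol: "N holomorphic_on ball p r"
        "D holomorphic_on ball p r" "e holomorphic_on ball p r"
      and *: "\<And>z. z \<in> ball p r \<Longrightarrow> e z \<noteq> 0 \<and> v z = (cmod (e z))\<^sup>2"
        "\<And>z. z \<in> ball p r \<Longrightarrow> D z \<noteq> 0 \<longleftrightarrow> z \<in> G"
        "\<And>z. z \<in> ball p r \<Longrightarrow> z \<in> G \<Longrightarrow> N z = \<Phi> z * D z"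
      using loc[OF p] by blast
    have "ball p r \<subseteq> closure G \<and> (\<exists>c. (cmod c)\<^sup>2 = \<kappa> \<and> (\<forall>z\<in>ball p r \<inter> G. \<Phi> z = c * e z))"
      if "x \<in> ball p r" "P x" for x
    proof -
      obtain \<rho> where "\<rho> > 0" "x \<in> closure G"
          "\<And>z. z \<in> ball x \<rho> \<Longrightarrow> z \<in> G \<Longrightarrow> (cmod (\<Phi> z))\<^sup>2 = \<kappa> * v z"
        using \<open>P x\<close> unfolding P_def by blast
      from continue_meromorphic_quotient[OF hol * that(1) this(2,1,3)]
      show ?thesis by blast
    qed
    then have "S p r e" unfolding S_def using r hol(3) *(1) by blast
    then show ?thesis by blast
  qed
  have P: "P y" if "y \<in> \<Omega>" for y
  proof (rule connected_induction_simple[OF \<Omega>(2,3) that])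
    show "P w0" using w0 closure_subset[of G] unfolding P_def by blast
    fix p assume "p \<in> \<Omega>"
    then obtain r e where "S p r e" using step by blast
    then have r: "r > 0" "ball p r \<subseteq> \<Omega>" and e: "\<forall>z\<in>ball p r. v z = (cmod (e z))\<^sup>2"
      and *: "\<forall>x\<in>ball p r. P x \<longrightarrow> ball p r \<subseteq> closure G \<and>
         (\<exists>c. (cmod c)\<^sup>2 = \<kappa> \<and> (\<forall>z\<in>ball p r \<inter> G. \<Phi> z = c * e z))"
      unfolding S_def by blast+
    have imp: "P y" if xy: "x \<in> ball p r" "y \<in> ball p r" "P x" for x y
    proof -
      obtain c where c: "(cmod c)\<^sup>2 = \<kappa>" "\<forall>z\<in>ball p r \<inter> G. \<Phi> z = c * e z" and G: "ball p r \<subseteq> closure G"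
        using * xy by blast
      obtain s where s: "s > 0" "ball y s \<subseteq> ball p r"
        using xy(2) by (meson open_ball open_contains_ball)
      have "(cmod (\<Phi> z))\<^sup>2 = \<kappa> * v z" if "z \<in> ball y s" "z \<in> G" for z
      proof -
        have z: "z \<in> ball p r" using s that by blast
        then have "\<Phi> z = c * e z" using c(2) that by blast
        then show ?thesis using c(1) e z by (simp add: norm_mult power_mult_distrib)
      qed
      then show ?thesis unfolding P_def using G xy(2) s(1) by blast
    qed
    have "openin (top_of_set \<Omega>) (ball p r)" using r(2) by (intro open_subset open_ball)
    moreover have "p \<in> ball p r" using r(1) by simp
    moreover have "\<forall>x\<in>ball p r. \<forall>y\<in>ball p r. P x \<longrightarrow> P y" using imp by (intro ballI impI)
    ultimately show "\<exists>T. openin (top_of_set \<Omega>) T \<and> p \<in> T \<and> (\<forall>x\<in>T. \<forall>y\<in>T. P x \<longrightarrow> P y)"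
      by blast
  qed
  \<comment> \<open>\<open>f\<close> will be a local multiple \<open>c * e\<close>: a holomorphic
    extension of \<open>\<Phi>\<close> across the points of the ball outside
    \<open>G\<close>.\<close>
  define Q where "Q p r f \<longleftrightarrow> r > 0 \<and> ball p r \<subseteq> \<Omega> \<and> ball p r \<subseteq> closure G \<and> f holomorphic_on ball p r \<and>
      (\<forall>z\<in>ball p r. (cmod (f z))\<^sup>2 = \<kappa> * v z) \<and> (\<forall>z\<in>ball p r \<inter> G. \<Phi> z = f z)" for p r f
  have "\<exists>R. Q p (fst R) (snd R)" if p: "p \<in> \<Omega>" for p
  proof -
    obtain r e where "S p r e" using step[OF p] by blast
    then have r: "r > 0" "ball p r \<subseteq> \<Omega>" and e: "e holomorphic_on ball p r"
        "\<forall>z\<in>ball p r. v z = (cmod (e z))\<^sup>2"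
      and *: "\<forall>x\<in>ball p r. P x \<longrightarrow> ball p r \<subseteq> closure G \<and>
         (\<exists>c. (cmod c)\<^sup>2 = \<kappa> \<and> (\<forall>z\<in>ball p r \<inter> G. \<Phi> z = c * e z))"
      unfolding S_def by blast+
    then obtain c where c: "(cmod c)\<^sup>2 = \<kappa>" "\<forall>z\<in>ball p r \<inter> G. \<Phi> z = c * e z" and G: "ball p r \<subseteq> closure G"
      using P[OF p] centre_in_ball[THEN iffD2, OF r(1)] by blast
    have "(\<lambda>z. c * e z) holomorphic_on ball p r" using e(1) by (intro holomorphic_intros)
    moreover have "\<forall>z\<in>ball p r. (cmod (c * e z))\<^sup>2 = \<kappa> * v z"
      using c(1) e(2) by (simp add: norm_mult power_mult_distrib)
    ultimately have "Q p r (\<lambda>z. c * e z)" unfolding Q_def using r c(2) G by blast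
    then show ?thesis by (intro exI[of _ "(r, \<lambda>z. c * e z)"]) simp
  qed
  then obtain R where R: "\<And>p. p \<in> \<Omega> \<Longrightarrow> Q p (fst (R p)) (snd (R p))" by metis
  define r where "r p = fst (R p)" for p
  define f where "f p = snd (R p)" for p
  have Q: "Q p (r p) (f p)" if "p \<in> \<Omega>" for p using R[OF that] by (simp add: r_def f_def)
  have r: "r p > 0" "ball p (r p) \<subseteq> \<Omega>" "ball p (r p) \<subseteq> closure G"
    and f: "f p holomorphic_on ball p (r p)"
      "\<And>z. z \<in> ball p (r p) \<Longrightarrow> (cmod (f p z))\<^sup>2 = \<kappa> * v z"
      "\<And>z. z \<in> ball p (r p) \<Longrightarrow> z \<in> G \<Longrightarrow> \<Phi> z = f p z" if "p \<in> \<Omega>" for p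
    using Q[OF that] unfolding Q_def by blast+
  \<comment> \<open>The set where two extensions differ is open; if it contained \<open>z\<close>,
    density would make it meet \<open>G\<close>, where both equal \<open>\<Phi>\<close>.\<close>
  have agree: "f z z = f p z" if p: "p \<in> \<Omega>" and z: "z \<in> ball p (r p)" for p z
  proof (rule ccontr)
    have z\<Omega>: "z \<in> \<Omega>" using r(2)[OF p] z by blast
    define W where "W = ball z (r z) \<inter> ball p (r p)"
    have "continuous_on W (\<lambda>u. f z u - f p u)"
      unfolding W_def
      by (intro continuous_on_diff holomorphic_on_imp_continuous_on
          holomorphic_on_subset[OF f(1)[OF z\<Omega>]] holomorphic_on_subset[OF f(1)[OF p]]) auto
    then have "open (W \<inter> (\<lambda>u. f z u - f p u) -` (- {0}))"
      by (rule continuous_open_preimage) (auto simp: W_def open_Compl)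
    moreover assume "f z z \<noteq> f p z"
    then have "z \<in> W \<inter> (\<lambda>u. f z u - f p u) -` (- {0})"
      using z r(1)[OF z\<Omega>] by (simp add: W_def)
    moreover have "z \<in> closure G" using r(3)[OF p] z by blast
    ultimately have "(W \<inter> (\<lambda>u. f z u - f p u) -` (- {0})) \<inter> G \<noteq> {}"
      using closure_iff_nhds_not_empty[of z G] by blast
    then obtain u where "u \<in> G" "u \<in> W" and u: "f z u - f p u \<in> - {0}"
      by blast
    moreover from this have "f z u \<noteq> f p u" by simp
    moreover have "f z u = \<Phi> u" "f p u = \<Phi> u"
      using f(3)[OF z\<Omega>, of u] f(3)[OF p, of u] \<open>u \<in> G\<close> \<open>u \<in> W\<close> by (auto simp: W_def)
    ultimately show False by simp
  qed
  define \<phi> where "\<phi> z = f z z / sqrt \<kappa>" for z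
  have "\<phi> field_differentiable at p" if p: "p \<in> \<Omega>" for p
  proof -
    have "(\<lambda>z. f p z / sqrt \<kappa>) holomorphic_on ball p (r p)"
      using f(1)[OF p] \<kappa> by (intro holomorphic_intros) auto
    then have "\<phi> holomorphic_on ball p (r p)"
      by (rule holomorphic_transform) (simp add: \<phi>_def agree[OF p])
    then show ?thesis
      using r(1)[OF p] by (intro holomorphic_on_imp_differentiable_at[OF _ open_ball]) auto
  qed
  then have "\<phi> holomorphic_on \<Omega>"
    by (auto simp: holomorphic_on_def intro: field_differentiable_at_within)
  moreover have "(cmod (\<phi> z))\<^sup>2 = v z" if "z \<in> \<Omega>" for z
    using f(2)[OF that, of z] r(1)[OF that] \<kappa> by (simp add: \<phi>_def norm_divide power_divide)
  ultimately show ?thesis by blast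
qed

section \<open>Curvature in a holomorphic frame\<close>

lemma twice_cdiff_on_subset: "twice_cdiff_on f f' U \<Longrightarrow> V \<subseteq> U \<Longrightarrow> twice_cdiff_on f f' V"
  by (auto simp: twice_cdiff_on_def)

lemma twice_cdiff_on_transform:
  assumes "twice_cdiff_on f f' U" "open U" "\<And>z. z \<in> U \<Longrightarrow> f z = g z"
  shows "twice_cdiff_on g f' U"
  using assms(1) has_cderiv_transform[of f _ _ U g, OF _ assms(2) _ assms(3)]
  unfolding twice_cdiff_on_def by blast

lemma twice_cdiff_on_continuous: "twice_cdiff_on f f' U \<Longrightarrow> continuous_on U f"
  by (auto simp: twice_cdiff_on_def intro!: continuous_at_imp_continuous_on has_cderiv_continuous)

lemma twice_cdiff_on_vholomorphic: "twice_cdiff_on f f' U \<Longrightarrow> open U \<Longrightarrow> f vholomorphic_on U"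
  by (auto simp: twice_cdiff_on_def vholomorphic_on_has_cderiv)

lemma twice_cdiff_on_bounded_clinear:
  "bounded_clinear A \<Longrightarrow> twice_cdiff_on f f' U \<Longrightarrow> twice_cdiff_on (\<lambda>z. A (f z)) (\<lambda>z. A (f' z)) U"
  unfolding twice_cdiff_on_def using has_cderiv_bounded_clinear by blast

text \<open>Holomorphic scalar coefficients have derivatives of all orders, so a section expanded in
  a twice differentiable frame is itself twice differentiable.\<close>

lemma twice_cdiff_on_lincomb:
  assumes a: "a holomorphic_on U" and c: "c holomorphic_on U" and U: "open U"
    and f: "twice_cdiff_on f f' U" and g: "twice_cdiff_on g g' U"
  shows "twice_cdiff_on (\<lambda>z. a z *\<^sub>C f z + c z *\<^sub>C g z)
    (\<lambda>z. (a z *\<^sub>C f' z + deriv a z *\<^sub>C f z) + (c z *\<^sub>C g' z + deriv c z *\<^sub>C g z)) U"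
  unfolding twice_cdiff_on_def
proof (intro ballI conjI)
  fix z assume z: "z \<in> U"
  note d = holomorphic_derivI[OF a U z] holomorphic_derivI[OF c U z]
    holomorphic_derivI[OF holomorphic_deriv[OF a U] U z] holomorphic_derivI[OF holomorphic_deriv[OF c U] U z]
  obtain f'' g'' where fg: "has_cderiv f (f' z) z" "has_cderiv f' f'' z"
      "has_cderiv g (g' z) z" "has_cderiv g' g'' z"
    using f g z unfolding twice_cdiff_on_def by blast
  show "has_cderiv (\<lambda>z. a z *\<^sub>C f z + c z *\<^sub>C g z)
      ((a z *\<^sub>C f' z + deriv a z *\<^sub>C f z) + (c z *\<^sub>C g' z + deriv c z *\<^sub>C g z)) z"
    by (intro has_cderiv_add has_cderiv_cscale d fg)
  show "\<exists>D. has_cderiv (\<lambda>z. (a z *\<^sub>C f' z + deriv a z *\<^sub>C f z) + (c z *\<^sub>C g' z + deriv c z *\<^sub>C g z)) D z"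
    by (rule exI, rule has_cderiv_add[OF has_cderiv_add[OF has_cderiv_cscale[OF d(1) fg(2)]
      has_cderiv_cscale[OF d(3) fg(1)]] has_cderiv_add[OF has_cderiv_cscale[OF d(2) fg(4)]
      has_cderiv_cscale[OF d(4) fg(3)]]])
qed

text \<open>If \<open>f\<close> is \<open>g\<close> times a scalar function, pairing with a fixed
  \<open>b\<close> recovers that function as this quotient and so shows it to be
  holomorphic.\<close>

lemma holomorphic_cinner_ratio:
  assumes U: "open U" and f: "f vholomorphic_on U" and g: "g vholomorphic_on U"
    and nz: "\<And>z. z \<in> U \<Longrightarrow> cinner (g z) b \<noteq> 0"
  shows "(\<lambda>z. cinner (f z) b / cinner (g z) b) holomorphic_on U"
proof -
  have "(\<lambda>z. cinner (h z) b) holomorphic_on U" if "h vholomorphic_on U" for h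
    unfolding holomorphic_on_open[OF U]
    using that vholomorphic_on_has_cderiv[OF U, of h] has_cderiv_cinner by blast
  then show ?thesis using f g nz by (intro holomorphic_on_divide) auto
qed

lemma has_wirtinger_compose:
  assumes "has_wirtinger f a b z" "(h has_field_derivative h') (at (f z))"
  shows "has_wirtinger (\<lambda>z. h (f z)) (h' * a) (h' * b) z"
  unfolding has_wirtinger_def
  by (rule has_derivative_eq_rhs[OF has_derivative_compose[OF assms(1)[unfolded has_wirtinger_def]
        assms(2)[unfolded has_field_derivative_def]]]) (simp add: fun_eq_iff algebra_simps)

text \<open>On positive reals \<open>ln\<close> agrees with the principal branch \<open>Ln\<close>,
  so the complex chain rule turns the z-derivative of the logarithm into a logarithmic
  derivative.\<close>

lemma section_curvature_log_laplacian:
  assumes U: "open U" "w \<in> U" and \<gamma>: "\<gamma> vholomorphic_on U" "\<And>z. z \<in> U \<Longrightarrow> \<gamma> z \<noteq> 0"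
  shows "section_curvature \<gamma> w = - log_laplacian (\<lambda>z. cinner (\<gamma> z) (\<gamma> z)) w"
proof -
  have "dz (\<lambda>z. complex_of_real (ln ((norm (\<gamma> z))\<^sup>2))) z =
      dz (\<lambda>z. cinner (\<gamma> z) (\<gamma> z)) z / cinner (\<gamma> z) (\<gamma> z)" if z: "z \<in> U" for z
  proof -
    obtain D where "has_cderiv \<gamma> D z" using \<gamma> z vholomorphic_on_has_cderiv[OF U(1)] by blast
    then have d: "has_wirtinger (\<lambda>z. cinner (\<gamma> z) (\<gamma> z)) (cinner D (\<gamma> z)) (cinner (\<gamma> z) D) z"
      by (intro has_wirtinger_cinner)
    have pos: "(norm (\<gamma> u))\<^sup>2 > 0" if "u \<in> U" for u using \<gamma>(2)[OF that] by simp
    have "cinner (\<gamma> z) (\<gamma> z) \<notin> \<real>\<^sub>\<le>\<^sub>0"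
      unfolding cinner_same complex_nonpos_Reals_iff using pos[OF z] by simp
    from has_wirtinger_compose[OF d has_field_derivative_Ln[OF this]]
    have "has_wirtinger (\<lambda>z. complex_of_real (ln ((norm (\<gamma> z))\<^sup>2)))
        (inverse (cinner (\<gamma> z) (\<gamma> z)) * cinner D (\<gamma> z)) (inverse (cinner (\<gamma> z) (\<gamma> z)) * cinner (\<gamma> z) D) z"
      by (rule has_wirtinger_transform[OF _ U(1) z]) (simp only: cinner_same Ln_of_real[OF pos])
    then show ?thesis
      using has_wirtinger_dz has_wirtinger_dz[OF d] by (simp add: field_simps)
  qed
  then show ?thesis
    unfolding section_curvature_def log_laplacian_def
    by (subst dzbar_cong[OF U]) auto
qed

text \<open>The section behind \<open>line_curvature\<close> is an unspecified choice. On a line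
  bundle it equals \<open>c z *\<^sub>C x z\<close>, and near \<open>w\<close> pairing with
  \<open>x w\<close> shows \<open>c\<close> to be holomorphic; gauge invariance then removes
  it.\<close>

lemma line_curvature_log_laplacian:
  assumes x: "twice_cdiff_on x x' U" "\<And>z. z \<in> U \<Longrightarrow> x z \<in> kernel (shift_op T z) \<and> x z \<noteq> 0"
    and U: "open U" "U \<subseteq> \<Omega>" "w \<in> U"
    and line: "\<And>z y. z \<in> U \<Longrightarrow> y \<in> kernel (shift_op T z) \<Longrightarrow> \<exists>c. y = c *\<^sub>C x z"
  shows "line_curvature \<Omega> T w = - log_laplacian (\<lambda>z. cinner (x z) (x z)) w"
    and "local_section \<Omega> T w w \<in> kernel (shift_op T w) \<and> local_section \<Omega> T w w \<noteq> 0"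
proof -
  define \<gamma> where "\<gamma> = local_section \<Omega> T w"
  have "nonvanishing_section \<Omega> T U x"
    unfolding nonvanishing_section_def using x U twice_cdiff_on_vholomorphic by blast
  then have "\<exists>\<gamma> U. w \<in> U \<and> nonvanishing_section \<Omega> T U \<gamma>"
    using U(3) by blast
  from someI_ex[OF this] have "\<exists>U. w \<in> U \<and> nonvanishing_section \<Omega> T U \<gamma>"
    unfolding \<gamma>_def local_section_def .
  then obtain V where V: "w \<in> V" "open V" "V \<subseteq> \<Omega>" "\<gamma> vholomorphic_on V"
      "\<And>z. z \<in> V \<Longrightarrow> \<gamma> z \<in> kernel (shift_op T z) \<and> \<gamma> z \<noteq> 0"
    unfolding nonvanishing_section_def by blast
  then show "local_section \<Omega> T w w \<in> kernel (shift_op T w) \<and> local_section \<Omega> T w w \<noteq> 0"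
    by (simp add: \<gamma>_def)
  define W where "W = (U \<inter> (\<lambda>z. cinner (x z) (x w)) -` (- {0})) \<inter> V"
  have "continuous_on U (\<lambda>z. cinner (x z) (x w))"
    using bounded_linear.continuous_on[OF bounded_bilinear.bounded_linear_left[OF bounded_bilinear_cinner]
        twice_cdiff_on_continuous[OF x(1)]] .
  then have "open W" unfolding W_def
    by (intro open_Int continuous_open_preimage U V) auto
  have wW: "w \<in> W" using U V x(2)[OF U(3)] by (simp add: W_def)
  define c where "c z = cinner (\<gamma> z) (x w) / cinner (x z) (x w)" for z
  have vh: "f vholomorphic_on W" if "f vholomorphic_on A" "open A" "W \<subseteq> A" for f :: "complex \<Rightarrow> 'a" and A
    using that vholomorphic_on_has_cderiv \<open>open W\<close> by blast
  have c: "c holomorphic_on W"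
    unfolding c_def
    by (rule holomorphic_cinner_ratio[OF \<open>open W\<close> vh[OF V(4,2)] vh[OF twice_cdiff_on_vholomorphic[OF x(1) U(1)] U(1)]])
      (auto simp: W_def)
  have \<gamma>: "\<gamma> z = c z *\<^sub>C x z" if z: "z \<in> W" for z
  proof -
    have "z \<in> U" "z \<in> V" "cinner (x z) (x w) \<noteq> 0" using z by (auto simp: W_def)
    then obtain d where "\<gamma> z = d *\<^sub>C x z" using line V(5) by blast
    then show ?thesis using \<open>cinner (x z) (x w) \<noteq> 0\<close> by (simp add: c_def cinner_cscale_left)
  qed
  have cw: "c w \<noteq> 0" using \<gamma>[OF wW] V(5)[OF V(1)] by auto
  have "section_curvature \<gamma> w = - log_laplacian (\<lambda>z. cinner (\<gamma> z) (\<gamma> z)) w"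
    by (rule section_curvature_log_laplacian[OF V(2,1,4)]) (use V(5) in blast)
  also have "log_laplacian (\<lambda>z. cinner (\<gamma> z) (\<gamma> z)) w =
      log_laplacian (\<lambda>z. c z * cnj (c z) * cinner (x z) (x z)) w"
    by (rule log_laplacian_cong[OF \<open>open W\<close> wW]) (simp add: \<gamma> cinner_cscale_left cinner_cscale_right)
  also have "\<dots> = log_laplacian (\<lambda>z. cinner (x z) (x z)) w"
    by (rule log_laplacian_norm_square_mult[OF c \<open>open W\<close> wW cw wirtinger_C2_cinner[OF x(1) x(1) U(1,3)]])
      (use x(2)[OF U(3)] in simp)
  finally show "line_curvature \<Omega> T w = - log_laplacian (\<lambda>z. cinner (x z) (x z)) w"
    by (simp add: line_curvature_def \<gamma>_def)
qed

lemma matrix_inv_2: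
  fixes A :: "'a::field^2^2"
  assumes "det A \<noteq> 0"
  shows "matrix_inv A $ 1 $ 1 = A$2$2 / det A" "matrix_inv A $ 1 $ 2 = - A$1$2 / det A"
    "matrix_inv A $ 2 $ 1 = - A$2$1 / det A" "matrix_inv A $ 2 $ 2 = A$1$1 / det A"
proof -
  define B where "B = matrix_inv A"
  have "invertible A" using assms by (simp add: invertible_det_nz)
  then have "B ** A = mat 1" unfolding B_def invertible_def matrix_inv_def by (metis (mono_tags, lifting) someI_ex)
  then have e: "B$1$1 * A$1$1 + B$1$2 * A$2$1 = 1" "B$1$1 * A$1$2 + B$1$2 * A$2$2 = 0"
    "B$2$1 * A$1$1 + B$2$2 * A$2$1 = 0" "B$2$1 * A$1$2 + B$2$2 * A$2$2 = 1"
    by (simp_all add: vec_eq_iff forall_2 matrix_matrix_mult_def sum_2 mat_def)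
  have "B$1$1 * det A = A$2$2" "B$1$2 * det A = - A$1$2" "B$2$1 * det A = - A$2$1" "B$2$2 * det A = A$1$1"
    unfolding det_2 using e by algebra+
  then show "matrix_inv A $ 1 $ 1 = A$2$2 / det A" "matrix_inv A $ 1 $ 2 = - A$1$2 / det A"
    "matrix_inv A $ 2 $ 1 = - A$2$1 / det A" "matrix_inv A $ 2 $ 2 = A$1$1 / det A"
    unfolding B_def by (simp_all only: nonzero_eq_divide_eq[OF assms])
qed

text \<open>Jacobi's formula: the trace of the inverse Gram matrix times its z-derivative is the
  logarithmic derivative of the determinant. The diagonal entries \<open>m1\<close> and
  \<open>m2\<close> come from the cofactor form of the inverse, and their sum is
  \<open>dz \<Delta> z / \<Delta> z\<close>.\<close>

lemma trace_frame_curvature: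
  fixes \<gamma> :: "2 \<Rightarrow> complex \<Rightarrow> 'a::complex_hilbert_space"
  assumes \<gamma>: "\<And>i. twice_cdiff_on (\<gamma> i) (\<gamma>' i) V" and V: "open V" "w \<in> V"
    and det: "\<And>z. z \<in> V \<Longrightarrow> det (gram \<gamma> z) \<noteq> 0"
  shows "trace (frame_curvature \<gamma> w) = - log_laplacian (\<lambda>z. det (gram \<gamma> z)) w"
proof -
  define h where "h i j z = cinner (\<gamma> j z) (\<gamma> i z)" for i j z
  define k where "k i j z = cinner (\<gamma>' j z) (\<gamma> i z)" for i j z
  have d: "has_cderiv (\<gamma> i) (\<gamma>' i z) z" if "z \<in> V" for i z
    using \<gamma> that by (auto simp: twice_cdiff_on_def)
  have dh: "has_wirtinger (h i j) (k i j z) (cinner (\<gamma> j z) (\<gamma>' i z)) z" if "z \<in> V" for i j z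
    unfolding h_def k_def by (rule has_wirtinger_cinner[OF d d]) (use that in auto)
  have dk: "\<exists>c d. has_wirtinger (k i j) c d w" for i j
  proof -
    obtain \<gamma>'' where "has_cderiv (\<gamma>' j) \<gamma>'' w" using \<gamma>[of j] V(2) by (auto simp: twice_cdiff_on_def)
    from has_wirtinger_cinner[OF this d[OF V(2)]] show ?thesis unfolding k_def by blast
  qed
  have gram: "gram \<gamma> z $ i $ j = h i j z" for i j z by (simp add: gram_def h_def)
  define \<Delta> where "\<Delta> z = h 1 1 z * h 2 2 z - h 1 2 z * h 2 1 z" for z
  have \<Delta>: "det (gram \<gamma> z) = \<Delta> z" for z by (simp add: det_2 gram \<Delta>_def)
  have d\<Delta>: "has_wirtinger \<Delta> ((k 1 1 z * h 2 2 z + h 1 1 z * k 2 2 z) - (k 1 2 z * h 2 1 z + h 1 2 z * k 2 1 z))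
      ((cinner (\<gamma> 1 z) (\<gamma>' 1 z) * h 2 2 z + h 1 1 z * cinner (\<gamma> 2 z) (\<gamma>' 2 z)) -
       (cinner (\<gamma> 2 z) (\<gamma>' 1 z) * h 2 1 z + h 1 2 z * cinner (\<gamma> 1 z) (\<gamma>' 2 z))) z" if "z \<in> V" for z
    unfolding \<Delta>_def by (intro has_wirtinger_diff has_wirtinger_mult dh that)
  define M where "M z = matrix_inv (gram \<gamma> z) ** (\<chi> i j. dz (\<lambda>u. gram \<gamma> u $ i $ j) z)" for z
  define m1 where "m1 z = (h 2 2 z * k 1 1 z - h 1 2 z * k 2 1 z) / \<Delta> z" for z
  define m2 where "m2 z = (h 1 1 z * k 2 2 z - h 2 1 z * k 1 2 z) / \<Delta> z" for z
  have dzg: "dz (h i j) z = k i j z" if "z \<in> V" for i j z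
    by (rule has_wirtinger_dz[OF dh[OF that]])
  have M: "M z $ 1 $ 1 = m1 z" "M z $ 2 $ 2 = m2 z" if "z \<in> V" for z
    by (simp_all add: M_def matrix_matrix_mult_def sum_2 matrix_inv_2[OF det[OF that]] dzg[OF that]
        gram \<Delta> m1_def m2_def diff_divide_distrib)
  obtain c d where D: "has_wirtinger \<Delta> c d w" using d\<Delta>[OF V(2)] by blast
  have D0: "\<Delta> w \<noteq> 0" using det[OF V(2)] by (simp add: \<Delta>)
  have md: "\<exists>c d. has_wirtinger (\<lambda>z. (h i j z * k i' j' z - h p q z * k p' q' z) / \<Delta> z) c d w" for i j i' j' p q p' q'
  proof -
    obtain a1 b1 a2 b2 where "has_wirtinger (k i' j') a1 b1 w" "has_wirtinger (k p' q') a2 b2 w"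
      using dk by blast
    from has_wirtinger_divide[OF has_wirtinger_diff[OF has_wirtinger_mult[OF dh[OF V(2)] this(1)]
        has_wirtinger_mult[OF dh[OF V(2)] this(2)]] D D0]
    show ?thesis by blast
  qed
  obtain a1 b1 a2 b2 where m: "has_wirtinger m1 a1 b1 w" "has_wirtinger m2 a2 b2 w"
    using md[of 2 2 1 1 1 2 2 1] md[of 1 1 2 2 2 1 1 2] unfolding m1_def m2_def by blast
  have "trace (frame_curvature \<gamma> w) = - dzbar (\<lambda>z. M z $ 1 $ 1) w - dzbar (\<lambda>z. M z $ 2 $ 2) w"
    by (simp add: trace_def sum_2 frame_curvature_def M_def)
  also have "\<dots> = - dzbar m1 w - dzbar m2 w"
    using dzbar_cong[OF V M(1)] dzbar_cong[OF V M(2)] by simp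
  also have "\<dots> = - dzbar (\<lambda>z. m1 z + m2 z) w"
    using has_wirtinger_dzbar[OF has_wirtinger_add[OF m]] has_wirtinger_dzbar[OF m(1)]
      has_wirtinger_dzbar[OF m(2)] by simp
  also have "dzbar (\<lambda>z. m1 z + m2 z) w = dzbar (\<lambda>z. dz \<Delta> z / \<Delta> z) w"
    by (rule dzbar_cong[OF V])
      (simp add: has_wirtinger_dz[OF d\<Delta>] m1_def m2_def add_divide_distrib[symmetric] algebra_simps)
  finally show ?thesis by (simp add: log_laplacian_def \<Delta>)
qed

section \<open>Eigenvectors of the block operator\<close>

lemma kernel_shift_op_iff: "x \<in> kernel (shift_op T z) \<longleftrightarrow> T x = z *\<^sub>C x"
  by (simp add: kernel_def shift_op_def)

lemma cowen_douglas_eigenline: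
  assumes T: "T \<in> cowen_douglas 1 \<Omega>" and z: "z \<in> \<Omega>"
  shows "\<exists>x. x \<noteq> 0 \<and> T x = z *\<^sub>C x"
    and "T x = z *\<^sub>C x \<Longrightarrow> x \<noteq> 0 \<Longrightarrow> T y = z *\<^sub>C y \<Longrightarrow> \<exists>c. y = c *\<^sub>C x"
proof -
  have "cvec.dim (kernel (shift_op T z)) = 1" using T z by (simp add: cowen_douglas_def)
  then obtain B where B: "B \<subseteq> kernel (shift_op T z)" "cvec.independent B"
      "kernel (shift_op T z) \<subseteq> cvec.span B" "card B = 1"
    by (metis cvec.basis_exists)
  then obtain b where b: "B = {b}" using card_1_singletonE by blast
  have "b \<noteq> 0" using B(2) b cvec.dependent_zero by blast
  moreover have "T b = z *\<^sub>C b" using B(1) b by (simp add: kernel_shift_op_iff)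
  ultimately show "\<exists>x. x \<noteq> 0 \<and> T x = z *\<^sub>C x" by blast
  assume *: "T x = z *\<^sub>C x" "x \<noteq> 0" "T y = z *\<^sub>C y"
  then have "x \<in> range (\<lambda>k. k *\<^sub>C b)" "y \<in> range (\<lambda>k. k *\<^sub>C b)"
    using B(3) b by (auto simp: cvec.span_singleton[symmetric] kernel_shift_op_iff)
  then obtain c d where cd: "x = c *\<^sub>C b" "y = d *\<^sub>C b" by (elim rangeE)
  then have "c \<noteq> 0" using * by auto
  then have "y = (d / c) *\<^sub>C x" using cd by (simp add: cscale_cscale)
  then show "\<exists>c. y = c *\<^sub>C x" by blast
qed

lemma cvec_independent_pair:
  fixes a b :: "'a::complex_hilbert_space"
  assumes "a \<noteq> b"
  shows "cvec.independent {a, b} \<longleftrightarrow> (\<forall>s t. s *\<^sub>C a + t *\<^sub>C b = 0 \<longrightarrow> s = 0 \<and> t = 0)"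
proof
  assume ind: "cvec.independent {a, b}"
  have "b \<noteq> 0" using ind cvec.dependent_zero[of "{a, b}"] by auto
  have ab: "a \<notin> cvec.span {b}" using ind assms by (simp add: cvec.independent_insert)
  show "\<forall>s t. s *\<^sub>C a + t *\<^sub>C b = 0 \<longrightarrow> s = 0 \<and> t = 0"
  proof (intro allI impI)
    fix s t assume *: "s *\<^sub>C a + t *\<^sub>C b = 0"
    have "s = 0"
    proof (rule ccontr)
      assume s: "s \<noteq> 0"
      have "a = (1 / s) *\<^sub>C (s *\<^sub>C a)" using s by (simp add: cscale_cscale)
      also have "s *\<^sub>C a = (- t) *\<^sub>C b" using * by (simp add: eq_neg_iff_add_eq_0)
      also have "(1 / s) *\<^sub>C (- t) *\<^sub>C b = (- t / s) *\<^sub>C b" unfolding cscale_cscale by simp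
      finally have "a \<in> cvec.span {b}" unfolding cvec.span_singleton by (rule range_eqI)
      then show False using ab by blast
    qed
    then show "s = 0 \<and> t = 0" using * \<open>b \<noteq> 0\<close> by simp
  qed
next
  assume *: "\<forall>s t. s *\<^sub>C a + t *\<^sub>C b = 0 \<longrightarrow> s = 0 \<and> t = 0"
  have "b \<noteq> 0" using *[rule_format, of 0 1] by auto
  moreover have "a \<notin> cvec.span {b}"
  proof
    assume "a \<in> cvec.span {b}"
    then obtain k where "a = k *\<^sub>C b" by (auto simp: cvec.span_singleton)
    then have "1 *\<^sub>C a + (- k) *\<^sub>C b = 0" by simp
    then show False using * by (metis one_neq_zero)
  qed
  ultimately show "cvec.independent {a, b}"
    using assms by (simp add: cvec.independent_insert)
qed

lemma cvec_span_pair: "cvec.span {a, b} = {s *\<^sub>C a + t *\<^sub>C b | s t. True}"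
proof -
  have "x \<in> cvec.span {a, b} \<longleftrightarrow> (\<exists>s t. x = s *\<^sub>C a + t *\<^sub>C b)" for x
  proof
    assume "x \<in> cvec.span {a, b}"
    then obtain s t where "x - s *\<^sub>C a = t *\<^sub>C b"
      by (auto simp: cvec.span_insert[of a] cvec.span_singleton)
    then have "x = s *\<^sub>C a + t *\<^sub>C b" by (simp add: diff_eq_eq add.commute)
    then show "\<exists>s t. x = s *\<^sub>C a + t *\<^sub>C b" by blast
  next
    assume "\<exists>s t. x = s *\<^sub>C a + t *\<^sub>C b"
    then obtain s t where x: "x = s *\<^sub>C a + t *\<^sub>C b" by blast
    show "x \<in> cvec.span {a, b}"
      unfolding x by (intro cvec.span_add cvec.span_scale cvec.span_base) auto
  qed
  then show ?thesis by blast
qed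

text \<open>
  For \<open>z \<in> \<Omega>\<close> an eigentriple \<open>(x\<^sub>0, x\<^sub>1, y)\<close> encodes the basis \<open>(x\<^sub>0, 0)\<close>, \<open>(y, x\<^sub>1)\<close> of
  \<open>ker (T - z)\<close>, and \<open>pairing_det\<close> is the determinant of the inner products of two such bases.
\<close>

definition pairing_det ::
    "'a::complex_hilbert_space \<Rightarrow> 'b::complex_hilbert_space \<Rightarrow> 'a \<Rightarrow> 'a \<Rightarrow> 'b \<Rightarrow> 'a \<Rightarrow> complex" where
  "pairing_det x0 x1 y a0 a1 b =
     cinner x0 a0 * (cinner y b + cinner x1 a1) - cinner y a0 * cinner x0 b"

text \<open>The first summand is the Gram determinant for \<open>y = 0\<close>; the inner difference
  is the Cauchy-Schwarz defect of \<open>x0\<close> and \<open>y\<close>, so the whole is positive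
  for an eigentriple.\<close>

lemma pairing_det_same:
  "pairing_det x0 x1 y x0 x1 y = complex_of_real
     ((norm x0)\<^sup>2 * (norm x1)\<^sup>2 + ((norm x0)\<^sup>2 * (norm y)\<^sup>2 - (cmod (cinner x0 y))\<^sup>2))"
  unfolding pairing_det_def of_real_add of_real_diff of_real_mult cinner_same[symmetric]
    cinner_mult_commute[symmetric]
  by (simp add: algebra_simps)

text \<open>Passing to another eigentriple is a triangular change of basis with diagonal entries
  \<open>f\<close> and \<open>g\<close>. The determinant sees only their product, and
  \<open>h\<close> cancels.\<close>

lemma pairing_det_gauge_left:
  "pairing_det (f *\<^sub>C x0) (g *\<^sub>C x1) (g *\<^sub>C y + h *\<^sub>C x0) a0 a1 b = f * g * pairing_det x0 x1 y a0 a1 b"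
  by (simp add: pairing_det_def cinner_add_left cinner_cscale_left algebra_simps)

lemma pairing_det_gauge_right:
  "pairing_det a0 a1 b (f *\<^sub>C x0) (g *\<^sub>C x1) (g *\<^sub>C y + h *\<^sub>C x0) = cnj (f * g) * pairing_det a0 a1 b x0 x1 y"
  by (simp add: pairing_det_def cinner_add_right cinner_cscale_right algebra_simps)

locale FB2_operator =
  fixes \<Omega> :: "complex set"
    and T0 :: "'a::{complex_hilbert_space, second_countable_topology} \<Rightarrow> 'a"
    and T1 :: "'b::{complex_hilbert_space, second_countable_topology} \<Rightarrow> 'b"
    and S :: "'b \<Rightarrow> 'a"
  assumes open_\<Omega>: "open \<Omega>" and FB2: "FB2 \<Omega> T0 S T1"
begin

lemma T0: "T0 \<in> cowen_douglas 1 \<Omega>" and T1: "T1 \<in> cowen_douglas 1 \<Omega>"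
  and clinear: "bounded_clinear T0" "bounded_clinear S" "bounded_clinear T1"
  and S_nonzero: "S \<noteq> (\<lambda>_. 0)"
  using FB2 by (auto simp: FB2_def cowen_douglas_def)

lemma intertwine: "T0 (S x) = S (T1 x)"
  using FB2 by (simp add: FB2_def fun_eq_iff)

lemma op_simps [simp]:
  "T0 (c *\<^sub>C x) = c *\<^sub>C T0 x" "S (c *\<^sub>C u) = c *\<^sub>C S u" "T1 (c *\<^sub>C u) = c *\<^sub>C T1 u"
  "T0 (x + y) = T0 x + T0 y" "S (u + v) = S u + S v" "T1 (u + v) = T1 u + T1 v"
  using clinear by (auto simp: bounded_clinear_def linear_simps)

lemma surj_T0: "z \<in> \<Omega> \<Longrightarrow> \<exists>x. T0 x = z *\<^sub>C x + y"
  and surj_T1: "z \<in> \<Omega> \<Longrightarrow> \<exists>u. T1 u = z *\<^sub>C u + v"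
proof -
  assume z: "z \<in> \<Omega>"
  then have "y \<in> range (shift_op T0 z)" "v \<in> range (shift_op T1 z)"
    using T0 T1 by (auto simp: cowen_douglas_def)
  then obtain x u where "y = T0 x - z *\<^sub>C x" "v = T1 u - z *\<^sub>C u"
    by (auto simp: shift_op_def)
  then have "T0 x = z *\<^sub>C x + y" "T1 u = z *\<^sub>C u + v" by simp_all
  then show "\<exists>x. T0 x = z *\<^sub>C x + y" "\<exists>u. T1 u = z *\<^sub>C u + v" by blast+
qed

lemma block_clinear: "bounded_clinear (block_op T0 S T1)"
proof -
  have "bounded_linear (\<lambda>p. (T0 (fst p) + S (snd p), T1 (snd p)))"
    using clinear unfolding bounded_clinear_def
    by (intro bounded_linear_Pair bounded_linear_add bounded_linear_compose[OF _ bounded_linear_fst]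
        bounded_linear_compose[OF _ bounded_linear_snd]) auto
  moreover have "block_op T0 S T1 = (\<lambda>p. (T0 (fst p) + S (snd p), T1 (snd p)))"
    by (simp add: block_op_def case_prod_beta fun_eq_iff)
  ultimately show ?thesis
    by (simp add: bounded_clinear_def cscale_prod_def cscale_add_right)
qed

lemma block_kernel_iff:
  "(y, x) \<in> kernel (shift_op (block_op T0 S T1) z) \<longleftrightarrow> T1 x = z *\<^sub>C x \<and> T0 y + S x = z *\<^sub>C y"
  by (auto simp: kernel_shift_op_iff block_op_def cscale_prod_def)

lemma block_surj:
  assumes "z \<in> \<Omega>"
  shows "range (shift_op (block_op T0 S T1) z) = UNIV"
proof -
  have "(a, b) \<in> range (shift_op (block_op T0 S T1) z)" for a b
  proof -
    obtain u where "T1 u = z *\<^sub>C u + b" using surj_T1[OF assms] by blast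
    moreover obtain x where "T0 x = z *\<^sub>C x + (a - S u)" using surj_T0[OF assms] by blast
    ultimately have "shift_op (block_op T0 S T1) z (x, u) = (a, b)"
      by (simp add: shift_op_def block_op_def cscale_prod_def)
    then show ?thesis by (metis rangeI)
  qed
  then show ?thesis by auto
qed

definition eigentriple :: "complex \<Rightarrow> 'a \<Rightarrow> 'b \<Rightarrow> 'a \<Rightarrow> bool" where
  "eigentriple z x0 x1 y \<longleftrightarrow> x0 \<noteq> 0 \<and> T0 x0 = z *\<^sub>C x0 \<and> x1 \<noteq> 0 \<and> T1 x1 = z *\<^sub>C x1 \<and> T0 y + S x1 = z *\<^sub>C y"

lemma eigentriple_exists:
  assumes z: "z \<in> \<Omega>" and x1: "x1 \<noteq> 0" "T1 x1 = z *\<^sub>C x1"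
  shows "\<exists>x0 y. eigentriple z x0 x1 y"
proof -
  obtain x0 where "x0 \<noteq> 0" "T0 x0 = z *\<^sub>C x0" using cowen_douglas_eigenline(1)[OF T0 z] by blast
  moreover obtain y where "T0 y = z *\<^sub>C y + (- S x1)" using surj_T0[OF z] by blast
  ultimately show ?thesis using x1 unfolding eigentriple_def by (intro exI[of _ x0] exI[of _ y]) simp
qed

text \<open>Both \<open>y'\<close> and \<open>g *\<^sub>C y\<close> solve the inhomogeneous equation
  belonging to \<open>x1'\<close>, so their difference is an eigenvector of \<open>T0\<close> or
  zero, and in either case a multiple of \<open>x0\<close>.\<close>

lemma eigentriple_gauge:
  assumes z: "z \<in> \<Omega>" and t: "eigentriple z x0 x1 y" and t': "eigentriple z x0' x1' y'"
  shows "\<exists>f g h. f \<noteq> 0 \<and> g \<noteq> 0 \<and> x0' = f *\<^sub>C x0 \<and> x1' = g *\<^sub>C x1 \<and> y' = g *\<^sub>C y + h *\<^sub>C x0"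
proof -
  obtain f where f: "x0' = f *\<^sub>C x0"
    using cowen_douglas_eigenline(2)[OF T0 z, of x0 x0'] t t' unfolding eigentriple_def by blast
  obtain g where g: "x1' = g *\<^sub>C x1"
    using cowen_douglas_eigenline(2)[OF T1 z, of x1 x1'] t t' unfolding eigentriple_def by blast
  have "T0 (y' + (- g) *\<^sub>C y) = z *\<^sub>C (y' + (- g) *\<^sub>C y)"
  proof -
    have "T0 y' = z *\<^sub>C y' - g *\<^sub>C S x1" "T0 y = z *\<^sub>C y - S x1"
      using t t' by (simp_all add: eigentriple_def g algebra_simps)
    then have "T0 (y' + (- g) *\<^sub>C y) = (z *\<^sub>C y' - g *\<^sub>C S x1) + (- g) *\<^sub>C (z *\<^sub>C y - S x1)"
      by (simp only: op_simps)
    then show ?thesis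
      by (simp add: cvec.scale_right_diff_distrib cscale_add_right cscale_cscale mult.commute)
  qed
  then obtain h where h: "y' + (- g) *\<^sub>C y = h *\<^sub>C x0"
    using cowen_douglas_eigenline(2)[OF T0 z, of x0 "y' + (- g) *\<^sub>C y"] t unfolding eigentriple_def by blast
  have "y' = g *\<^sub>C y + h *\<^sub>C x0"
    unfolding h[symmetric] by simp
  moreover have "f \<noteq> 0" "g \<noteq> 0" using t' f g unfolding eigentriple_def by auto
  ultimately show ?thesis using f g by blast
qed

definition triple_frame where
  "triple_frame U x0 x0' x1 x1' y y' \<longleftrightarrow> open U \<and> U \<subseteq> \<Omega> \<and> twice_cdiff_on x0 x0' U \<and>
     twice_cdiff_on x1 x1' U \<and> twice_cdiff_on y y' U \<and> (\<forall>z\<in>U. eigentriple z (x0 z) (x1 z) (y z))"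

text \<open>A holomorphic eigenvector of the block operator through \<open>(c, b)\<close> has the
  components \<open>y\<close> and \<open>x1\<close>, so the inhomogeneous equation for
  \<open>y\<close> is solved holomorphically along with the eigenvector equation for
  \<open>x1\<close>. The ball is then shrunk until \<open>x0\<close> and \<open>x1\<close> do not
  vanish.\<close>

lemma triple_frame_exists:
  assumes p: "p \<in> \<Omega>"
  shows "\<exists>r>0. \<exists>x0 x0' x1 x1' y y'. triple_frame (ball p r) x0 x0' x1 x1' y y'"
proof -
  obtain b where b: "b \<noteq> 0" "T1 b = p *\<^sub>C b" using cowen_douglas_eigenline(1)[OF T1 p] by blast
  then obtain a c where abc: "eigentriple p a b c" using eigentriple_exists[OF p] by blast
  obtain r x0 x0' where x0: "r > 0" "x0 p = a" "twice_cdiff_on x0 x0' (ball p r)"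
      "\<And>z. z \<in> ball p r \<Longrightarrow> x0 z \<in> kernel (shift_op T0 z)"
    using holomorphic_eigenvector[OF clinear(1), of p a] T0 p abc
    by (auto simp: cowen_douglas_def eigentriple_def kernel_shift_op_iff)
  obtain s \<tau> \<tau>' where \<tau>: "s > 0" "\<tau> p = (c, b)" "twice_cdiff_on \<tau> \<tau>' (ball p s)"
      "\<And>z. z \<in> ball p s \<Longrightarrow> \<tau> z \<in> kernel (shift_op (block_op T0 S T1) z)"
    using holomorphic_eigenvector[OF block_clinear block_surj[OF p], of "(c, b)"] abc
    by (auto simp: eigentriple_def block_kernel_iff)
  define x1 where "x1 z = snd (\<tau> z)" for z
  define y where "y z = fst (\<tau> z)" for z
  have d: "twice_cdiff_on x1 (\<lambda>z. snd (\<tau>' z)) (ball p s)" "twice_cdiff_on y (\<lambda>z. fst (\<tau>' z)) (ball p s)"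
    unfolding x1_def y_def
    by (rule twice_cdiff_on_bounded_clinear[OF bounded_clinear_snd \<tau>(3)],
        rule twice_cdiff_on_bounded_clinear[OF bounded_clinear_fst \<tau>(3)])
  have "\<exists>e>0. \<forall>u\<in>ball p r. dist p u < e \<longrightarrow> x0 u \<noteq> 0"
    using twice_cdiff_on_continuous[OF x0(3)] x0 abc
    by (intro continuous_on_avoid) (auto simp: eigentriple_def)
  then obtain e where e: "e > 0" "\<And>u. u \<in> ball p r \<Longrightarrow> dist p u < e \<Longrightarrow> x0 u \<noteq> 0" by blast
  have "\<exists>e>0. \<forall>u\<in>ball p s. dist p u < e \<longrightarrow> x1 u \<noteq> 0"
    using twice_cdiff_on_continuous[OF d(1)] \<tau> b
    by (intro continuous_on_avoid) (auto simp: x1_def)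
  then obtain e' where e': "e' > 0" "\<And>u. u \<in> ball p s \<Longrightarrow> dist p u < e' \<Longrightarrow> x1 u \<noteq> 0" by blast
  obtain t where t: "t > 0" "ball p t \<subseteq> \<Omega>" using open_\<Omega> p by (meson open_contains_ball)
  define R where "R = Min {r, s, e, e', t}"
  have R: "R > 0" "R \<le> r" "R \<le> s" "R \<le> e" "R \<le> e'" "R \<le> t"
    using x0(1) \<tau>(1) e(1) e'(1) t(1) by (auto simp: R_def)
  have "eigentriple z (x0 z) (x1 z) (y z)" if z: "z \<in> ball p R" for z
  proof -
    have "z \<in> ball p r" "z \<in> ball p s" "dist p z < e" "dist p z < e'"
      using z R by auto
    moreover from this have "T0 (x0 z) = z *\<^sub>C x0 z" using x0(4) by (simp add: kernel_shift_op_iff)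
    moreover have "(y z, x1 z) \<in> kernel (shift_op (block_op T0 S T1) z)"
      using \<tau>(4)[OF \<open>z \<in> ball p s\<close>] by (simp add: y_def x1_def)
    ultimately show ?thesis using e(2) e'(2) unfolding eigentriple_def block_kernel_iff by blast
  qed
  moreover have "ball p R \<subseteq> ball p r" "ball p R \<subseteq> ball p s" "ball p R \<subseteq> ball p t"
    using R by (auto intro: subset_ball)
  ultimately have "triple_frame (ball p R) x0 x0' x1 (\<lambda>z. snd (\<tau>' z)) y (\<lambda>z. fst (\<tau>' z))"
    unfolding triple_frame_def
    using twice_cdiff_on_subset[OF x0(3)] twice_cdiff_on_subset[OF d(1)] twice_cdiff_on_subset[OF d(2)] t(2)
    by (meson open_ball subset_trans)
  then show ?thesis using R(1) by blast
qed

lemma triple_frameD: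
  assumes "triple_frame U x0 x0' x1 x1' y y'"
  shows "open U" "U \<subseteq> \<Omega>" "twice_cdiff_on x0 x0' U" "twice_cdiff_on x1 x1' U" "twice_cdiff_on y y' U"
    "\<And>z. z \<in> U \<Longrightarrow> eigentriple z (x0 z) (x1 z) (y z)"
  using assms by (auto simp: triple_frame_def)

section \<open>Curvatures in a frame of eigentriples\<close>

lemma
  assumes F: "triple_frame U x0 x0' x1 x1' y y'" and w: "w \<in> U"
  shows line_curvature_T0: "line_curvature \<Omega> T0 w = - log_laplacian (\<lambda>z. cinner (x0 z) (x0 z)) w"
    and line_curvature_T1: "line_curvature \<Omega> T1 w = - log_laplacian (\<lambda>z. cinner (x1 z) (x1 z)) w"
    and local_section_T1: "T1 (local_section \<Omega> T1 w w) = w *\<^sub>C local_section \<Omega> T1 w w"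
      "local_section \<Omega> T1 w w \<noteq> 0"
proof -
  note F = triple_frameD[OF F]
  have k0: "x0 z \<in> kernel (shift_op T0 z) \<and> x0 z \<noteq> 0" and k1: "x1 z \<in> kernel (shift_op T1 z) \<and> x1 z \<noteq> 0"
    if "z \<in> U" for z
    using F(6)[OF that] by (auto simp: eigentriple_def kernel_shift_op_iff)
  have l0: "\<exists>c. u = c *\<^sub>C x0 z" if "z \<in> U" "u \<in> kernel (shift_op T0 z)" for z u
    using cowen_douglas_eigenline(2)[OF T0, of z "x0 z" u] k0[OF that(1)] that F(2)
    by (auto simp: kernel_shift_op_iff)
  have l1: "\<exists>c. u = c *\<^sub>C x1 z" if "z \<in> U" "u \<in> kernel (shift_op T1 z)" for z u
    using cowen_douglas_eigenline(2)[OF T1, of z "x1 z" u] k1[OF that(1)] that F(2)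
    by (auto simp: kernel_shift_op_iff)
  show "line_curvature \<Omega> T0 w = - log_laplacian (\<lambda>z. cinner (x0 z) (x0 z)) w"
    by (rule line_curvature_log_laplacian(1)[OF F(3) k0 F(1,2) w l0])
  show "line_curvature \<Omega> T1 w = - log_laplacian (\<lambda>z. cinner (x1 z) (x1 z)) w"
    by (rule line_curvature_log_laplacian(1)[OF F(4) k1 F(1,2) w l1])
  have "local_section \<Omega> T1 w w \<in> kernel (shift_op T1 w) \<and> local_section \<Omega> T1 w w \<noteq> 0"
    by (rule line_curvature_log_laplacian(2)[OF F(4) k1 F(1,2) w l1])
  then show "T1 (local_section \<Omega> T1 w w) = w *\<^sub>C local_section \<Omega> T1 w w"
      "local_section \<Omega> T1 w w \<noteq> 0"
    by (simp_all add: kernel_shift_op_iff)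
qed

text \<open>Modulo a multiple of \<open>(y, x1)\<close> a kernel vector has second component zero,
  and its first component then lies in the eigenspace of \<open>T0\<close>.\<close>

lemma eigentriple_basis:
  assumes z: "z \<in> \<Omega>" and t: "eigentriple z x0 x1 y"
  shows "kernel (shift_op (block_op T0 S T1) z) = cvec.span {(x0, 0), (y, x1)}"
    and "cvec.independent {(x0, 0), (y, x1)}" and "(x0, 0) \<noteq> (y, x1)"
proof -
  have pair: "s *\<^sub>C (x0, 0) + t *\<^sub>C (y, x1) = (s *\<^sub>C x0 + t *\<^sub>C y, t *\<^sub>C x1)" for s t
    by (simp add: cscale_prod_def)
  have t0: "x0 \<noteq> 0" "x1 \<noteq> 0" "T0 x0 = z *\<^sub>C x0" "T1 x1 = z *\<^sub>C x1" "T0 y + S x1 = z *\<^sub>C y"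
    using t by (auto simp: eigentriple_def)
  show ne: "(x0, 0) \<noteq> (y, x1)" using t0 by auto
  have "\<forall>s t. s *\<^sub>C (x0, 0) + t *\<^sub>C (y, x1) = 0 \<longrightarrow> s = 0 \<and> t = 0"
    unfolding pair using t0 by (auto simp: zero_prod_def)
  then show "cvec.independent {(x0, 0), (y, x1)}" unfolding cvec_independent_pair[OF ne] .
  have "p \<in> kernel (shift_op (block_op T0 S T1) z) \<longleftrightarrow> p \<in> cvec.span {(x0, 0), (y, x1)}" for p
  proof
    obtain u v where p: "p = (u, v)" by (cases p)
    assume "p \<in> kernel (shift_op (block_op T0 S T1) z)"
    then have uv: "T1 v = z *\<^sub>C v" "T0 u + S v = z *\<^sub>C u" unfolding p block_kernel_iff by auto
    then obtain c where c: "v = c *\<^sub>C x1" using cowen_douglas_eigenline(2)[OF T1 z t0(4,2)] by blast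
    have "T0 u = z *\<^sub>C u - c *\<^sub>C S x1" "T0 y = z *\<^sub>C y - S x1"
      using uv(2) t0(5) by (simp_all add: c algebra_simps)
    then have "T0 (u + (- c) *\<^sub>C y) = (z *\<^sub>C u - c *\<^sub>C S x1) + (- c) *\<^sub>C (z *\<^sub>C y - S x1)"
      by (simp only: op_simps)
    also have "\<dots> = z *\<^sub>C (u + (- c) *\<^sub>C y)"
      by (simp add: cvec.scale_right_diff_distrib cscale_add_right cscale_cscale mult.commute)
    finally obtain d where d: "u + (- c) *\<^sub>C y = d *\<^sub>C x0"
      using cowen_douglas_eigenline(2)[OF T0 z t0(3,1)] by blast
    have "u = d *\<^sub>C x0 + c *\<^sub>C y" unfolding d[symmetric] by simp
    then have "p = d *\<^sub>C (x0, 0) + c *\<^sub>C (y, x1)" by (simp add: p c pair)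
    then show "p \<in> cvec.span {(x0, 0), (y, x1)}" unfolding cvec_span_pair by blast
  next
    assume "p \<in> cvec.span {(x0, 0), (y, x1)}"
    then obtain s t where p: "p = (s *\<^sub>C x0 + t *\<^sub>C y, t *\<^sub>C x1)"
      unfolding cvec_span_pair pair by blast
    have "t *\<^sub>C (T0 y + S x1) = t *\<^sub>C z *\<^sub>C y" unfolding t0(5) ..
    then show "p \<in> kernel (shift_op (block_op T0 S T1) z)"
      unfolding p block_kernel_iff using t0(3,4)
      by (simp add: cscale_add_right cscale_cscale mult.commute add.assoc)
  qed
  then show "kernel (shift_op (block_op T0 S T1) z) = cvec.span {(x0, 0), (y, x1)}" by blast
qed

lemma pairing_det_pos:
  assumes t: "eigentriple z x0 x1 y"
  shows "(cmod (cinner x0 y))\<^sup>2 \<le> (norm x0)\<^sup>2 * (norm y)\<^sup>2"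
    and "pairing_det x0 x1 y x0 x1 y \<noteq> 0"
proof -
  show le: "(cmod (cinner x0 y))\<^sup>2 \<le> (norm x0)\<^sup>2 * (norm y)\<^sup>2"
    using power_mono[OF cinner_cauchy_schwarz[of x0 y], of 2] by (simp add: power_mult_distrib)
  have "(norm x0)\<^sup>2 * (norm x1)\<^sup>2 > 0" using t by (simp add: eigentriple_def)
  with le have "(norm x0)\<^sup>2 * (norm x1)\<^sup>2 + ((norm x0)\<^sup>2 * (norm y)\<^sup>2 - (cmod (cinner x0 y))\<^sup>2) > 0"
    by linarith
  then show "pairing_det x0 x1 y x0 x1 y \<noteq> 0"
    unfolding pairing_det_same of_real_eq_0_iff by linarith
qed

lemma wirtinger_C2_pairing_det:
  assumes F: "triple_frame U x0 x0' x1 x1' y y'" and w: "w \<in> U"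
  shows "wirtinger_C2 (\<lambda>z. pairing_det (x0 z) (x1 z) (y z) (x0 z) (x1 z) (y z)) w"
  unfolding pairing_det_def
  by (intro wirtinger_C2_diff wirtinger_C2_mult wirtinger_C2_add
      wirtinger_C2_cinner[OF triple_frameD(3)[OF F] triple_frameD(3)[OF F] triple_frameD(1)[OF F] w]
      wirtinger_C2_cinner[OF triple_frameD(4)[OF F] triple_frameD(4)[OF F] triple_frameD(1)[OF F] w]
      wirtinger_C2_cinner[OF triple_frameD(5)[OF F] triple_frameD(5)[OF F] triple_frameD(1)[OF F] w]
      wirtinger_C2_cinner[OF triple_frameD(3)[OF F] triple_frameD(5)[OF F] triple_frameD(1)[OF F] w]
      wirtinger_C2_cinner[OF triple_frameD(5)[OF F] triple_frameD(3)[OF F] triple_frameD(1)[OF F] w])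

text \<open>The frame behind \<open>curvature\<close> is an unspecified choice
  \<open>\<gamma>\<close>. Its coefficients \<open>a\<close> and \<open>c\<close> in the reference
  frame \<open>X\<close>, \<open>Y\<close> are holomorphic near \<open>w\<close>. This supplies
  second derivatives for \<open>\<gamma>\<close> and gives its Gram determinant as that of the
  reference frame times \<open>\<Delta> * cnj \<Delta>\<close>.\<close>

lemma trace_curvature_block:
  assumes F: "triple_frame U x0 x0' x1 x1' y y'" and w: "w \<in> U"
  shows "trace (curvature \<Omega> (block_op T0 S T1) w :: complex^2^2) =
    - log_laplacian (\<lambda>z. pairing_det (x0 z) (x1 z) (y z) (x0 z) (x1 z) (y z)) w"
proof -
  let ?T = "block_op T0 S T1"
  note FD = triple_frameD[OF F]
  define X where "X z = (x0 z, 0 :: 'b)" for z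
  define X' where "X' z = (x0' z, 0 :: 'b)" for z
  define Y where "Y z = (y z, x1 z)" for z
  define Y' where "Y' z = (y' z, x1' z)" for z
  have XY: "twice_cdiff_on X X' U" "twice_cdiff_on Y Y' U"
    using FD(3,4,5) has_cderiv_Pair[OF _ has_cderiv_const[of "0 :: 'b"]] has_cderiv_Pair
    unfolding twice_cdiff_on_def X_def X'_def Y_def Y'_def by blast+
  have basis: "kernel (shift_op ?T z) = cvec.span {X z, Y z}" "cvec.independent {X z, Y z}" "X z \<noteq> Y z"
    if "z \<in> U" for z
    using eigentriple_basis[OF _ FD(6)[OF that]] FD(2) that by (auto simp: X_def Y_def)
  define \<gamma> where "\<gamma> = (local_frame \<Omega> ?T w :: 2 \<Rightarrow> complex \<Rightarrow> 'a \<times> 'b)"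
  define \<delta> where "\<delta> = (\<lambda>i::2. if i = 1 then X else Y)"
  have range2: "range (\<lambda>i::2. f i z) = {f 1 z, f 2 z}" for f :: "2 \<Rightarrow> complex \<Rightarrow> 'a \<times> 'b" and z
    by (simp add: UNIV_2)
  have inj2: "inj (\<lambda>i::2. f i z) \<longleftrightarrow> f 1 z \<noteq> f 2 z" for f :: "2 \<Rightarrow> complex \<Rightarrow> 'a \<times> 'b" and z
    unfolding inj_def by (auto simp: forall_2)
  have "hol_frame \<Omega> ?T U \<delta>"
    unfolding hol_frame_def range2 inj2
    using basis FD(1,2) XY[THEN twice_cdiff_on_vholomorphic] by (simp add: \<delta>_def)
  then have "\<exists>\<gamma>::2 \<Rightarrow> complex \<Rightarrow> 'a \<times> 'b. \<exists>U. w \<in> U \<and> hol_frame \<Omega> ?T U \<gamma>" using w by blast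
  from someI_ex[OF this] have "\<exists>V. w \<in> V \<and> hol_frame \<Omega> ?T V \<gamma>"
    unfolding \<gamma>_def local_frame_def .
  then obtain V where V: "w \<in> V" "open V" "V \<subseteq> \<Omega>" "\<And>i. \<gamma> i vholomorphic_on V"
      and ker: "\<And>z. z \<in> V \<Longrightarrow> cvec.span {\<gamma> 1 z, \<gamma> 2 z} = kernel (shift_op ?T z)"
      and ind: "\<And>z. z \<in> V \<Longrightarrow> cvec.independent {\<gamma> 1 z, \<gamma> 2 z} \<and> \<gamma> 1 z \<noteq> \<gamma> 2 z"
    unfolding hol_frame_def range2 inj2 by blast
  define W where "W = ((U \<inter> (\<lambda>z. cinner (x0 z) (x0 w)) -` (- {0})) \<inter> (U \<inter> (\<lambda>z. cinner (x1 z) (x1 w)) -` (- {0}))) \<inter> V"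
  have "continuous_on U (\<lambda>z. cinner (x0 z) (x0 w))" "continuous_on U (\<lambda>z. cinner (x1 z) (x1 w))"
    using bounded_linear.continuous_on[OF bounded_bilinear.bounded_linear_left[OF bounded_bilinear_cinner]]
      twice_cdiff_on_continuous[OF FD(3)] twice_cdiff_on_continuous[OF FD(4)] by blast+
  then have oW: "open W" unfolding W_def
    by (intro open_Int continuous_open_preimage FD(1) V(2)) auto
  have wW: "w \<in> W" using w V(1) FD(6)[OF w] by (simp add: W_def eigentriple_def)
  have nz: "cinner (x0 z) (x0 w) \<noteq> 0" "cinner (x1 z) (x1 w) \<noteq> 0" if "z \<in> W" for z
    using that by (auto simp: W_def)
  have WU: "W \<subseteq> U" "W \<subseteq> V" by (auto simp: W_def)
  have vh: "f vholomorphic_on W" if "f vholomorphic_on A" "open A" "W \<subseteq> A"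
    for f :: "complex \<Rightarrow> 'c::complex_hilbert_space" and A
    using that vholomorphic_on_has_cderiv oW by blast
  \<comment> \<open>\<open>X\<close> has second component zero, so \<open>c\<close> is read off from
    second components, and \<open>a\<close> from first components after subtracting the
    \<open>Y\<close> part.\<close>
  define c where "c i z = cinner (snd (\<gamma> i z)) (x1 w) / cinner (x1 z) (x1 w)" for i z
  define a where "a i z = cinner (fst (\<gamma> i z) + (- c i z) *\<^sub>C y z) (x0 w) / cinner (x0 z) (x0 w)" for i z
  have d\<gamma>: "\<exists>D. has_cderiv (\<gamma> i) D z" if "z \<in> W" for i z
    using V(4)[of i] WU that unfolding vholomorphic_on_has_cderiv[OF V(2)] by blast
  have vfst: "(\<lambda>z. fst (\<gamma> i z)) vholomorphic_on W" and vsnd: "(\<lambda>z. snd (\<gamma> i z)) vholomorphic_on W" for i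
    unfolding vholomorphic_on_has_cderiv[OF oW]
    using d\<gamma> has_cderiv_bounded_clinear[OF bounded_clinear_fst] has_cderiv_bounded_clinear[OF bounded_clinear_snd]
    by blast+
  have vx: "x0 vholomorphic_on W" "x1 vholomorphic_on W" "y vholomorphic_on W"
    using FD(3,4,5)[THEN twice_cdiff_on_vholomorphic, OF FD(1)] vh[OF _ FD(1) WU(1)] by blast+
  have c: "c i holomorphic_on W" for i
    unfolding c_def by (rule holomorphic_cinner_ratio[OF oW vsnd vx(2) nz(2)])
  have vy: "(\<lambda>z. fst (\<gamma> i z) + (- c i z) *\<^sub>C y z) vholomorphic_on W" for i
    unfolding vholomorphic_on_has_cderiv[OF oW]
  proof
    fix z assume z: "z \<in> W"
    have "((\<lambda>z. - c i z) has_field_derivative - deriv (c i) z) (at z)"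
      using holomorphic_derivI[OF c oW z] by (auto intro!: derivative_intros)
    moreover obtain D E where "has_cderiv (\<lambda>z. fst (\<gamma> i z)) D z" "has_cderiv y E z"
      using vfst[of i] vx(3) z unfolding vholomorphic_on_has_cderiv[OF oW] by blast
    ultimately show "\<exists>D. has_cderiv (\<lambda>z. fst (\<gamma> i z) + (- c i z) *\<^sub>C y z) D z"
      using has_cderiv_add has_cderiv_cscale by blast
  qed
  have a: "a i holomorphic_on W" for i
    unfolding a_def by (rule holomorphic_cinner_ratio[OF oW vy vx(1) nz(1)])
  have \<gamma>: "\<gamma> i z = a i z *\<^sub>C X z + c i z *\<^sub>C Y z" if z: "z \<in> W" for i z
  proof -
    have "i = 1 \<or> i = 2" by (rule exhaust_2)
    then have "\<gamma> i z \<in> cvec.span {\<gamma> 1 z, \<gamma> 2 z}" by (auto intro: cvec.span_base)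
    then have "\<gamma> i z \<in> cvec.span {X z, Y z}" using ker basis(1) z WU by blast
    then obtain s t where st: "\<gamma> i z = s *\<^sub>C X z + t *\<^sub>C Y z" unfolding cvec_span_pair by blast
    then have "snd (\<gamma> i z) = t *\<^sub>C x1 z" "fst (\<gamma> i z) = s *\<^sub>C x0 z + t *\<^sub>C y z"
      by (simp_all add: X_def Y_def cscale_prod_def)
    then have "c i z = t" "a i z = s"
      using nz[OF z] by (simp_all add: c_def a_def cinner_cscale_left)
    then show ?thesis using st by simp
  qed
  have tw: "\<exists>\<gamma>'. twice_cdiff_on (\<gamma> i) \<gamma>' W" for i
  proof -
    note L = twice_cdiff_on_lincomb[OF a c oW twice_cdiff_on_subset[OF XY(1) WU(1)] twice_cdiff_on_subset[OF XY(2) WU(1)], of i i]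
    show ?thesis
      by (rule exI, rule twice_cdiff_on_transform[OF L oW]) (simp add: \<gamma>)
  qed
  then obtain \<gamma>' where \<gamma>': "\<And>i. twice_cdiff_on (\<gamma> i) (\<gamma>' i) W" by metis
  define \<Delta> where "\<Delta> z = a 1 z * c 2 z - a 2 z * c 1 z" for z
  have \<Delta>: "\<Delta> holomorphic_on W" unfolding \<Delta>_def by (intro holomorphic_intros a c)
  have \<Delta>0: "\<Delta> z \<noteq> 0" if z: "z \<in> W" for z
  proof
    assume 0: "\<Delta> z = 0"
    have comb: "s *\<^sub>C \<gamma> 1 z + t *\<^sub>C \<gamma> 2 z = (s * a 1 z + t * a 2 z) *\<^sub>C X z + (s * c 1 z + t * c 2 z) *\<^sub>C Y z" for s t
      unfolding \<gamma>[OF z] by (simp add: cscale_add_right cscale_add_left cscale_cscale algebra_simps)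
    have indz: "\<forall>s t. s *\<^sub>C \<gamma> 1 z + t *\<^sub>C \<gamma> 2 z = 0 \<longrightarrow> s = 0 \<and> t = 0"
      using ind[of z] cvec_independent_pair[of "\<gamma> 1 z" "\<gamma> 2 z"] z WU by blast
    \<comment> \<open>These coefficients cancel \<open>Y z\<close>, and the coefficient left at
      \<open>X z\<close> is \<open>\<Delta> z\<close>.\<close>
    have "(c 2 z) *\<^sub>C \<gamma> 1 z + (- c 1 z) *\<^sub>C \<gamma> 2 z = 0"
      unfolding comb using 0 by (simp add: \<Delta>_def algebra_simps)
    then have c0: "c 2 z = 0" "c 1 z = 0" using indz by fastforce+
    have "(a 2 z) *\<^sub>C \<gamma> 1 z + (- a 1 z) *\<^sub>C \<gamma> 2 z = 0"
      unfolding comb by (simp add: c0)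
    then have "a 2 z = 0" using indz by blast
    then have "\<gamma> 2 z = 0" unfolding \<gamma>[OF z] by (simp add: c0)
    then have "0 *\<^sub>C \<gamma> 1 z + 1 *\<^sub>C \<gamma> 2 z = 0" by simp
    then show False using indz by (metis one_neq_zero)
  qed
  define N where "N z = pairing_det (x0 z) (x1 z) (y z) (x0 z) (x1 z) (y z)" for z
  have det: "det (gram \<gamma> z) = \<Delta> z * cnj (\<Delta> z) * N z" if z: "z \<in> W" for z
  proof -
    have g: "gram \<gamma> z $ i $ j = cinner (a j z *\<^sub>C X z + c j z *\<^sub>C Y z) (a i z *\<^sub>C X z + c i z *\<^sub>C Y z)" for i j
      by (simp add: gram_def \<gamma>[OF z])
    have e: "cinner (X z) (X z) = cinner (x0 z) (x0 z)" "cinner (Y z) (Y z) = cinner (y z) (y z) + cinner (x1 z) (x1 z)"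
      "cinner (X z) (Y z) = cinner (x0 z) (y z)" "cinner (Y z) (X z) = cinner (y z) (x0 z)"
      by (simp_all add: X_def Y_def cinner_prod_def)
    show ?thesis
      unfolding det_2 g N_def pairing_det_def \<Delta>_def cinner_add_left cinner_add_right
        cinner_cscale_left cinner_cscale_right e
      by (simp add: algebra_simps)
  qed
  have N: "N z \<noteq> 0" if "z \<in> U" for z
    unfolding N_def using pairing_det_pos(2)[OF FD(6)[OF that]] .
  have "trace (frame_curvature \<gamma> w) = - log_laplacian (\<lambda>z. det (gram \<gamma> z)) w"
    by (rule trace_frame_curvature[OF \<gamma>' oW wW]) (use det \<Delta>0 N WU in auto)
  also have "log_laplacian (\<lambda>z. det (gram \<gamma> z)) w = log_laplacian (\<lambda>z. \<Delta> z * cnj (\<Delta> z) * N z) w"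
    by (rule log_laplacian_cong[OF oW wW det])
  also have "\<dots> = log_laplacian N w"
  proof (rule log_laplacian_norm_square_mult[of \<Delta> W w N, OF \<Delta> oW wW \<Delta>0[OF wW] _ N[OF w]])
    show "wirtinger_C2 N w" unfolding N_def by (rule wirtinger_C2_pairing_det[OF F w])
  qed
  finally show ?thesis unfolding curvature_def \<gamma>_def[symmetric] N_def .
qed

section \<open>The trace formula\<close>

text \<open>
  This is the function \<open>v\<close> of the introduction. The description is meaningful only at points of
  \<open>\<Omega>\<close>, where eigentriples exist.
\<close>

definition gram_ratio :: "complex \<Rightarrow> real" where
  "gram_ratio z = (THE v. \<forall>x0 x1 y. eigentriple z x0 x1 y \<longrightarrow>
     pairing_det x0 x1 y x0 x1 y = complex_of_real v * (cinner x0 x0 * cinner x1 x1))"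

text \<open>A change of eigentriple multiplies both sides by the squared modulus of
  \<open>f * g\<close>, so the value computed from one triple serves for all and the description is
  well defined.\<close>

lemma gram_ratio:
  assumes z: "z \<in> \<Omega>" and t: "eigentriple z x0 x1 y"
  shows "pairing_det x0 x1 y x0 x1 y = complex_of_real (gram_ratio z) * (cinner x0 x0 * cinner x1 x1)"
proof -
  let ?P = "\<lambda>v. \<forall>x0 x1 y. eigentriple z x0 x1 y \<longrightarrow>
     pairing_det x0 x1 y x0 x1 y = complex_of_real v * (cinner x0 x0 * cinner x1 x1)"
  define v where "v = ((norm x0)\<^sup>2 * (norm x1)\<^sup>2 + ((norm x0)\<^sup>2 * (norm y)\<^sup>2 - (cmod (cinner x0 y))\<^sup>2)) /
    ((norm x0)\<^sup>2 * (norm x1)\<^sup>2)"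
  have nz: "(norm x0)\<^sup>2 * (norm x1)\<^sup>2 \<noteq> 0" using t by (simp add: eigentriple_def)
  have eq: "pairing_det x0 x1 y x0 x1 y = complex_of_real v * (cinner x0 x0 * cinner x1 x1)"
    unfolding pairing_det_same cinner_same of_real_mult[symmetric] of_real_eq_iff v_def
    using nz by simp
  have "?P v"
  proof (intro allI impI)
    fix x0' x1' y' assume "eigentriple z x0' x1' y'"
    then obtain f g h where fgh: "x0' = f *\<^sub>C x0" "x1' = g *\<^sub>C x1" "y' = g *\<^sub>C y + h *\<^sub>C x0"
      using eigentriple_gauge[OF z t] by blast
    show "pairing_det x0' x1' y' x0' x1' y' = complex_of_real v * (cinner x0' x0' * cinner x1' x1')"
      unfolding fgh pairing_det_gauge_left pairing_det_gauge_right eq cinner_cscale_left cinner_cscale_right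
      by simp
  qed
  moreover have "u = v" if "?P u" for u
  proof -
    have "complex_of_real u * (cinner x0 x0 * cinner x1 x1) = complex_of_real v * (cinner x0 x0 * cinner x1 x1)"
      using that t eq by metis
    moreover have "cinner x0 x0 * cinner x1 x1 \<noteq> 0" using t by (simp add: eigentriple_def)
    ultimately show ?thesis by simp
  qed
  ultimately have "?P (gram_ratio z)" unfolding gram_ratio_def by (rule theI)
  then show ?thesis using t by blast
qed

lemma gram_ratio_eq:
  assumes z: "z \<in> \<Omega>" and t: "eigentriple z x0 x1 y"
  shows "gram_ratio z = 1 + ((norm x0)\<^sup>2 * (norm y)\<^sup>2 - (cmod (cinner x0 y))\<^sup>2) / ((norm x0)\<^sup>2 * (norm x1)\<^sup>2)"
proof -
  have nz: "(norm x0)\<^sup>2 * (norm x1)\<^sup>2 \<noteq> 0" using t by (simp add: eigentriple_def)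
  have "(norm x0)\<^sup>2 * (norm x1)\<^sup>2 + ((norm x0)\<^sup>2 * (norm y)\<^sup>2 - (cmod (cinner x0 y))\<^sup>2) =
      gram_ratio z * ((norm x0)\<^sup>2 * (norm x1)\<^sup>2)"
    using gram_ratio[OF z t]
    unfolding pairing_det_same cinner_same of_real_mult[symmetric] of_real_eq_iff .
  then show ?thesis using nz by (simp add: field_simps)
qed

lemma gram_ratio_ge_1: "z \<in> \<Omega> \<Longrightarrow> gram_ratio z \<ge> 1"
proof -
  assume z: "z \<in> \<Omega>"
  obtain x1 where "x1 \<noteq> 0" "T1 x1 = z *\<^sub>C x1" using cowen_douglas_eigenline(1)[OF T1 z] by blast
  then obtain x0 y where t: "eigentriple z x0 x1 y" using eigentriple_exists[OF z] by blast
  show ?thesis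
    unfolding gram_ratio_eq[OF z t] using pairing_det_pos(1)[OF t] by simp
qed

text \<open>
  Differentiating \<open>T\<^sub>0 x\<^sub>0(z) = z x\<^sub>0(z)\<close> gives \<open>(T\<^sub>0 - z) x\<^sub>0' = x\<^sub>0\<close>. Hence \<open>x\<^sub>0'\<close> is not an
  eigenvector, and \<open>y = - \<psi> x\<^sub>0' + c x\<^sub>0\<close> if \<open>S x\<^sub>1 = \<psi> x\<^sub>0\<close>.
\<close>

lemma curvature_gram_ratio:
  assumes z: "z \<in> \<Omega>"
  shows "\<exists>k>0. line_curvature \<Omega> T0 z = - complex_of_real k \<and>
    (\<forall>x1. x1 \<noteq> 0 \<longrightarrow> T1 x1 = z *\<^sub>C x1 \<longrightarrow> gram_ratio z = 1 + (norm (S x1))\<^sup>2 / (norm x1)\<^sup>2 * k)"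
proof -
  obtain r X0 X0' X1 X1' Y Y' where r: "r > 0" and F: "triple_frame (ball z r) X0 X0' X1 X1' Y Y'"
    using triple_frame_exists[OF z] by blast
  note FD = triple_frameD[OF F]
  have zr: "z \<in> ball z r" using r by simp
  define x where "x = X0 z"
  define x' where "x' = X0' z"
  have x: "x \<noteq> 0" "T0 x = z *\<^sub>C x" using FD(6)[OF zr] by (auto simp: eigentriple_def x_def)
  have d: "has_cderiv X0 x' z" using FD(3) zr by (auto simp: twice_cdiff_on_def x'_def)
  have "has_cderiv (\<lambda>u. u *\<^sub>C X0 u) (z *\<^sub>C x' + x) z"
    using has_cderiv_cscale[OF DERIV_ident d] by (simp add: x_def)
  then have "has_cderiv (\<lambda>u. T0 (X0 u)) (z *\<^sub>C x' + x) z"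
    by (rule has_cderiv_transform[OF _ open_ball zr]) (use FD(6) in \<open>simp add: eigentriple_def\<close>)
  moreover have "has_cderiv (\<lambda>u. T0 (X0 u)) (T0 x') z"
    by (rule has_cderiv_bounded_clinear[OF clinear(1) d])
  ultimately have "(\<lambda>h. h *\<^sub>C (z *\<^sub>C x' + x)) = (\<lambda>h. h *\<^sub>C T0 x')"
    unfolding has_cderiv_def by (rule has_derivative_unique)
  then have Tx': "T0 x' = z *\<^sub>C x' + x"
    using fun_cong[of _ _ 1] by fastforce
  have "x' \<noteq> c *\<^sub>C x" for c
  proof
    assume "x' = c *\<^sub>C x"
    then have "T0 x' = z *\<^sub>C x'" using x(2) by (simp add: cscale_cscale mult.commute)
    then show False using Tx' x(1) by simp
  qed
  then have strict: "(cmod (cinner x x'))\<^sup>2 < (norm x)\<^sup>2 * (norm x')\<^sup>2"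
    by (rule cinner_cauchy_schwarz_strict[OF x(1)])
  define \<delta> where "\<delta> = (norm x)\<^sup>2 * (norm x')\<^sup>2 - (cmod (cinner x x'))\<^sup>2"
  define k where "k = \<delta> / ((norm x)\<^sup>2)\<^sup>2"
  have k: "k > 0" using strict x(1) by (simp add: k_def \<delta>_def)
  have "cinner x x * cinner x' x' - cinner x' x * cinner x x' = complex_of_real \<delta>"
    using cinner_mult_commute[of x x'] by (simp add: \<delta>_def cinner_same mult.commute)
  then have "log_laplacian (\<lambda>u. cinner (X0 u) (X0 u)) z = complex_of_real k"
    using log_laplacian_cinner[OF FD(3) open_ball zr x(1)[unfolded x_def]]
    by (simp add: x_def[symmetric] x'_def[symmetric] k_def cinner_same)
  then have K: "line_curvature \<Omega> T0 z = - complex_of_real k"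
    using line_curvature_T0[OF F zr] by simp
  have "gram_ratio z = 1 + (norm (S x1))\<^sup>2 / (norm x1)\<^sup>2 * k" if x1: "x1 \<noteq> 0" "T1 x1 = z *\<^sub>C x1" for x1
  proof -
    obtain y where y: "T0 y = z *\<^sub>C y + (- S x1)" using surj_T0[OF z] by blast
    then have t: "eigentriple z x x1 y" using x x1 by (simp add: eigentriple_def)
    have "T0 (S x1) = z *\<^sub>C S x1" using x1(2) by (simp add: intertwine)
    then obtain \<psi> where \<psi>: "S x1 = \<psi> *\<^sub>C x" using cowen_douglas_eigenline(2)[OF T0 z x(2,1)] by blast
    have "T0 (y + \<psi> *\<^sub>C x') = z *\<^sub>C (y + \<psi> *\<^sub>C x')"
      by (simp add: y \<psi> Tx' cscale_add_right cscale_cscale mult.commute)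
    then obtain c where c: "y + \<psi> *\<^sub>C x' = c *\<^sub>C x" using cowen_douglas_eigenline(2)[OF T0 z x(2,1)] by blast
    then have y': "y = c *\<^sub>C x + (- \<psi>) *\<^sub>C x'" by (simp add: eq_diff_eq)
    \<comment> \<open>Adding a multiple of \<open>x\<close> to \<open>y\<close> does not change
      their Gram determinant, and the factor \<open>- \<psi>\<close> contributes its squared
      modulus.\<close>
    have "cinner x x * cinner y y - cinner x y * cinner y x =
        (\<psi> * cnj \<psi>) * (cinner x x * cinner x' x' - cinner x x' * cinner x' x)"
      unfolding y' cinner_add_left cinner_add_right cinner_cscale_left cinner_cscale_right
      by (simp add: algebra_simps)
    then have G: "(norm x)\<^sup>2 * (norm y)\<^sup>2 - (cmod (cinner x y))\<^sup>2 = (cmod \<psi>)\<^sup>2 * \<delta>"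
      unfolding cinner_mult_commute cinner_same \<delta>_def complex_norm_square[symmetric]
        of_real_mult[symmetric] of_real_diff[symmetric] of_real_eq_iff .
    have "gram_ratio z = 1 + (cmod \<psi>)\<^sup>2 * \<delta> / ((norm x)\<^sup>2 * (norm x1)\<^sup>2)"
      using gram_ratio_eq[OF z t] unfolding G .
    \<comment> \<open>\<open>\<psi>\<close> has modulus \<open>norm (S x1) / norm x\<close>, which
      supplies the second factor \<open>(norm x)\<^sup>2\<close> in the denominator of
      \<open>k\<close>.\<close>
    also have "(cmod \<psi>)\<^sup>2 * \<delta> / ((norm x)\<^sup>2 * (norm x1)\<^sup>2) = (norm (S x1))\<^sup>2 / (norm x1)\<^sup>2 * k"
      using x(1) x1(1) by (simp add: \<psi> norm_cscale power_mult_distrib k_def power2_eq_square mult_ac)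
    finally show ?thesis .
  qed
  then show ?thesis using k K by blast
qed

lemma gram_ratio_frame:
  assumes F: "triple_frame U x0 x0' x1 x1' y y'" and z: "z \<in> U"
  shows "pairing_det (x0 z) (x1 z) (y z) (x0 z) (x1 z) (y z) =
    complex_of_real (gram_ratio z) * (cinner (x0 z) (x0 z) * cinner (x1 z) (x1 z))"
  using gram_ratio[OF _ triple_frameD(6)[OF F z]] triple_frameD(2)[OF F] z by blast

lemma wirtinger_C2_gram_ratio:
  assumes w: "w \<in> \<Omega>"
  shows "wirtinger_C2 (\<lambda>z. complex_of_real (gram_ratio z)) w"
proof -
  obtain r x0 x0' x1 x1' y y' where r: "r > 0" and F: "triple_frame (ball w r) x0 x0' x1 x1' y y'"
    using triple_frame_exists[OF w] by blast
  note FD = triple_frameD[OF F]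
  have wr: "w \<in> ball w r" using r by simp
  have nz: "cinner (x0 z) (x0 z) * cinner (x1 z) (x1 z) \<noteq> 0" if "z \<in> ball w r" for z
    using FD(6)[OF that] by (simp add: eigentriple_def)
  have "wirtinger_C2 (\<lambda>z. cinner (x0 z) (x0 z) * cinner (x1 z) (x1 z)) w"
    by (intro wirtinger_C2_mult wirtinger_C2_cinner[OF FD(3,3) open_ball wr]
        wirtinger_C2_cinner[OF FD(4,4) open_ball wr])
  from wirtinger_C2_mult[OF wirtinger_C2_pairing_det[OF F wr] wirtinger_C2_inverse[OF this nz[OF wr]]]
  show ?thesis
    by (rule wirtinger_C2_transform[OF _ open_ball wr]) (use nz gram_ratio_frame[OF F] in simp)
qed

lemma trace_curvature_gram_ratio:
  assumes w: "w \<in> \<Omega>"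
  shows "trace (curvature \<Omega> (block_op T0 S T1) w :: complex^2^2) =
    line_curvature \<Omega> T0 w + line_curvature \<Omega> T1 w - log_laplacian (\<lambda>z. complex_of_real (gram_ratio z)) w"
proof -
  obtain r x0 x0' x1 x1' y y' where r: "r > 0" and F: "triple_frame (ball w r) x0 x0' x1 x1' y y'"
    using triple_frame_exists[OF w] by blast
  note FD = triple_frameD[OF F]
  have wr: "w \<in> ball w r" using r by simp
  have nz: "cinner (x0 w) (x0 w) \<noteq> 0" "cinner (x1 w) (x1 w) \<noteq> 0"
    using FD(6)[OF wr] by (auto simp: eigentriple_def)
  have v: "complex_of_real (gram_ratio w) \<noteq> 0" using gram_ratio_ge_1[OF w] by auto
  note C0 = wirtinger_C2_cinner[OF FD(3,3) open_ball wr]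
  note C1 = wirtinger_C2_cinner[OF FD(4,4) open_ball wr]
  have "log_laplacian (\<lambda>z. pairing_det (x0 z) (x1 z) (y z) (x0 z) (x1 z) (y z)) w =
     log_laplacian (\<lambda>z. complex_of_real (gram_ratio z) * (cinner (x0 z) (x0 z) * cinner (x1 z) (x1 z))) w"
    by (rule log_laplacian_cong[OF open_ball wr gram_ratio_frame[OF F]])
  also have "\<dots> = log_laplacian (\<lambda>z. complex_of_real (gram_ratio z)) w +
      log_laplacian (\<lambda>z. cinner (x0 z) (x0 z) * cinner (x1 z) (x1 z)) w"
    by (rule log_laplacian_mult[OF wirtinger_C2_gram_ratio[OF w] v wirtinger_C2_mult[OF C0 C1]])
      (use nz in simp)
  also have "log_laplacian (\<lambda>z. cinner (x0 z) (x0 z) * cinner (x1 z) (x1 z)) w =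
      log_laplacian (\<lambda>z. cinner (x0 z) (x0 z)) w + log_laplacian (\<lambda>z. cinner (x1 z) (x1 z)) w"
    by (rule log_laplacian_mult[OF C0 nz(1) C1 nz(2)])
  finally show ?thesis
    unfolding trace_curvature_block[OF F wr] line_curvature_T0[OF F wr] line_curvature_T1[OF F wr]
    by simp
qed

text \<open>With \<open>\<rho> = (norm (S t))\<^sup>2 / (norm t)\<^sup>2\<close> and
  \<open>v = 1 + \<rho> * k\<close> the square is
  \<open>k\<^sup>2 / (1 / \<rho> + k) = k * (v - 1) / v\<close>. Where \<open>S t = 0\<close> the
  prescribed value 0 fits the same formula, since there \<open>v = 1\<close>.\<close>

lemma second_fundamental_form_square:
  assumes z: "z \<in> \<Omega>" and k: "line_curvature \<Omega> T0 z = - complex_of_real k" "k > 0"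
    and v: "\<And>x1. x1 \<noteq> 0 \<Longrightarrow> T1 x1 = z *\<^sub>C x1 \<Longrightarrow> gram_ratio z = 1 + (norm (S x1))\<^sup>2 / (norm x1)\<^sup>2 * k"
  shows "(second_fundamental_form \<Omega> T0 S T1 z)\<^sup>2 = complex_of_real (k * (gram_ratio z - 1) / gram_ratio z)"
proof -
  obtain r x0 x0' x1 x1' y y' where r: "r > 0" and F: "triple_frame (ball z r) x0 x0' x1 x1' y y'"
    using triple_frame_exists[OF z] by blast
  have zr: "z \<in> ball z r" using r by simp
  define t where "t = local_section \<Omega> T1 z z"
  define \<rho> where "\<rho> = (norm (S t))\<^sup>2 / (norm t)\<^sup>2"
  have t: "t \<noteq> 0" "T1 t = z *\<^sub>C t" using local_section_T1[OF F zr] by (simp_all add: t_def)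
  have vt: "gram_ratio z = 1 + \<rho> * k" using v[OF t] by (simp add: \<rho>_def)
  show ?thesis
  proof (cases "S t = 0")
    case True
    then show ?thesis using vt by (simp add: second_fundamental_form_def Let_def t_def[symmetric] \<rho>_def)
  next
    case False
    then have \<rho>: "\<rho> > 0" using t by (simp add: \<rho>_def)
    have "(norm t)\<^sup>2 / (norm (S t))\<^sup>2 = 1 / \<rho>" by (simp add: \<rho>_def)
    then have "second_fundamental_form \<Omega> T0 S T1 z =
        - complex_of_real k / csqrt (complex_of_real (1 / \<rho>) - (- complex_of_real k))"
      using False unfolding second_fundamental_form_def Let_def t_def[symmetric] k(1) by simp
    then have "(second_fundamental_form \<Omega> T0 S T1 z)\<^sup>2 = (complex_of_real k)\<^sup>2 / complex_of_real (1 / \<rho> + k)"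
      by (simp add: power_divide)
    also have "\<dots> = complex_of_real (k\<^sup>2 / (1 / \<rho> + k))" by simp
    also have "k\<^sup>2 / (1 / \<rho> + k) = k * (gram_ratio z - 1) / gram_ratio z"
    proof -
      have "1 + \<rho> * k > 0" using \<rho> k(2) by (simp add: add_pos_pos)
      moreover have "1 / \<rho> + k = (1 + \<rho> * k) / \<rho>" using \<rho> by (simp add: field_simps)
      ultimately show ?thesis unfolding vt using \<rho> by (simp add: power2_eq_square)
    qed
    finally show ?thesis .
  qed
qed

text \<open>Write \<open>v\<close> for the Gram ratio. Clearing denominators, legitimate because
  \<open>m > 1\<close> and \<open>v \<ge> 1\<close>, leaves \<open>k * (v - m) = 0\<close> with
  \<open>k > 0\<close>.\<close>

lemma fundamental_form_equation_iff:
  assumes z: "z \<in> \<Omega>" and m: "m > 1"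
  shows "line_curvature \<Omega> T0 z = complex_of_real (m / (1 - m)) * (second_fundamental_form \<Omega> T0 S T1 z)\<^sup>2
    \<longleftrightarrow> gram_ratio z = m"
proof -
  obtain k where k: "k > 0" "line_curvature \<Omega> T0 z = - complex_of_real k"
    and v: "\<And>x1. x1 \<noteq> 0 \<Longrightarrow> T1 x1 = z *\<^sub>C x1 \<Longrightarrow> gram_ratio z = 1 + (norm (S x1))\<^sup>2 / (norm x1)\<^sup>2 * k"
    using curvature_gram_ratio[OF z] by blast
  have sq: "(second_fundamental_form \<Omega> T0 S T1 z)\<^sup>2 = complex_of_real (k * (gram_ratio z - 1) / gram_ratio z)"
    by (rule second_fundamental_form_square[OF z k(2,1)]) (rule v)
  define v where "v = gram_ratio z"
  have v1: "v \<ge> 1" using gram_ratio_ge_1[OF z] by (simp add: v_def)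
  have "line_curvature \<Omega> T0 z = complex_of_real (m / (1 - m)) * (second_fundamental_form \<Omega> T0 S T1 z)\<^sup>2 \<longleftrightarrow>
      complex_of_real (- k) = complex_of_real (m / (1 - m) * (k * (v - 1) / v))"
    unfolding sq k(2) v_def by simp
  also have "\<dots> \<longleftrightarrow> - k = m / (1 - m) * (k * (v - 1) / v)" by (rule of_real_eq_iff)
  also have "\<dots> \<longleftrightarrow> - k * ((1 - m) * v) = m * (k * (v - 1))"
    using m v1 by (simp add: field_simps)
  also have "\<dots> \<longleftrightarrow> k * (v - m) = 0" by (auto simp: algebra_simps)
  also have "\<dots> \<longleftrightarrow> v = m" using k by simp
  finally show ?thesis by (simp add: v_def)
qed

text \<open>A ratio identically 1 makes \<open>S\<close> vanish on every eigenvector of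
  \<open>T1\<close> over \<open>\<Omega>\<close>, because \<open>k > 0\<close>. These eigenvectors
  span a dense subspace and \<open>S\<close> is continuous.\<close>

lemma exists_gram_ratio_gt_1: "\<exists>z\<in>\<Omega>. gram_ratio z \<noteq> 1"
proof (rule ccontr)
  assume "\<not> ?thesis"
  then have one: "gram_ratio z = 1" if "z \<in> \<Omega>" for z using that by blast
  have "S x = 0" if z: "z \<in> \<Omega>" and x: "T1 x = z *\<^sub>C x" for z x
  proof (cases "x = 0")
    case True
    then show ?thesis using clinear(2) by (simp add: bounded_clinear_def linear_simps)
  next
    case False
    then show ?thesis using curvature_gram_ratio[OF z] one[OF z] x by auto
  qed
  then have "(\<Union>w\<in>\<Omega>. kernel (shift_op T1 w)) \<subseteq> {x. S x = 0}"
    by (auto simp: kernel_shift_op_iff)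
  moreover have "cvec.subspace {x. S x = 0}"
    using clinear(2) by (auto simp: cvec.subspace_def bounded_clinear_def linear_simps)
  ultimately have "cvec.span (\<Union>w\<in>\<Omega>. kernel (shift_op T1 w)) \<subseteq> {x. S x = 0}"
    by (rule cvec.span_minimal)
  moreover have "closed {x. S x = 0}"
    using clinear(2) by (intro closed_Collect_eq continuous_on_const)
      (simp add: bounded_clinear_def linear_continuous_on)
  ultimately have "closure (cvec.span (\<Union>w\<in>\<Omega>. kernel (shift_op T1 w))) \<subseteq> {x. S x = 0}"
    by (rule closure_minimal)
  then have "S = (\<lambda>_. 0)" using T1 by (auto simp: cowen_douglas_def)
  then show False using S_nonzero by blast
qed

text \<open>
  Polarizing \<open>gram_ratio = cmod e\<^sup>2\<close> at \<open>w\<close> shows that \<open>e\<close> is, up to a constant, the quotient of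
  the pairings of the fibres over \<open>z\<close> and \<open>w\<close>; this quotient is defined on all of \<open>\<Omega>\<close>.
\<close>

lemma gram_ratio_norm_square:
  assumes conn: "connected \<Omega>"
    and harm: "\<And>z. z \<in> \<Omega> \<Longrightarrow> log_laplacian (\<lambda>z. complex_of_real (gram_ratio z)) z = 0"
  shows "\<exists>\<phi>. \<phi> holomorphic_on \<Omega> \<and> (\<forall>z\<in>\<Omega>. (cmod (\<phi> z))\<^sup>2 = gram_ratio z)"
proof -
  obtain w where w: "w \<in> \<Omega>" using exists_gram_ratio_gt_1 by blast
  have pos: "gram_ratio z > 0" if "z \<in> \<Omega>" for z using gram_ratio_ge_1[OF that] by simp
  have root: "\<exists>e. e holomorphic_on ball p r \<and> (\<forall>z\<in>ball p r. e z \<noteq> 0 \<and> gram_ratio z = (cmod (e z))\<^sup>2)"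
    if "ball p r \<subseteq> \<Omega>" "r > 0" for p r
    by (rule log_harmonic_is_norm_square[OF wirtinger_C2_gram_ratio pos harm that(2)]) (use that in auto)
  obtain R a0 a0' a1 a1' b b' where R: "R > 0" and A: "triple_frame (ball w R) a0 a0' a1 a1' b b'"
    using triple_frame_exists[OF w] by blast
  note AD = triple_frameD[OF A]
  have wR: "w \<in> ball w R" using R by simp
  have ta: "eigentriple w (a0 w) (a1 w) (b w)" by (rule AD(6)[OF wR])
  \<comment> \<open>The numerator pairs the fibres over \<open>z\<close> and \<open>w\<close>. A
    change of triple at \<open>z\<close> multiplies numerator and denominator by the same factor, so
    \<open>c\<close> does not depend on the triple.\<close>
  define Q where "Q z c \<longleftrightarrow> (\<exists>x0 x1 y. eigentriple z x0 x1 y \<and>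
      cinner x0 (a0 w) * cinner x1 (a1 w) \<noteq> 0 \<and>
      c = pairing_det x0 x1 y (a0 w) (a1 w) (b w) / (cinner x0 (a0 w) * cinner x1 (a1 w)))" for z c
  define \<Phi> where "\<Phi> z = (SOME c. Q z c)" for z
  define G where "G = {z \<in> \<Omega>. \<exists>c. Q z c}"
  have G: "cinner x0 (a0 w) * cinner x1 (a1 w) \<noteq> 0 \<longleftrightarrow> z \<in> G"
    and \<Phi>: "z \<in> G \<longrightarrow> pairing_det x0 x1 y (a0 w) (a1 w) (b w) = \<Phi> z * (cinner x0 (a0 w) * cinner x1 (a1 w))"
    if z: "z \<in> \<Omega>" and t: "eigentriple z x0 x1 y" for z x0 x1 y
  proof -
    have "cinner x0 (a0 w) * cinner x1 (a1 w) \<noteq> 0 \<and>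
        pairing_det x0 x1 y (a0 w) (a1 w) (b w) = c * (cinner x0 (a0 w) * cinner x1 (a1 w))" if "Q z c" for c
    proof -
      obtain u0 u1 v where u: "eigentriple z u0 u1 v" "cinner u0 (a0 w) * cinner u1 (a1 w) \<noteq> 0"
          "c = pairing_det u0 u1 v (a0 w) (a1 w) (b w) / (cinner u0 (a0 w) * cinner u1 (a1 w))"
        using \<open>Q z c\<close> unfolding Q_def by blast
      obtain f g h where fgh: "f \<noteq> 0" "g \<noteq> 0" "x0 = f *\<^sub>C u0" "x1 = g *\<^sub>C u1" "y = g *\<^sub>C v + h *\<^sub>C u0"
        using eigentriple_gauge[OF z u(1) t] by blast
      show ?thesis
        unfolding fgh(3-5) pairing_det_gauge_left cinner_cscale_left using u(2,3) fgh(1,2) by simp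
    qed
    moreover have "Q z (\<Phi> z)" if "z \<in> G"
      using that unfolding G_def \<Phi>_def by (auto intro: someI)
    ultimately show "z \<in> G \<longrightarrow> pairing_det x0 x1 y (a0 w) (a1 w) (b w) = \<Phi> z * (cinner x0 (a0 w) * cinner x1 (a1 w))"
      and "cinner x0 (a0 w) * cinner x1 (a1 w) \<noteq> 0 \<longleftrightarrow> z \<in> G"
      using z t unfolding G_def Q_def by blast+
  qed
  obtain e where e: "e holomorphic_on ball w R" "\<And>z. z \<in> ball w R \<Longrightarrow> e z \<noteq> 0 \<and> gram_ratio z = (cmod (e z))\<^sup>2"
    using root[OF AD(2) R] by blast
  \<comment> \<open>On the diagonal this is the equation
    \<open>gram_ratio z = (cmod (e z))\<^sup>2\<close> multiplied out, so \<open>F\<close> vanishes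
    there.\<close>
  define F where "F z u = pairing_det (a0 z) (a1 z) (b z) (a0 u) (a1 u) (b u) -
      (e z * cnj (e u)) * (cinner (a0 z) (a0 u) * cinner (a1 z) (a1 u))" for z u
  have da: "\<And>z. z \<in> ball w R \<Longrightarrow> has_cderiv a0 (a0' z) z" "\<And>z. z \<in> ball w R \<Longrightarrow> has_cderiv a1 (a1' z) z"
      "\<And>z. z \<in> ball w R \<Longrightarrow> has_cderiv b (b' z) z"
    using AD(3-5) unfolding twice_cdiff_on_def by blast+
  have F: "sesquiholomorphic_on F (ball w R)"
    unfolding F_def pairing_det_def
    by (intro sesquiholomorphic_on_diff sesquiholomorphic_on_mult sesquiholomorphic_on_add
        sesquiholomorphic_on_holomorphic[OF e(1) open_ball]
        sesquiholomorphic_on_cinner[OF da(1) da(1)] sesquiholomorphic_on_cinner[OF da(1) da(3)]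
        sesquiholomorphic_on_cinner[OF da(2) da(2)] sesquiholomorphic_on_cinner[OF da(3) da(1)]
        sesquiholomorphic_on_cinner[OF da(3) da(3)])
  have diag: "F z z = 0" if "z \<in> ball w R" for z
    using gram_ratio_frame[OF A that] e(2)[OF that] unfolding F_def complex_norm_square[symmetric] by simp
  have Fw: "F z w = 0" if "z \<in> ball w R" for z
    by (rule polarization[OF F diag that])
  have \<Phi>w: "\<Phi> z = e z * cnj (e w)" if "z \<in> ball w R" "z \<in> G" for z
  proof -
    have z: "z \<in> \<Omega>" using AD(2) that by blast
    note t = AD(6)[OF that(1)]
    show ?thesis
      using \<Phi>[OF z t] G[OF z t] Fw[OF that(1)] that(2) by (simp add: F_def)
  qed
  show ?thesis
  proof (rule global_norm_square_root[OF open_\<Omega> conn w _ _ R _ pos[OF w]])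
    show "w \<in> G" using G[OF w ta] ta by (simp add: eigentriple_def)
    \<comment> \<open>Here \<open>\<kappa>\<close> is \<open>gram_ratio w\<close>, the squared
      modulus of the constant \<open>cnj (e w)\<close> relating \<open>\<Phi>\<close> to
      \<open>e\<close>.\<close>
    show "(cmod (\<Phi> z))\<^sup>2 = gram_ratio w * gram_ratio z" if "z \<in> ball w R" "z \<in> G" for z
      using \<Phi>w[OF that] e(2)[OF that(1)] e(2)[OF wR] by (simp add: norm_mult power_mult_distrib)
    fix p assume p: "p \<in> \<Omega>"
    obtain r x0 x0' x1 x1' y y' where r: "r > 0" and X: "triple_frame (ball p r) x0 x0' x1 x1' y y'"
      using triple_frame_exists[OF p] by blast
    note XD = triple_frameD[OF X]
    obtain e where e: "e holomorphic_on ball p r" "\<forall>z\<in>ball p r. e z \<noteq> 0 \<and> gram_ratio z = (cmod (e z))\<^sup>2"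
      using root[OF XD(2) r] by blast
    have hol: "(\<lambda>z. cinner (f z) c) holomorphic_on ball p r" if "twice_cdiff_on f f' (ball p r)"
      for f f' :: "complex \<Rightarrow> 'c::complex_hilbert_space" and c
      using that has_cderiv_cinner unfolding holomorphic_on_open[OF open_ball] twice_cdiff_on_def by blast
    have N: "(\<lambda>z. pairing_det (x0 z) (x1 z) (y z) (a0 w) (a1 w) (b w)) holomorphic_on ball p r"
      unfolding pairing_det_def by (intro holomorphic_intros hol[OF XD(3)] hol[OF XD(4)] hol[OF XD(5)])
    have D: "(\<lambda>z. cinner (x0 z) (a0 w) * cinner (x1 z) (a1 w)) holomorphic_on ball p r"
      by (intro holomorphic_intros hol[OF XD(3)] hol[OF XD(4)])
    have "\<forall>z\<in>ball p r. (e z \<noteq> 0 \<and> gram_ratio z = (cmod (e z))\<^sup>2) \<and>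
        ((cinner (x0 z) (a0 w) * cinner (x1 z) (a1 w)) \<noteq> 0 \<longleftrightarrow> z \<in> G) \<and>
        (z \<in> G \<longrightarrow> pairing_det (x0 z) (x1 z) (y z) (a0 w) (a1 w) (b w) =
           \<Phi> z * (cinner (x0 z) (a0 w) * cinner (x1 z) (a1 w)))"
    proof
      fix z assume z: "z \<in> ball p r"
      then have "z \<in> \<Omega>" using XD(2) by blast
      from e(2)[rule_format, OF z] G[OF this XD(6)[OF z]] \<Phi>[OF this XD(6)[OF z]]
      show "(e z \<noteq> 0 \<and> gram_ratio z = (cmod (e z))\<^sup>2) \<and>
        ((cinner (x0 z) (a0 w) * cinner (x1 z) (a1 w)) \<noteq> 0 \<longleftrightarrow> z \<in> G) \<and>
        (z \<in> G \<longrightarrow> pairing_det (x0 z) (x1 z) (y z) (a0 w) (a1 w) (b w) =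
           \<Phi> z * (cinner (x0 z) (a0 w) * cinner (x1 z) (a1 w)))" by blast
    qed
    from conjI[OF N conjI[OF D conjI[OF e(1) this]]]
    have "\<exists>N D e. N holomorphic_on ball p r \<and> D holomorphic_on ball p r \<and> e holomorphic_on ball p r \<and>
        (\<forall>z\<in>ball p r. (e z \<noteq> 0 \<and> gram_ratio z = (cmod (e z))\<^sup>2) \<and> (D z \<noteq> 0 \<longleftrightarrow> z \<in> G) \<and>
           (z \<in> G \<longrightarrow> N z = \<Phi> z * D z))"
      by (intro exI)
    then show "\<exists>r>0. ball p r \<subseteq> \<Omega> \<and> (\<exists>N D e. N holomorphic_on ball p r \<and>
        D holomorphic_on ball p r \<and> e holomorphic_on ball p r \<and>
        (\<forall>z\<in>ball p r. (e z \<noteq> 0 \<and> gram_ratio z = (cmod (e z))\<^sup>2) \<and> (D z \<noteq> 0 \<longleftrightarrow> z \<in> G) \<and>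
           (z \<in> G \<longrightarrow> N z = \<Phi> z * D z)))"
      using r XD(2) by blast
  qed
qed

lemma norm_root_gt_1:
  assumes conn: "connected \<Omega>" and \<phi>: "\<phi> holomorphic_on \<Omega>"
    and v: "\<And>z. z \<in> \<Omega> \<Longrightarrow> (cmod (\<phi> z))\<^sup>2 = gram_ratio z" and w: "w \<in> \<Omega>"
  shows "cmod (\<phi> w) > 1"
proof (rule ccontr)
  assume "\<not> cmod (\<phi> w) > 1"
  have ge: "cmod (\<phi> z) \<ge> 1" if "z \<in> \<Omega>" for z
    using v[OF that] gram_ratio_ge_1[OF that] power2_le_imp_le[of 1 "cmod (\<phi> z)"] by simp
  then have w1: "cmod (\<phi> w) = 1" using w \<open>\<not> cmod (\<phi> w) > 1\<close> by fastforce
  have nz: "\<phi> z \<noteq> 0" if "z \<in> \<Omega>" for z using ge[OF that] by auto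
  \<comment> \<open>A minimum of the modulus of \<open>\<phi>\<close> is a maximum for the
    reciprocal.\<close>
  have "(\<lambda>z. 1 / \<phi> z) constant_on \<Omega>"
  proof (rule maximum_modulus_principle[OF _ open_\<Omega> conn open_\<Omega> order_refl w])
    show "(\<lambda>z. 1 / \<phi> z) holomorphic_on \<Omega>" using \<phi> nz by (intro holomorphic_intros)
    show "cmod (1 / \<phi> z) \<le> cmod (1 / \<phi> w)" if "z \<in> \<Omega>" for z
      using ge[OF that] w1 by (simp add: norm_divide divide_le_eq_1)
  qed
  then obtain c where c: "\<And>z. z \<in> \<Omega> \<Longrightarrow> 1 / \<phi> z = c" by (auto simp: constant_on_def)
  have "gram_ratio z = 1" if "z \<in> \<Omega>" for z
  proof -
    have "1 / \<phi> z = 1 / \<phi> w" using c that w by simp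
    then have "\<phi> z = \<phi> w" by simp
    then show ?thesis using v[OF that] w1 by simp
  qed
  then show False using exists_gram_ratio_gt_1 by blast
qed

lemma log_laplacian_gram_ratio_norm_square:
  assumes \<phi>: "\<phi> holomorphic_on \<Omega>" and v: "\<And>z. z \<in> \<Omega> \<Longrightarrow> (cmod (\<phi> z))\<^sup>2 = gram_ratio z" and w: "w \<in> \<Omega>"
  shows "log_laplacian (\<lambda>z. complex_of_real (gram_ratio z)) w = 0"
proof -
  have nz: "\<phi> w \<noteq> 0" using v[OF w] gram_ratio_ge_1[OF w] by auto
  have "log_laplacian (\<lambda>z. complex_of_real (gram_ratio z)) w = log_laplacian (\<lambda>z. \<phi> z * cnj (\<phi> z)) w"
    by (rule log_laplacian_cong[OF open_\<Omega> w]) (simp only: v[symmetric] complex_norm_square)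
  also have "\<dots> = log_laplacian \<phi> w + log_laplacian (\<lambda>z. cnj (\<phi> z)) w"
    by (rule log_laplacian_mult[OF wirtinger_C2_holomorphic[OF \<phi> open_\<Omega> w] nz wirtinger_C2_cnj[OF \<phi> open_\<Omega> w]])
      (use nz in simp)
  also have "\<dots> = 0"
    using log_laplacian_holomorphic[OF \<phi> open_\<Omega> w nz] log_laplacian_cnj[OF \<phi> open_\<Omega> w] by simp
  finally show ?thesis .
qed

end

theorem proposition1p4:
  fixes \<Omega> :: "complex set"
    and T0 :: "'a::{complex_hilbert_space, second_countable_topology} \<Rightarrow> 'a"
    and T1 :: "'b::{complex_hilbert_space, second_countable_topology} \<Rightarrow> 'b"
    and S01 :: "'b \<Rightarrow> 'a"
  assumes "open \<Omega>" and "connected \<Omega>"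
    and "FB2 \<Omega> T0 S01 T1"
  shows "(\<forall>w\<in>\<Omega>. trace (curvature \<Omega> (block_op T0 S01 T1) w :: complex^2^2) =
                   line_curvature \<Omega> T0 w + line_curvature \<Omega> T1 w) \<longleftrightarrow>
         (\<exists>\<phi>. \<phi> holomorphic_on \<Omega> \<and> (\<forall>w\<in>\<Omega>. cmod (\<phi> w) > 1) \<and>
              (\<forall>w\<in>\<Omega>. line_curvature \<Omega> T0 w =
                 complex_of_real ((cmod (\<phi> w))\<^sup>2 / (1 - (cmod (\<phi> w))\<^sup>2)) *
                 (second_fundamental_form \<Omega> T0 S01 T1 w)\<^sup>2))"
    (is "?trace \<longleftrightarrow> (\<exists>\<phi>. ?\<phi> \<phi>)")
proof -
  interpret FB2_operator \<Omega> T0 T1 S01 using assms by unfold_locales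
  have trace: "?trace \<longleftrightarrow> (\<forall>w\<in>\<Omega>. log_laplacian (\<lambda>z. complex_of_real (gram_ratio z)) w = 0)"
    using trace_curvature_gram_ratio by simp
  \<comment> \<open>The bound on \<open>\<phi>\<close> in the second conjunct is available when the
    third is rewritten; \<open>fundamental_form_equation_iff\<close> requires \<open>m > 1\<close>
    for \<open>m = (cmod (\<phi> w))\<^sup>2\<close>.\<close>
  have root: "?\<phi> \<phi> \<longleftrightarrow> \<phi> holomorphic_on \<Omega> \<and> (\<forall>w\<in>\<Omega>. cmod (\<phi> w) > 1) \<and> (\<forall>w\<in>\<Omega>. (cmod (\<phi> w))\<^sup>2 = gram_ratio w)" for \<phi>
  proof (intro conj_cong refl ball_cong)
    fix w assume gt: "\<forall>w\<in>\<Omega>. cmod (\<phi> w) > 1" and w: "w \<in> \<Omega>"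
    have "(cmod (\<phi> w))\<^sup>2 > 1" using gt w by (simp add: one_less_power)
    from fundamental_form_equation_iff[OF w this]
    show "(line_curvature \<Omega> T0 w = complex_of_real ((cmod (\<phi> w))\<^sup>2 / (1 - (cmod (\<phi> w))\<^sup>2)) *
        (second_fundamental_form \<Omega> T0 S01 T1 w)\<^sup>2) \<longleftrightarrow> ((cmod (\<phi> w))\<^sup>2 = gram_ratio w)" by auto
  qed
  show ?thesis
  proof
    assume ?trace
    then obtain \<phi> where \<phi>: "\<phi> holomorphic_on \<Omega>" "\<And>z. z \<in> \<Omega> \<Longrightarrow> (cmod (\<phi> z))\<^sup>2 = gram_ratio z"
      using gram_ratio_norm_square[OF assms(2)] trace by blast
    moreover have "cmod (\<phi> w) > 1" if "w \<in> \<Omega>" for w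
      by (rule norm_root_gt_1[OF assms(2) \<phi> that])
    ultimately show "\<exists>\<phi>. ?\<phi> \<phi>" using root by blast
  next
    assume "\<exists>\<phi>. ?\<phi> \<phi>"
    then obtain \<phi> where "\<phi> holomorphic_on \<Omega>" "\<And>z. z \<in> \<Omega> \<Longrightarrow> (cmod (\<phi> z))\<^sup>2 = gram_ratio z"
      using root by blast
    then show ?trace using trace log_laplacian_gram_ratio_norm_square by blast
  qed
qed

end
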